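(* Let $\Gamma$ be a Coxeter diagram and $J\subseteq\Gamma_0$. Let $(x,I),(y,K)\in\mathrm{Cham}(J)$. Any two geodesic paths $p,p':(x,I)\to(y,K)$ in the hyperplane arrangement $(\mathrm{Cone}(J)^\circ,\mathcal H^J)$ are related by a finite sequence of codimension two relations.
   Context: Coxeter notation. $\Gamma$ is a Coxeter diagram with finite vertex set $\Gamma_0$; $W$ its Coxeter group with simple generators $s_i$ and length $\ell$; $V=\bigoplus_{i\in\Gamma_0}\mathbb R\alpha_i$ the standard geometric representation, $\Phi=\Phi^+\sqcup\Phi^-$ the roots, $\Theta=V^*$ the contragredient representation. For $I\subseteq\Gamma_0$: $I^c=\Gamma_0\setminus I$, $I+a=I\cup\{a\}$, $I-a=I\setminus\{a\}$, $W_I=\langle s_i:i\in I\rangle$, $\Phi_I=\{w\cdot\alpha_i:i\in I,w\in W_I\}$, $\Phi_I^\pm=\Phi_I\cap\Phi^\pm$. Tits cone intersection. $H_\alpha=\{\varphi\in\Theta:\varphi(\alpha)=0\}$; $C=\{\varphi\in\Theta:\varphi(\alpha_i)>0\ \forall i\}$; $\mathrm{Cone}=\bigcup_{w\in W}w\cdot\overline C$; $\Theta_I=\{\varphi:\varphi(\alpha_i)=0\ \forall i\in I\}$; $C_I=\{\varphi\in\Theta_I:\varphi(\alpha_j)>0\ \forall j\in I^c\}$; $\mathrm{Cone}(J)=\mathrm{Cone}\cap\Theta_J$, with interior $\mathrm{Cone}(J)^\circ$ in $\Theta_J$; $\mathcal H^J=\{H_\alpha\cap\Theta_J:\alpha\in\Phi,\Theta_J\not\subseteq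 H_\alpha\}$. Chambers are the connected components of $\mathrm{Cone}(J)^\circ\setminus\bigcup_{H\in\mathcal H^J}H$; by Iyama--Wemyss they are in bijection, via $(x,I)\mapsto x\cdot C_I$, with $\mathrm{Cham}(J)=\{(x,I):W_Jx=xW_I,\ x\text{ of minimal length in }xW_I\}$. Paths. Two distinct chambers are adjacent if they share a common wall (codimension-one intersection of the closure with a hyperplane of $\mathcal H^J$). A path is a finite sequence of chambers with consecutive ones adjacent; it is geodesic if it crosses the minimal number of walls between its endpoints, equivalently if it crosses each hyperplane of $\mathcal H^J$ at most once. For $a\in I^c$, $[I,a]$ is the vertex set of the component containing $a$ of the full subgraph of $\Gamma$ on $I+a$. For $W_K$ finite, $w_K$ is its longest element and $w_K\cdot\alpha_k=-\alpha_{\iota_K(k)}$. If $W_{[I,a]}$ is finite, $v_{a,I}=w_{[I,a]-a}w_{[I,a]}$. Adjacent chambers $(x,I),(y,K)$ are related by a simple wall crossing: $(y,K)=\omega_{a,I}(x,I):=(xv_{a,I},I+a-\iota_{[I,a]}(a))$ for a unique $a\in I^c$, with $W_{[I,a]}$ finite. Codimension two relations. Let $(x,I)\in\mathrm{Cham}(J)$ and $a\neq b$ in $I^c$ with $|\Phi_{I+a+b}\setminus\Phi_I|<\infty$. Let $v_{a,b,I}\in W_{I+a+b}$ be the inverse of the unique $u\in W_{I+a+b}$ with $u(\Phi^+_{I+a+b}\setminus\Phi_I^+)\subseteq\Phi^-_{I+a+b}$ and $u(\Phi^+_I)\subseteq\Phi^+_{I+a+b}$. Then there is $K\subseteq\Gamma_0$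 such that $(xv_{a,b,I},K)$ is a chamber and there are exactly two geodesic paths from $(x,I)$ to it; they have the same length, one begins with the simple wall crossing $\omega_{a,I}$ and the other with $\omega_{b,I}$. The relation equating these two geodesic paths is a codimension two relation; applying it to a path means replacing a consecutive subpath equal to one of the two by the other. *)

theory Defs
  imports
    "HOL-Analysis.Analysis"
    "HOL-Library.Extended_Nat"
    "HOL-Algebra.Generated_Groups"
begin

text \<open>
  The vertex set of the diagram is the finite type \<open>'v\<close>, and the diagram is given by its Coxeter
  matrix \<open>m\<close>.
\<close>

definition coxeter_matrix :: "('v::finite \<Rightarrow> 'v \<Rightarrow> enat) \<Rightarrow> bool" where
  "coxeter_matrix m \<longleftrightarrow>
     (\<forall>i. m i i = 1) \<and> (\<forall>i j. m i j = m j i) \<and> (\<forall>i j. i \<noteq> j \<longrightarrow> 2 \<le> m i j)"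

context
  fixes m :: "'v::finite \<Rightarrow> 'v \<Rightarrow> enat"
begin

subsection \<open>The Coxeter group\<close>

text \<open>
  The congruence on words generated by \<open>(i j)^(m i j) = 1\<close> for \<open>m i j \<noteq> \<infinity>\<close>. The case \<open>i = j\<close> gives
  \<open>i i = 1\<close>, so the quotient of the free monoid is the group with this presentation.
\<close>

inductive word_eq :: "'v list \<Rightarrow> 'v list \<Rightarrow> bool" where
  refl: "word_eq u u"
| sym: "word_eq u v \<Longrightarrow> word_eq v u"
| trans: "word_eq u v \<Longrightarrow> word_eq v w \<Longrightarrow> word_eq u w"
| rel: "m i j = enat k \<Longrightarrow> word_eq (u @ concat (replicate k [i, j]) @ v) (u @ v)"

definition word_class :: "'v list \<Rightarrow> 'v list set" where
  "word_class u = {v. word_eq u v}"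

definition cox_group :: "'v list set monoid" where
  "cox_group = \<lparr>carrier = range word_class,
     mult = (\<lambda>g h. \<Union>u\<in>g. \<Union>v\<in>h. word_class (u @ v)),
     one = word_class []\<rparr>"

definition simple_gen :: "'v \<Rightarrow> 'v list set" where
  "simple_gen i = word_class [i]"

definition cox_length :: "'v list set \<Rightarrow> nat" where
  "cox_length w = (LEAST n. \<exists>u\<in>w. length u = n)"

definition parabolic :: "'v set \<Rightarrow> 'v list set set" where
  "parabolic I = generate cox_group (simple_gen ` I)"

subsection \<open>The geometric representation and its contragredient\<close>

definition simple_root :: "'v \<Rightarrow> real^'v" where
  "simple_root i = axis i 1"

definition cox_coeff :: "'v \<Rightarrow> 'v \<Rightarrow> real" where
  "cox_coeff i j = (case m i j of enat k \<Rightarrow> - cos (pi / real k) | \<infinity> \<Rightarrow> - 1)"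

definition cox_form :: "real^'v \<Rightarrow> real^'v \<Rightarrow> real" where
  "cox_form u v = (\<Sum>i\<in>UNIV. \<Sum>j\<in>UNIV. u $ i * v $ j * cox_coeff i j)"

definition simple_refl :: "'v \<Rightarrow> real^'v \<Rightarrow> real^'v" where
  "simple_refl i v = v - (2 * cox_form (simple_root i) v) *\<^sub>R simple_root i"

text \<open>
  The defining relations of the group hold for the simple reflections when \<open>m\<close> is a Coxeter matrix,
  so the choice of a representing word does not matter.
\<close>

definition act :: "'v list set \<Rightarrow> real^'v \<Rightarrow> real^'v" where
  "act w v = foldr simple_refl (SOME u. u \<in> w) v"

text \<open>
  The dual space is identified with \<open>real^'v\<close> by the basis dual to the simple roots: \<open>\<phi> $ i\<close> is the
  value of \<open>\<phi>\<close> at \<open>simple_root i\<close>, and the value of \<open>\<phi>\<close> at \<open>v\<close> is \<open>\<phi> \<bullet> v\<close>. Hence \<open>dual_act w \<phi>\<close> is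
  the functional \<open>v \<mapsto> \<phi> (w\<inverse> v)\<close>.
\<close>

definition dual_act :: "'v list set \<Rightarrow> real^'v \<Rightarrow> real^'v" where
  "dual_act w \<phi> = (\<chi> i. \<phi> \<bullet> act (inv\<^bsub>cox_group\<^esub> w) (simple_root i))"

definition roots :: "(real^'v) set" where
  "roots = {act w (simple_root i) | w i. w \<in> carrier cox_group}"

definition pos_roots :: "(real^'v) set" where
  "pos_roots = {r \<in> roots. \<forall>i. 0 \<le> r $ i}"

definition neg_roots :: "(real^'v) set" where
  "neg_roots = {r \<in> roots. \<forall>i. r $ i \<le> 0}"

definition roots_of :: "'v set \<Rightarrow> (real^'v) set" where
  "roots_of I = {act w (simple_root i) | w i. i \<in> I \<and> w \<in> parabolic I}"

definition pos_roots_of :: "'v set \<Rightarrow> (real^'v) set" where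
  "pos_roots_of I = roots_of I \<inter> pos_roots"

definition neg_roots_of :: "'v set \<Rightarrow> (real^'v) set" where
  "neg_roots_of I = roots_of I \<inter> neg_roots"

subsection \<open>The Tits cone intersection\<close>

definition root_hyp :: "real^'v \<Rightarrow> (real^'v) set" where
  "root_hyp r = {\<phi>. \<phi> \<bullet> r = 0}"

definition fund_chamber :: "(real^'v) set" where
  "fund_chamber = {\<phi>. \<forall>i. 0 < \<phi> \<bullet> simple_root i}"

definition tits_cone :: "(real^'v) set" where
  "tits_cone = (\<Union>w\<in>carrier cox_group. dual_act w ` closure fund_chamber)"

definition Theta :: "'v set \<Rightarrow> (real^'v) set" where
  "Theta I = {\<phi>. \<forall>i\<in>I. \<phi> \<bullet> simple_root i = 0}"

definition open_face :: "'v set \<Rightarrow> (real^'v) set" where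
  "open_face I = {\<phi> \<in> Theta I. \<forall>j\<in>-I. 0 < \<phi> \<bullet> simple_root j}"

definition cone_interior :: "'v set \<Rightarrow> (real^'v) set" where
  "cone_interior J = top_of_set (Theta J) interior_of (tits_cone \<inter> Theta J)"

definition arrangement :: "'v set \<Rightarrow> (real^'v) set set" where
  "arrangement J = {root_hyp r \<inter> Theta J | r. r \<in> roots \<and> \<not> Theta J \<subseteq> root_hyp r}"

definition chambers :: "'v set \<Rightarrow> (real^'v) set set" where
  "chambers J = components (cone_interior J - \<Union> (arrangement J))"

definition Cham :: "'v set \<Rightarrow> ('v list set \<times> 'v set) set" where
  "Cham J = {(x, I). x \<in> carrier cox_group \<and>
     parabolic J #>\<^bsub>cox_group\<^esub> x = x <#\<^bsub>cox_group\<^esub> parabolic I \<and>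
     (\<forall>y \<in> x <#\<^bsub>cox_group\<^esub> parabolic I. cox_length x \<le> cox_length y)}"

definition chamber_of :: "'v list set \<times> 'v set \<Rightarrow> (real^'v) set" where
  "chamber_of = (\<lambda>(x, I). dual_act x ` open_face I)"

subsection \<open>Paths\<close>

definition walls :: "'v set \<Rightarrow> (real^'v) set \<Rightarrow> (real^'v) set set" where
  "walls J D = {closure D \<inter> H | H. H \<in> arrangement J \<and>
     aff_dim (closure D \<inter> H) = aff_dim (Theta J) - 1}"

definition adjacent :: "'v set \<Rightarrow> (real^'v) set \<Rightarrow> (real^'v) set \<Rightarrow> bool" where
  "adjacent J D E \<longleftrightarrow> D \<in> chambers J \<and> E \<in> chambers J \<and> D \<noteq> E \<and> walls J D \<inter> walls J E \<noteq> {}"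

definition is_path ::
    "'v set \<Rightarrow> (real^'v) set \<Rightarrow> (real^'v) set \<Rightarrow> (real^'v) set list \<Rightarrow> bool" where
  "is_path J D E p \<longleftrightarrow> p \<noteq> [] \<and> hd p = D \<and> last p = E \<and> set p \<subseteq> chambers J \<and>
     successively (adjacent J) p"

text \<open>Each step of a path crosses one wall, so a path \<open>p\<close> crosses \<open>length p - 1\<close> walls.\<close>

definition geodesic ::
    "'v set \<Rightarrow> (real^'v) set \<Rightarrow> (real^'v) set \<Rightarrow> (real^'v) set list \<Rightarrow> bool" where
  "geodesic J D E p \<longleftrightarrow> is_path J D E p \<and> (\<forall>q. is_path J D E q \<longrightarrow> length p \<le> length q)"

subsection \<open>Simple wall crossings\<close>

text \<open>Distinct vertices \<open>i\<close> and \<open>j\<close> are joined by an edge of the diagram iff \<open>3 \<le> m i j\<close>.\<close>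

definition comp_of :: "'v set \<Rightarrow> 'v \<Rightarrow> 'v set" where
  "comp_of I a =
     {b. (a, b) \<in> {(i, j). i \<in> insert a I \<and> j \<in> insert a I \<and> i \<noteq> j \<and> 3 \<le> m i j}\<^sup>*}"

definition longest :: "'v set \<Rightarrow> 'v list set" where
  "longest K = (THE w. w \<in> parabolic K \<and> (\<forall>u \<in> parabolic K. cox_length u \<le> cox_length w))"

definition iota :: "'v set \<Rightarrow> 'v \<Rightarrow> 'v" where
  "iota K k = (THE j. act (longest K) (simple_root k) = - simple_root j)"

definition cross_elt :: "'v \<Rightarrow> 'v set \<Rightarrow> 'v list set" where
  "cross_elt a I = longest (comp_of I a - {a}) \<otimes>\<^bsub>cox_group\<^esub> longest (comp_of I a)"

definition omega :: "'v \<Rightarrow> 'v list set \<times> 'v set \<Rightarrow> 'v list set \<times> 'v set" where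
  "omega a = (\<lambda>(x, I). (x \<otimes>\<^bsub>cox_group\<^esub> cross_elt a I, insert a I - {iota (comp_of I a) a}))"

text \<open>The crossing \<open>omega a (x, I)\<close> is defined only when \<open>parabolic (comp_of I a)\<close> is finite.\<close>

definition begins_with :: "(real^'v) set list \<Rightarrow> 'v \<Rightarrow> 'v list set \<times> 'v set \<Rightarrow> bool" where
  "begins_with p a = (\<lambda>(x, I). finite (parabolic (comp_of I a)) \<and> 2 \<le> length p \<and>
     p ! 0 = chamber_of (x, I) \<and> p ! 1 = chamber_of (omega a (x, I)))"

subsection \<open>Codimension two relations\<close>

definition codim2_elt :: "'v \<Rightarrow> 'v \<Rightarrow> 'v set \<Rightarrow> 'v list set" where
  "codim2_elt a b I = inv\<^bsub>cox_group\<^esub> (THE u. u \<in> parabolic (I \<union> {a, b}) \<and>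
     act u ` (pos_roots_of (I \<union> {a, b}) - pos_roots_of I) \<subseteq> neg_roots_of (I \<union> {a, b}) \<and>
     act u ` pos_roots_of I \<subseteq> pos_roots_of (I \<union> {a, b}))"

text \<open>This relation is symmetric in \<open>p\<close> and \<open>q\<close>: exchange \<open>a\<close> and \<open>b\<close>.\<close>

definition codim2_rel :: "'v set \<Rightarrow> (real^'v) set list \<Rightarrow> (real^'v) set list \<Rightarrow> bool" where
  "codim2_rel J p q \<longleftrightarrow> (\<exists>x I a b K. (x, I) \<in> Cham J \<and> a \<noteq> b \<and> a \<notin> I \<and> b \<notin> I \<and>
     finite (roots_of (I \<union> {a, b}) - roots_of I) \<and>
     (x \<otimes>\<^bsub>cox_group\<^esub> codim2_elt a b I, K) \<in> Cham J \<and>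
     geodesic J (chamber_of (x, I)) (chamber_of (x \<otimes>\<^bsub>cox_group\<^esub> codim2_elt a b I, K)) p \<and>
     geodesic J (chamber_of (x, I)) (chamber_of (x \<otimes>\<^bsub>cox_group\<^esub> codim2_elt a b I, K)) q \<and>
     begins_with p a (x, I) \<and> begins_with q b (x, I))"

definition codim2_step :: "'v set \<Rightarrow> (real^'v) set list \<Rightarrow> (real^'v) set list \<Rightarrow> bool" where
  "codim2_step J p q \<longleftrightarrow>
     (\<exists>l c d r. p = l @ c @ r \<and> q = l @ d @ r \<and> codim2_rel J c d)"

end

end

theory Submission
  imports Defs
begin

text \<open>
  Two geodesics from \<open>D\<close> to \<open>E\<close> that leave \<open>D = x C\<^bsub>I\<^esub>\<close> through different walls \<open>a\<close> and \<open>b\<close> both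
  cross hyperplanes that separate \<open>D\<close> from \<open>E\<close>. Hence every hyperplane through the codimension two
  face \<open>x C\<^bsub>I+a+b\<^esub>\<close> separates \<open>D\<close> from \<open>E\<close>, and the chamber \<open>F\<close> opposite to \<open>D\<close> at that face lies between
  them. Both geodesics can therefore be moved, by induction on the number of separating hyperplanes,
  to geodesics through \<open>F\<close> with a common tail, and these differ by one codimension two relation.

  The chamber \<open>F\<close> and the finiteness condition at the face need no local analysis of the arrangement:
  \<open>F = x u\<inverse> C\<^bsub>K\<^esub>\<close> for the \<open>W\<^bsub>I+a+b\<^esub>\<close>-component \<open>u\<close> of the element of \<open>W\<close> relating \<open>D\<close> to \<open>E\<close>, and the
  positive roots of \<open>I+a+b\<close> not in \<open>I\<close> are inversions of \<open>u\<close>.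
\<close>

section \<open>The Coxeter group and its geometric representation\<close>

text \<open>Topology and affine geometry serve only to turn the notions of the statement into signs
  of roots. A pair \<open>(x, I)\<close> lies in \<open>Cham m J\<close> exactly when
  \<open>x\<close> carries the simple roots of \<open>I\<close> onto those of \<open>J\<close>, and
  the hyperplane of a root \<open>r\<close> outside \<open>V J\<close> separates two chambers
  exactly when the inverses of their group elements give \<open>r\<close> different signs. The
  number of such hyperplanes bounds path lengths from below, because adjacent chambers are separated
  by at most one, and greedy wall crossings attain the bound. Being geodesic thus becomes a counting
  condition that is additive along a detour through an intermediate chamber. The dichotomy of
  positive and negative roots behind all this is derived from the presentation by a rank two
  computation with Chebyshev polynomials. The obstacle at the other end is that \<open>omega\<close>
  is written with longest elements, which calls for a finite parabolic subgroup, whereas signs of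
  roots supply only an element that flips certain roots. Both the finiteness and the equality of the
  two descriptions have to be proved.\<close>

fun alternating :: "'a \<Rightarrow> 'a \<Rightarrow> nat \<Rightarrow> 'a list" where
  "alternating a b 0 = []"
| "alternating a b (Suc n) = a # alternating b a n"

lemma length_alternating [simp]: "length (alternating a b n) = n"
  by (induction n arbitrary: a b) auto

lemma alternating_add:
  "alternating a b (k + n) = alternating a b k @ (if even k then alternating a b n else alternating b a n)"
  by (induction k arbitrary: a b) auto

lemma rev_alternating:
  "rev (alternating a b n) = (if even n then alternating b a n else alternating a b n)"
proof (induction n arbitrary: a b)
  case (Suc n)
  show ?case
    using alternating_add[of a b n 1] alternating_add[of b a n 1] Suc[of a b] Suc[of b a]
    by auto
qed simp

lemma concat_replicate_pair: "concat (replicate k [a, b]) = alternating a b (2 * k)"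
  by (induction k) auto

text \<open>\<open>cheb c n\<close> is the value at \<open>c\<close> of the Chebyshev polynomial of
  the second kind of degree \<open>n - 1\<close>, so \<open>cheb (cos t) n\<close> is
  \<open>sin (n t) / sin t\<close>. These values are the coordinates of roots in a rank two
  subsystem.\<close>

fun cheb :: "real \<Rightarrow> nat \<Rightarrow> real" where
  "cheb c 0 = 0"
| "cheb c (Suc 0) = 1"
| "cheb c (Suc (Suc n)) = 2 * c * cheb c (Suc n) - cheb c n"

lemma sin_mult_cheb: "sin t * cheb (cos t) n = sin (real n * t)"
proof (induction n rule: induct_nat_012)
  case (ge2 n)
  have "sin (real (Suc (Suc n)) * t) + sin (real n * t) = 2 * cos t * sin (real (Suc n) * t)"
    using sin_add[of "real (Suc n) * t" t] sin_diff[of "real (Suc n) * t" t]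
    by (simp add: algebra_simps)
  then show ?case
    using ge2 by (simp add: algebra_simps)
qed auto

text \<open>Serves the case \<open>m i j = \<infinity>\<close>, where the form has the coefficient
  \<open>- 1\<close> and the angle degenerates to zero.\<close>

lemma cheb_one: "cheb 1 n = real n"
  by (induction n rule: induct_nat_012) auto

lemma axis_expansion: "v = (\<Sum>i\<in>UNIV. v $ i *\<^sub>R simple_root i)"
  using basis_expansion[of v] by (simp add: simple_root_def vector_scalar_mult_def scaleR_vec_def)

lemma simple_root_nth: "simple_root i $ j = (if i = j then 1 else 0)"
  by (simp add: simple_root_def axis_def)

lemma simple_root_self [simp]: "simple_root i $ i = 1"
  and simple_root_other: "i \<noteq> j \<Longrightarrow> simple_root i $ j = 0"
  by (simp_all add: simple_root_nth)

lemma simple_root_nonneg [simp]: "0 \<le> simple_root i"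
  by (simp add: less_eq_vec_def simple_root_nth)

lemma simple_root_inject [simp]: "simple_root i = simple_root j \<longleftrightarrow> i = j"
  by (metis simple_root_nth zero_neq_one)

lemma inner_simple_root: "\<phi> \<bullet> simple_root i = \<phi> $ i"
  by (simp add: simple_root_def inner_axis)

locale coxeter =
  fixes m :: "'v::finite \<Rightarrow> 'v \<Rightarrow> enat"
  assumes coxeter: "coxeter_matrix m"
begin

abbreviation W :: "'v list set set" where "W \<equiv> carrier (cox_group m)"
abbreviation cl :: "'v list \<Rightarrow> 'v list set" where "cl \<equiv> word_class m"
abbreviation mul :: "'v list set \<Rightarrow> 'v list set \<Rightarrow> 'v list set" (infixl "\<odot>" 70)
  where "g \<odot> h \<equiv> g \<otimes>\<^bsub>cox_group m\<^esub> h"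
abbreviation ginv :: "'v list set \<Rightarrow> 'v list set" where "ginv g \<equiv> inv\<^bsub>cox_group m\<^esub> g"
abbreviation "e \<equiv> \<one>\<^bsub>cox_group m\<^esub>"
abbreviation "\<alpha> \<equiv> simple_root :: 'v \<Rightarrow> real^'v"
abbreviation "gen \<equiv> simple_gen m"
abbreviation "len \<equiv> cox_length :: 'v list set \<Rightarrow> nat"
abbreviation "rep \<equiv> foldr (simple_refl m)"
abbreviation "form \<equiv> cox_form m"

section \<open>The Coxeter group as a quotient of the monoid of words\<close>

lemma word_eq_context: "word_eq m u v \<Longrightarrow> word_eq m (p @ u @ q) (p @ v @ q)"
proof (induction rule: word_eq.induct)
  case (rel i j k u v)
  show ?case
    using word_eq.rel[of m i j k "p @ u" "v @ q"] rel by simp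
qed (auto intro: word_eq.intros)

lemma word_eq_append: "word_eq m u u' \<Longrightarrow> word_eq m v v' \<Longrightarrow> word_eq m (u @ v) (u' @ v')"
  using word_eq_context[of u u' "[]" v] word_eq_context[of v v' u' "[]"]
  by (auto intro: word_eq.trans)

lemma cl_eq: "cl u = cl v \<longleftrightarrow> word_eq m u v"
  unfolding word_class_def using word_eq.refl word_eq.sym word_eq.trans by blast

lemma mem_cl: "u \<in> cl v \<longleftrightarrow> cl u = cl v"
  using cl_eq word_eq.sym by (auto simp: word_class_def)

lemma W_eq: "W = range cl"
  by (simp add: cox_group_def)

lemma cl_in_W [simp, intro]: "cl u \<in> W"
  by (simp add: W_eq)

lemma cl_mult [simp]: "cl u \<odot> cl v = cl (u @ v)"
proof -
  have "cl (a @ b) = cl (u @ v)" if "a \<in> cl u" "b \<in> cl v" for a b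
    using that word_eq_append[of a u b v] by (simp add: mem_cl cl_eq)
  then have "(\<Union>a\<in>cl u. \<Union>b\<in>cl v. cl (a @ b)) = (\<Union>a\<in>cl u. \<Union>b\<in>cl v. cl (u @ v))"
    by (intro SUP_cong HOL.refl)
  moreover have "u \<in> cl u" "v \<in> cl v"
    by (simp_all add: mem_cl)
  ultimately show ?thesis
    by (auto simp: cox_group_def)
qed

lemma one_eq: "e = cl []"
  by (simp add: cox_group_def)

lemma m_diag: "m i i = 1" and m_sym: "m i j = m j i" and m_ge2: "i \<noteq> j \<Longrightarrow> 2 \<le> m i j"
  using coxeter by (auto simp: coxeter_matrix_def)

lemma cl_square: "cl (u @ [i, i] @ v) = cl (u @ v)"
  using word_eq.rel[of m i i 1 u v] m_diag[of i] by (simp add: cl_eq one_enat_def)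

lemma cl_rev_append: "cl (rev u @ u) = cl []"
proof (induction u)
  case (Cons i u)
  then show ?case
    using cl_square[of "rev u" i u] by simp
qed simp

lemma group_W: "group (cox_group m)"
proof (rule groupI)
  fix x assume "x \<in> W"
  then obtain u where "x = cl u"
    by (auto simp: W_eq)
  then show "\<exists>y\<in>W. y \<odot> x = e"
    by (intro bexI[of _ "cl (rev u)"]) (auto simp: one_eq cl_rev_append)
next
  fix x y z assume "x \<in> W" "y \<in> W" "z \<in> W"
  then show "x \<odot> y \<odot> z = x \<odot> (y \<odot> z)"
    by (auto simp: W_eq)
qed (auto simp: W_eq one_eq)

sublocale group "cox_group m"
  by (rule group_W)

lemma inv_cl: "ginv (cl u) = cl (rev u)"
  by (rule inv_equality) (auto simp: one_eq cl_rev_append)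

lemma gen_in_W [simp, intro]: "gen i \<in> W"
  by (simp add: simple_gen_def)

lemma gen_square [simp]: "gen i \<odot> gen i = e"
  using cl_square[of "[]" i "[]"] by (simp add: simple_gen_def one_eq)

lemma mult_gen_gen [simp]: "w \<in> W \<Longrightarrow> w \<odot> gen i \<odot> gen i = w"
  by (simp add: m_assoc)

lemma cl_Cons: "cl (i # u) = gen i \<odot> cl u" and cl_snoc: "cl (u @ [i]) = cl u \<odot> gen i"
  by (simp_all add: simple_gen_def)

section \<open>Length and descents\<close>

lemma word_eq_parity: "word_eq m u v \<Longrightarrow> even (length u) = even (length v)"
proof (induction rule: word_eq.induct)
  case (rel i j k u v)
  show ?case
    by (simp add: concat_replicate_pair)
qed auto

lemma len_cl_le: "len (cl u) \<le> length u"
  unfolding cox_length_def by (rule Least_le) (auto simp: mem_cl)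

lemma ex_reduced_word:
  assumes "w \<in> W"
  obtains u where "w = cl u" "length u = len w"
proof -
  from assms obtain u where u: "w = cl u"
    by (auto simp: W_eq)
  have "\<exists>v\<in>w. length v = len w"
    unfolding cox_length_def
    by (rule LeastI[of "\<lambda>n. \<exists>v\<in>w. length v = n" "length u"]) (auto simp: u mem_cl)
  then obtain v where "v \<in> w" "length v = len w"
    by blast
  with u that[of v] show ?thesis
    by (simp add: mem_cl)
qed

lemma len_mult_gen_le: "w \<in> W \<Longrightarrow> len (w \<odot> gen i) \<le> Suc (len w)"
  by (metis ex_reduced_word cl_snoc len_cl_le length_append_singleton)

text \<open>Both sides of a defining relation have lengths of the same parity, so the parity of a
  word depends only on its class, and one more letter changes it.\<close>

lemma len_mult_gen_neq:
  assumes "w \<in> W"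
  shows "len (w \<odot> gen i) \<noteq> len w"
proof
  assume eq: "len (w \<odot> gen i) = len w"
  obtain u where u: "w = cl u" "length u = len w"
    using ex_reduced_word[OF assms] .
  obtain v where v: "w \<odot> gen i = cl v" "length v = len (w \<odot> gen i)"
    using ex_reduced_word[of "w \<odot> gen i"] assms by auto
  have "word_eq m (u @ [i]) v"
    using u v cl_eq cl_snoc by metis
  from word_eq_parity[OF this] show False
    using u v eq by simp
qed

lemma len_mult_gen_cases:
  assumes "w \<in> W"
  shows "len (w \<odot> gen i) = Suc (len w) \<or> len w = Suc (len (w \<odot> gen i))"
  using len_mult_gen_le[OF assms, of i] len_mult_gen_neq[OF assms, of i]
    len_mult_gen_le[of "w \<odot> gen i" i] assms by fastforce

text \<open>The last letter of a reduced word cancels against itself and leaves a shorter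
  word.\<close>

lemma ex_descent:
  assumes "w \<in> W" "w \<noteq> e"
  obtains i where "len w = Suc (len (w \<odot> gen i))"
proof -
  obtain u where u: "w = cl u" "length u = len w"
    using ex_reduced_word[OF assms(1)] .
  have "u \<noteq> []"
    using assms u one_eq by auto
  then obtain v i where v: "u = v @ [i]"
    by (metis rev_exhaust)
  have "w \<odot> gen i = cl v"
    using u v cl_square[of v i "[]"] by (simp add: simple_gen_def)
  then have "len (w \<odot> gen i) < len w"
    using u v len_cl_le[of v] by simp
  with len_mult_gen_cases[OF assms(1), of i] that show ?thesis
    by auto
qed

section \<open>The invariant form, the simple reflections and the action on the root space\<close>

lemma form_add_left: "form (u + v) w = form u w + form v w"
  and form_scale_left: "form (c *\<^sub>R u) w = c * form u w"
  and form_add_right: "form w (u + v) = form w u + form w v"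
  and form_scale_right: "form w (c *\<^sub>R u) = c * form w u"
  by (simp_all add: cox_form_def sum.distrib algebra_simps sum_distrib_left)

lemma form_minus_left: "form (- u) w = - form u w"
  and form_minus_right: "form w (- u) = - form w u"
  using form_scale_left[of "-1"] form_scale_right[of _ "-1"] by auto

lemma form_diff_left: "form (u - v) w = form u w - form v w"
  and form_diff_right: "form w (u - v) = form w u - form w v"
  using form_add_left[of u "- v"] form_add_right[of w u "- v"]
  by (simp_all add: form_minus_left form_minus_right)

lemmas form_simps = form_add_left form_scale_left form_add_right form_scale_right
  form_diff_left form_diff_right form_minus_left form_minus_right

lemma form_sym: "form u v = form v u"
proof -
  have "cox_coeff m i j = cox_coeff m j i" for i j
    by (simp add: cox_coeff_def m_sym)
  then show ?thesis
    unfolding cox_form_def by (subst sum.swap) (simp add: mult.commute mult.left_commute)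
qed

lemma form_root_left: "form (\<alpha> i) v = (\<Sum>j\<in>UNIV. v $ j * cox_coeff m i j)"
proof -
  have "form (\<alpha> i) v = (\<Sum>k\<in>UNIV. if i = k then (\<Sum>j\<in>UNIV. v $ j * cox_coeff m k j) else 0)"
    unfolding cox_form_def by (rule sum.cong) (auto simp: simple_root_nth)
  then show ?thesis
    by simp
qed

lemma form_roots: "form (\<alpha> i) (\<alpha> j) = cox_coeff m i j"
  by (simp add: form_root_left simple_root_nth if_distrib[of "\<lambda>x. x * _"] cong: if_cong)

lemma cox_coeff_self: "cox_coeff m i i = 1"
  by (simp add: cox_coeff_def m_diag one_enat_def)

lemma form_root_self [simp]: "form (\<alpha> i) (\<alpha> i) = 1"
  by (simp add: form_roots cox_coeff_self)

lemma linear_refl: "linear (simple_refl m i)"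
  by (rule linearI) (simp_all add: simple_refl_def form_simps algebra_simps)

lemma refl_involution [simp]: "simple_refl m i (simple_refl m i v) = v"
  by (simp add: simple_refl_def form_simps algebra_simps)

lemma refl_root [simp]: "simple_refl m i (\<alpha> i) = - \<alpha> i"
  by (simp add: simple_refl_def scaleR_2)

lemma form_refl: "form (simple_refl m i u) (simple_refl m i v) = form u v"
  by (simp add: simple_refl_def form_simps form_sym[of u "\<alpha> i"] form_sym[of v "\<alpha> i"] algebra_simps)

lemma linear_rep: "linear (rep u)"
proof (induction u)
  case Nil
  show ?case by (simp add: linear_id[unfolded id_def])
next
  case (Cons i u)
  show ?case
    using linear_compose[OF Cons linear_refl[of i]] by (simp add: comp_def)
qed

text \<open>The root acted on belongs to the letter that would come next in the alternating word. In
  the plane of \<alpha> a and \<alpha> b, with \<open>c\<close> the negative of the coefficient of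
  the form, the reflection formula for the two coordinates is the three-term recursion of
  \<open>cheb\<close>.\<close>

lemma rep_alternating:
  "rep (alternating a b n) (\<alpha> (if even n then a else b)) =
     cheb (- cox_coeff m a b) (Suc n) *\<^sub>R \<alpha> a + cheb (- cox_coeff m a b) n *\<^sub>R \<alpha> b"
proof (induction n arbitrary: a b)
  case (Suc n)
  define c where "c = - cox_coeff m a b"
  have ba: "cox_coeff m b a = - c" "cox_coeff m a b = - c"
    by (simp_all add: c_def cox_coeff_def m_sym)
  have "rep (alternating a b (Suc n)) (\<alpha> (if even (Suc n) then a else b)) =
      simple_refl m a (rep (alternating b a n) (\<alpha> (if even n then b else a)))"
    by simp
  also have "\<dots> = simple_refl m a (cheb c (Suc n) *\<^sub>R \<alpha> b + cheb c n *\<^sub>R \<alpha> a)"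
    by (simp only: Suc[of b a] ba minus_minus)
  also have "\<dots> = cheb c (Suc (Suc n)) *\<^sub>R \<alpha> a + cheb c (Suc n) *\<^sub>R \<alpha> b"
    by (simp add: vec_eq_iff simple_refl_def form_simps form_roots ba cox_coeff_self algebra_simps)
  finally show ?case
    by (simp only: ba minus_minus)
qed simp

text \<open>The bound on \<open>n\<close> keeps the angle \<open>n * pi / k\<close> between 0 and
  pi, where the sine is nonnegative.\<close>

lemma cheb_coxeter:
  assumes "a \<noteq> b" "enat n \<le> m a b"
  shows "0 \<le> cheb (- cox_coeff m a b) n"
proof (cases "m a b")
  case (enat k)
  have k: "2 \<le> k"
    using m_ge2[OF assms(1)] enat by (simp add: numeral_eq_enat)
  have "0 < sin (pi / real k)"
    using k by (intro sin_gt_zero) (auto simp: field_simps)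
  moreover have "0 \<le> sin (real n * (pi / real k))"
    using k assms(2) enat by (intro sin_ge_zero) (auto simp: field_simps)
  ultimately have "0 \<le> cheb (cos (pi / real k)) n"
    by (metis sin_mult_cheb zero_le_mult_iff less_le_not_le)
  then show ?thesis
    by (simp add: cox_coeff_def enat)
next
  case infinity
  then show ?thesis
    by (simp add: cox_coeff_def cheb_one)
qed

text \<open>The relation is checked on the plane of \<alpha> i and \<alpha> j, by Chebyshev values
  at a full turn, and on the orthogonal complement of the plane, which both reflections fix. The
  form is nondegenerate on the plane because \<open>sin t\<close> is nonzero, so the two parts
  span.\<close>

lemma rep_relation:
  assumes "m i j = enat k"
  shows "rep (concat (replicate k [i, j])) v = v"
proof (cases "i = j")
  case True
  then have "k = 1"
    using assms m_diag by (simp add: one_enat_def)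
  with True show ?thesis
    by simp
next
  case False
  have k: "2 \<le> k"
    using m_ge2[OF False] assms by (simp add: numeral_eq_enat)
  define t where "t = pi / real k"
  have sint: "0 < sin t"
    using k by (auto simp: t_def field_simps intro!: sin_gt_zero)
  have c: "cox_coeff m i j = - cos t"
    by (simp add: cox_coeff_def assms t_def)
  have kt: "real (2 * k) * t = 2 * pi"
    using k by (simp add: t_def)
  have ch0: "cheb (cos t) (2 * k) = 0"
    using sin_mult_cheb[of t "2 * k"] sint unfolding kt by simp
  have ch1: "cheb (cos t) (Suc (2 * k)) = 1"
  proof -
    have "real (Suc (2 * k)) * t = t + 2 * pi"
      using kt by (simp add: algebra_simps)
    then show ?thesis
      using sin_mult_cheb[of t "Suc (2 * k)"] sint by simp
  qed
  \<comment> \<open>With first letter \<open>i\<close>, \<open>rep_alternating\<close> reaches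
    \<alpha> j only for words of odd length. The last letter \<open>j\<close> is therefore split
    off; it supplies the sign that cancels the value \<open>- 1\<close> at \<open>n\<close>.\<close>
  obtain n where n: "2 * k = Suc n" "odd n"
    using k by (intro that[of "2 * k - 1"]) auto
  have ch2: "cheb (cos t) n = - 1"
    using ch0 ch1 n by simp
  define r where "r = rep (concat (replicate k [i, j]))"
  have r: "r = rep (alternating i j (2 * k))"
    by (simp add: r_def concat_replicate_pair)
  have lin: "linear r"
    unfolding r_def by (rule linear_rep)
  have ri: "r (\<alpha> i) = \<alpha> i"
    using rep_alternating[of i j "2 * k"] ch0 ch1 by (simp add: r c)
  have rj: "r (\<alpha> j) = \<alpha> j"
  proof -
    have "alternating i j (2 * k) = alternating i j n @ [j]"
      using alternating_add[of i j n 1] n by simp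
    then have "r (\<alpha> j) = rep (alternating i j n) (- \<alpha> j)"
      by (simp add: r)
    also have "\<dots> = - rep (alternating i j n) (\<alpha> j)"
      by (rule linear_neg[OF linear_rep])
    finally show ?thesis
      using rep_alternating[of i j n] n ch0 ch2 by (simp add: c)
  qed
  have ne: "1 - (cos t)\<^sup>2 \<noteq> 0"
    using sint by (simp add: sin_squared_eq[symmetric])
  \<comment> \<open>\<open>x\<close> and \<open>y\<close> solve the two linear equations that make
    \<open>v'\<close> orthogonal to both roots; the denominator is the Gram determinant of the
    plane.\<close>
  define x where "x = (form (\<alpha> i) v + cos t * form (\<alpha> j) v) / (1 - (cos t)\<^sup>2)"
  define y where "y = (form (\<alpha> j) v + cos t * form (\<alpha> i) v) / (1 - (cos t)\<^sup>2)"
  define v' where "v' = v - x *\<^sub>R \<alpha> i - y *\<^sub>R \<alpha> j"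
  have cji: "cox_coeff m j i = - cos t"
    using c m_sym by (simp add: cox_coeff_def)
  have "form (\<alpha> i) v = x - y * cos t" "form (\<alpha> j) v = y - x * cos t"
    using ne by (simp_all add: x_def y_def diff_divide_distrib[symmetric] eq_divide_eq
        power2_eq_square algebra_simps)
  then have "form (\<alpha> i) v' = 0" "form (\<alpha> j) v' = 0"
    by (simp_all add: v'_def form_simps form_roots c cji cox_coeff_self)
  then have fix': "simple_refl m i v' = v'" "simple_refl m j v' = v'"
    by (simp_all add: simple_refl_def)
  have "rep (alternating a b q) v' = v'" if "{a, b} = {i, j}" for a b q
    using that
  proof (induction q arbitrary: a b)
    case (Suc q)
    then show ?case
      using fix' by (auto simp: doubleton_eq_iff)
  qed simp
  then have rv': "r v' = v'"
    by (simp add: r)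
  have "v = v' + x *\<^sub>R \<alpha> i + y *\<^sub>R \<alpha> j"
    by (simp add: v'_def)
  then have "r v = v"
    using rv' ri rj by (simp add: linear_add[OF lin] linear_cmul[OF lin])
  then show ?thesis
    by (simp add: r_def)
qed

text \<open>With this, the representative chosen by \<open>SOME\<close> in \<open>act\<close> is
  immaterial.\<close>

lemma rep_word_eq: "word_eq m u v \<Longrightarrow> rep u = rep v"
proof (induction rule: word_eq.induct)
  case (rel i j k u v)
  show ?case
    by (simp add: fun_eq_iff rep_relation[OF rel])
qed auto

lemma act_cl [simp]: "act m (cl u) v = rep u v"
proof -
  have "(SOME w. w \<in> cl u) \<in> cl u"
    by (rule someI[of _ u]) (simp add: mem_cl)
  then show ?thesis
    using rep_word_eq[of "SOME w. w \<in> cl u" u] by (simp add: act_def mem_cl cl_eq)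
qed

lemma act_one [simp]: "act m e v = v"
  by (simp add: one_eq)

lemma act_gen [simp]: "act m (gen i) v = simple_refl m i v"
  by (simp add: simple_gen_def)

lemma act_mult [simp]: "g \<in> W \<Longrightarrow> h \<in> W \<Longrightarrow> act m (g \<odot> h) v = act m g (act m h v)"
  by (auto simp: W_eq)

lemma act_inv [simp]: "g \<in> W \<Longrightarrow> act m (ginv g) (act m g v) = v"
  and act_inv' [simp]: "g \<in> W \<Longrightarrow> act m g (act m (ginv g) v) = v"
  using act_mult[of "ginv g" g v] act_mult[of g "ginv g" v] by auto

lemma linear_act: "g \<in> W \<Longrightarrow> linear (act m g)"
proof -
  assume "g \<in> W"
  then obtain u where "g = cl u"
    by (auto simp: W_eq)
  then have "act m g = rep u"
    by (simp add: fun_eq_iff)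
  then show ?thesis
    by (simp add: linear_rep)
qed

lemma act_minus: "g \<in> W \<Longrightarrow> act m g (- v) = - act m g v"
  using linear_neg linear_act by blast

lemma act_expansion: "g \<in> W \<Longrightarrow> act m g v = (\<Sum>i\<in>UNIV. v $ i *\<^sub>R act m g (\<alpha> i))"
  using axis_expansion[of v] linear_sum[OF linear_act] linear_cmul[OF linear_act]
  by (smt (verit, best) sum.cong)

lemma form_act: "g \<in> W \<Longrightarrow> form (act m g u) (act m g v) = form u v"
proof -
  assume "g \<in> W"
  then obtain w where "g = cl w"
    by (auto simp: W_eq)
  moreover have "form (rep w u) (rep w v) = form u v"
    by (induction w) (auto simp: form_refl)
  ultimately show ?thesis
    by simp
qed

section \<open>Positivity of the image of a simple root under an ascent\<close>

lemma cl_braid: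
  assumes "m i j = enat k"
  shows "cl (rev (alternating j i k)) = cl (rev (alternating i j k))"
proof -
  have "rev (alternating i j (2 * k)) = alternating j i (2 * k)"
    by (simp add: rev_alternating)
  then have "alternating i j (2 * k) = rev (alternating j i (2 * k))"
    by (metis rev_rev_ident)
  moreover have "take k (rev (rev (alternating j i (2 * k)))) = alternating j i k"
    using alternating_add[of j i k k] by (simp add: mult_2)
  ultimately have "alternating i j (2 * k) = alternating i j k @ rev (alternating j i k)"
    using alternating_add[of i j k k] rev_alternating[of j i k] by (simp add: mult_2)
  then have "cl (alternating i j k) \<odot> cl (rev (alternating j i k)) = e"
    using word_eq.rel[of m i j k "[]" "[]"] assms
    by (simp add: one_eq cl_eq concat_replicate_pair)
  then have "cl (rev (alternating j i k)) = ginv (cl (alternating i j k))"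
    by (metis cl_in_W inv_equality inv_inv)
  then show ?thesis
    by (simp add: inv_cl)
qed

text \<open>\<open>w\<close> is written as \<open>v\<close> times an alternating word in
  \<open>i\<close> and a descent \<open>j\<close>, with the word as long as possible. Then both
  letters are ascents of \<open>v\<close>, the induction hypothesis applies to \<open>v\<close>, and
  the alternating word carries \<alpha> i to a nonnegative combination of the two simple
  roots.\<close>

theorem act_simple_nonneg:
  assumes "w \<in> W" "len w < len (w \<odot> gen i)"
  shows "0 \<le> act m w (\<alpha> i)"
  using assms
proof (induction "len w" arbitrary: w i rule: less_induct)
  case less
  show ?case
  proof (cases "w = e")
    case False
    obtain j where j: "len w = Suc (len (w \<odot> gen j))"
      using ex_descent[OF less.prems(1) False] .
    then have ij: "j \<noteq> i"
      using less.prems by auto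
    \<comment> \<open>The word has \<open>n\<close> letters and ends in \<open>j\<close>; for
      \<open>n = 1\<close> it is the descent \<open>j\<close> alone.\<close>
    define P where "P n \<longleftrightarrow> (\<exists>v\<in>W. w = v \<odot> cl (rev (alternating j i n)) \<and> len w = len v + n)" for n
    have "P 1"
      unfolding P_def using less.prems j
      by (intro bexI[of _ "w \<odot> gen j"]) (auto simp: simple_gen_def[symmetric])
    moreover have "n \<le> len w" if "P n" for n
      using that by (auto simp: P_def)
    ultimately obtain n where n: "P n" "\<And>k. P k \<Longrightarrow> k \<le> n" "1 \<le> n"
      using GreatestI_nat[of P 1 "len w"] Greatest_le_nat[of P _ "len w"] by metis
    then obtain v where v: "v \<in> W" "w = v \<odot> cl (rev (alternating j i n))" "len w = len v + n"
      by (auto simp: P_def)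
    define t where "t = (if even n then j else i)"
    define t' where "t' = (if even n then i else j)"
    have snoc: "alternating j i (Suc n) = alternating j i n @ [t]"
      using alternating_add[of j i n 1] by (simp add: t_def)
    have rev_eq: "rev (alternating j i n) = alternating t' t n"
      by (simp add: rev_alternating t_def t'_def)
    \<comment> \<open>\<open>t\<close> is the letter that would extend the word on the left. If it
      shortened \<open>v\<close>, the word could be lengthened, against the maximality of
      \<open>n\<close>.\<close>
    have up_t: "len v < len (v \<odot> gen t)"
    proof (rule ccontr)
      assume "\<not> ?thesis"
      then have "len v = Suc (len (v \<odot> gen t))"
        using len_mult_gen_cases[OF v(1), of t] by auto
      moreover have "w = (v \<odot> gen t) \<odot> cl (rev (alternating j i (Suc n)))"
        unfolding snoc using v by (simp add: cl_Cons m_assoc[symmetric])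
      ultimately have "P (Suc n)"
        unfolding P_def using v by (intro bexI[of _ "v \<odot> gen t"]) auto
      with n(2) show False
        by fastforce
    qed
    \<comment> \<open>\<open>t'\<close> is the first letter of the word. If it shortened
      \<open>v\<close>, absorbing it would give a word for \<open>w\<close> with fewer than
      \<open>len w\<close> letters.\<close>
    have up_t': "len v < len (v \<odot> gen t')"
    proof (rule ccontr)
      assume "\<not> ?thesis"
      then have *: "len v = Suc (len (v \<odot> gen t'))"
        using len_mult_gen_cases[OF v(1), of t'] by auto
      obtain k where k: "n = Suc k"
        using n(3) by (cases n) auto
      obtain u where u: "v \<odot> gen t' = cl u" "length u = len (v \<odot> gen t')"
        using ex_reduced_word[of "v \<odot> gen t'"] v(1) by auto
      have "w = v \<odot> gen t' \<odot> cl (alternating t t' k)"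
        using v rev_eq k by (simp add: cl_Cons m_assoc)
      then have "len w \<le> len (v \<odot> gen t') + k"
        using u len_cl_le[of "u @ alternating t t' k"] by simp
      with * v k show False
        by simp
    qed
    \<comment> \<open>Otherwise the braid relation rewrites the last \<open>k\<close> letters into a
      word ending in \<open>i\<close>, and \<open>i\<close> would be a descent of
      \<open>w\<close>.\<close>
    have bound: "enat (Suc n) \<le> m i j"
    proof (rule ccontr)
      assume "\<not> ?thesis"
      then obtain k where k: "m i j = enat k" "k \<le> n"
        by (cases "m i j") auto
      obtain l where l: "n = k + l"
        using k by (metis le_Suc_ex)
      obtain r where r: "alternating j i n = alternating j i k @ r" "length r = l"
        unfolding l alternating_add by simp
      have k0: "k \<noteq> 0"
        using k m_ge2[of i j] ij by (auto simp: numeral_eq_enat)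
      then obtain q where q: "k = Suc q"
        by (cases k) auto
      obtain u where u: "v = cl u" "length u = len v"
        using ex_reduced_word[OF v(1)] .
      define z where "z = u @ rev r @ rev (alternating j i q)"
      have "w = cl (u @ rev r) \<odot> cl (rev (alternating j i k))"
        using v u r by simp
      also have "\<dots> = cl (u @ rev r) \<odot> cl (rev (alternating i j k))"
        by (simp only: cl_braid[OF k(1)])
      also have "\<dots> = cl (z @ [i])"
        by (simp add: q z_def)
      finally have w: "w = cl z \<odot> gen i"
        by (simp add: simple_gen_def)
      then have "w \<odot> gen i = cl z"
        by simp
      then have "len (w \<odot> gen i) \<le> length z"
        by (simp add: len_cl_le)
      then have "len (w \<odot> gen i) < len w"
        using v u r l q by (simp add: z_def)
      with less.prems show False
        by simp
    qed
    have "len v < len w"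
      using v n by simp
    then have pos: "0 \<le> act m v (\<alpha> t)" "0 \<le> act m v (\<alpha> t')"
      using less.hyps[OF _ v(1)] up_t up_t' by auto
    have "rep (rev (alternating j i n)) (\<alpha> i) =
        cheb (- cox_coeff m i j) (Suc n) *\<^sub>R \<alpha> t' + cheb (- cox_coeff m i j) n *\<^sub>R \<alpha> t"
    proof -
      have "cox_coeff m t' t = cox_coeff m i j"
        by (simp add: t_def t'_def cox_coeff_def m_sym)
      moreover have "(if even n then t' else t) = i"
        by (simp add: t_def t'_def)
      ultimately show ?thesis
        using rep_alternating[of t' t n] rev_eq by simp
    qed
    then have "act m w (\<alpha> i) =
        cheb (- cox_coeff m i j) (Suc n) *\<^sub>R act m v (\<alpha> t') + cheb (- cox_coeff m i j) n *\<^sub>R act m v (\<alpha> t)"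
      using v by (simp add: linear_add[OF linear_act] linear_cmul[OF linear_act])
    moreover have "0 \<le> cheb (- cox_coeff m i j) (Suc n)" "0 \<le> cheb (- cox_coeff m i j) n"
      using cheb_coxeter[of i j "Suc n"] cheb_coxeter[of i j n] bound ij
        order_trans[of "enat n" "enat (Suc n)" "m i j"] by auto
    ultimately show ?thesis
      using pos by (simp add: less_eq_vec_def)
  qed simp
qed

end

section \<open>Roots and parabolic subgroups\<close>

lemma vec_minus_sign [simp]:
  fixes v :: "real^'n"
  shows "0 \<le> - v \<longleftrightarrow> v \<le> 0" "- v \<le> 0 \<longleftrightarrow> 0 \<le> v"
  by (simp_all add: less_eq_vec_def)

context coxeter begin

section \<open>Signs of roots and faithfulness of the representation\<close>

lemma refl_nth: "j \<noteq> i \<Longrightarrow> simple_refl m i v $ j = v $ j"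
  by (simp add: simple_refl_def simple_root_other)

text \<open>\<open>w \<odot> gen i\<close> sends \<alpha> i to the negative of its image under
  \<open>w\<close>, so the two length cases yield opposite signs. They exclude each other because
  invariance of the form keeps the image nonzero.\<close>

lemma act_nonneg_iff:
  assumes "w \<in> W"
  shows "0 \<le> act m w (\<alpha> i) \<longleftrightarrow> len w < len (w \<odot> gen i)"
    and "act m w (\<alpha> i) \<le> 0 \<longleftrightarrow> len (w \<odot> gen i) < len w"
proof -
  have neg: "act m w (\<alpha> i) \<le> 0" if "len (w \<odot> gen i) < len w"
  proof -
    have "0 \<le> act m (w \<odot> gen i) (\<alpha> i)"
      using assms that by (intro act_simple_nonneg) auto
    then show ?thesis
      using assms by (simp add: act_minus less_eq_vec_def)
  qed
  have nz: "act m w (\<alpha> i) \<noteq> 0"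
    using form_act[OF assms, of "\<alpha> i" "\<alpha> i"] form_scale_left[of 0] by auto
  have "\<not> (0 \<le> act m w (\<alpha> i) \<and> act m w (\<alpha> i) \<le> 0)"
    using nz by (metis order_antisym)
  then show "0 \<le> act m w (\<alpha> i) \<longleftrightarrow> len w < len (w \<odot> gen i)"
    and "act m w (\<alpha> i) \<le> 0 \<longleftrightarrow> len (w \<odot> gen i) < len w"
    using neg act_simple_nonneg[OF assms] len_mult_gen_neq[OF assms, of i] by (metis nat_neq_iff)+
qed

lemma rootsE:
  assumes "r \<in> roots m"
  obtains w i where "w \<in> W" "r = act m w (\<alpha> i)"
  using assms by (auto simp: roots_def)

lemma simple_root_in_roots [simp, intro]: "\<alpha> i \<in> roots m"
  unfolding roots_def using act_one one_closed by (metis (mono_tags, lifting) mem_Collect_eq)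

lemma act_roots [simp, intro]: "g \<in> W \<Longrightarrow> r \<in> roots m \<Longrightarrow> act m g r \<in> roots m"
  unfolding roots_def by (clarsimp) (metis act_mult m_closed)

lemma minus_roots: "r \<in> roots m \<Longrightarrow> - r \<in> roots m"
proof (elim rootsE)
  fix w i assume "w \<in> W" "r = act m w (\<alpha> i)"
  then have "- r = act m (w \<odot> gen i) (\<alpha> i)" "w \<odot> gen i \<in> W"
    by (auto simp: act_minus)
  then show ?thesis
    by (auto simp: roots_def)
qed

lemma form_root: "r \<in> roots m \<Longrightarrow> form r r = 1"
  by (auto elim!: rootsE simp: form_act)

lemma root_nonzero: "r \<in> roots m \<Longrightarrow> r \<noteq> 0"
  using form_root form_scale_left[of 0] by force

lemma root_sign: "r \<in> roots m \<Longrightarrow> 0 \<le> r \<or> r \<le> 0"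
  using act_nonneg_iff len_mult_gen_neq by (metis rootsE nat_neq_iff)

lemma root_not_both: "r \<in> roots m \<Longrightarrow> 0 \<le> r \<Longrightarrow> r \<le> 0 \<Longrightarrow> False"
  using root_nonzero by (metis order_antisym)

lemma root_neg_iff: "r \<in> roots m \<Longrightarrow> r \<le> 0 \<longleftrightarrow> \<not> 0 \<le> r"
  using root_sign root_not_both by blast

lemma root_sign_coordinate:
  assumes "r \<in> roots m"
  shows "0 < r $ i \<Longrightarrow> 0 \<le> r" "r $ i < 0 \<Longrightarrow> r \<le> 0"
  using root_sign[OF assms] by (auto simp: less_eq_vec_def) (metis not_less)+

text \<open>The coordinate subspace spanned by the simple roots of \<open>I\<close>. The roots in it
  are exactly those of the parabolic subsystem (\<open>roots_of_eq\<close>), so that belonging to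
  the subsystem becomes a linear condition.\<close>

definition V :: "'v set \<Rightarrow> (real^'v) set" where
  "V I = {v. \<forall>i. i \<notin> I \<longrightarrow> v $ i = 0}"

lemma subspace_V: "subspace (V I)"
  by (auto simp: V_def subspace_def)

lemma V_diff: "u \<in> V I \<Longrightarrow> v \<in> V I \<Longrightarrow> u - v \<in> V I"
  and V_scale: "u \<in> V I \<Longrightarrow> c *\<^sub>R u \<in> V I"
  and V_minus: "u \<in> V I \<Longrightarrow> - u \<in> V I"
  by (auto simp: V_def)

lemma V_mono: "I \<subseteq> L \<Longrightarrow> V I \<subseteq> V L"
  by (auto simp: V_def)

lemma simple_root_in_V [simp]: "\<alpha> i \<in> V I \<longleftrightarrow> i \<in> I"
  by (auto simp: V_def simple_root_nth)

lemma V_expansion: "v \<in> V I \<Longrightarrow> v = (\<Sum>i\<in>I. v $ i *\<^sub>R \<alpha> i)"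
proof -
  assume "v \<in> V I"
  then have "(\<Sum>i\<in>UNIV. v $ i *\<^sub>R \<alpha> i) = (\<Sum>i\<in>I. v $ i *\<^sub>R \<alpha> i)"
    by (intro sum.mono_neutral_right) (auto simp: V_def)
  then show ?thesis
    using axis_expansion[of v] by simp
qed

lemma act_V_expansion: "g \<in> W \<Longrightarrow> v \<in> V I \<Longrightarrow> act m g v = (\<Sum>i\<in>I. v $ i *\<^sub>R act m g (\<alpha> i))"
  by (subst V_expansion[of v I])
    (simp_all add: linear_sum[OF linear_act] linear_cmul[OF linear_act])

lemma act_nonneg_V:
  assumes "g \<in> W" "v \<in> V I" "0 \<le> v" "\<And>i. i \<in> I \<Longrightarrow> 0 \<le> act m g (\<alpha> i)"
  shows "0 \<le> act m g v"
  using assms by (auto simp: act_V_expansion less_eq_vec_def intro!: sum_nonneg)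

lemma nonneg_root_single:
  assumes "r \<in> roots m" "0 \<le> r" "r \<in> V {i}"
  shows "r = \<alpha> i"
proof -
  have r: "r = r $ i *\<^sub>R \<alpha> i"
    using V_expansion[OF assms(3)] by simp
  have "form r r = (r $ i) * (r $ i)"
    by (subst (1 2) r) (simp add: form_simps)
  then have "(r $ i) * (r $ i) = 1"
    using form_root[OF assms(1)] by simp
  moreover have "0 \<le> r $ i"
    using assms by (simp add: less_eq_vec_def)
  ultimately have "r $ i = 1"
    by (metis abs_mult abs_of_nonneg abs_square_eq_1 power2_eq_square)
  with r show ?thesis
    by simp
qed

text \<open>The reflection alters only the coordinate at \<open>i\<close>, so all other coordinates
  are both nonnegative and nonpositive.\<close>

lemma root_refl_neg:
  assumes "r \<in> roots m" "0 \<le> r" "simple_refl m i r \<le> 0"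
  shows "r = \<alpha> i"
proof (rule nonneg_root_single)
  show "r \<in> V {i}"
    unfolding V_def
  proof (clarsimp)
    fix j assume "j \<noteq> i"
    then show "r $ j = 0"
      using assms refl_nth[of j i r] by (metis less_eq_vec_def order_antisym zero_index)
  qed
qed (use assms in auto)

lemma all_nonneg_imp_one: "w \<in> W \<Longrightarrow> (\<And>i. 0 \<le> act m w (\<alpha> i)) \<Longrightarrow> w = e"
  using ex_descent act_nonneg_iff by (metis lessI not_less_iff_gr_or_eq)

lemma act_eq_iff:
  assumes "g \<in> W" "h \<in> W" "\<And>v. act m g v = act m h v"
  shows "g = h"
proof -
  have "ginv g \<odot> h = e"
    using assms(1,2) by (intro all_nonneg_imp_one) (auto simp: assms(3)[symmetric])
  then show ?thesis
    using assms by (metis inv_closed inv_equality inv_inv)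
qed

text \<open>Invariance of the form makes both products act alike, and the representation is
  faithful.\<close>

lemma conj_gen:
  assumes "w \<in> W" "act m w (\<alpha> i) = \<alpha> j"
  shows "w \<odot> gen i = gen j \<odot> w"
proof (rule act_eq_iff)
  fix v
  have "form (\<alpha> j) (act m w v) = form (\<alpha> i) v"
    using form_act[OF assms(1)] assms(2) by metis
  then show "act m (w \<odot> gen i) v = act m (gen j \<odot> w) v"
    using assms by (simp add: simple_refl_def linear_diff[OF linear_act] linear_cmul[OF linear_act])
qed (use assms in auto)

section \<open>Standard parabolic subgroups and their roots\<close>

lemma parabolic_eq: "parabolic m I = cl ` lists I"
proof (intro equalityI subsetI)
  fix w assume "w \<in> parabolic m I"
  then show "w \<in> cl ` lists I"
    unfolding parabolic_def
  proof (induction rule: generate.induct)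
    case one
    show ?case by (auto simp: one_eq)
  next
    case (incl h)
    then show ?case
      by (auto simp: simple_gen_def intro!: image_eqI[of _ _ "[_]"])
  next
    case (inv h)
    then show ?case
      by (auto simp: simple_gen_def inv_cl intro!: image_eqI[of _ _ "[_]"])
  next
    case (eng h1 h2)
    then obtain u v where "h1 = cl u" "h2 = cl v" "u \<in> lists I" "v \<in> lists I"
      by auto
    then show ?case
      by (intro image_eqI[of _ _ "u @ v"]) auto
  qed
next
  fix w assume "w \<in> cl ` lists I"
  then obtain u where u: "u \<in> lists I" "w = cl u"
    by auto
  show "w \<in> parabolic m I"
    using u(1) unfolding u(2) parabolic_def
  proof (induction u)
    case Nil
    then show ?case by (simp add: one_eq[symmetric] generate.one)
  next
    case (Cons i u)
    then show ?case by (auto simp: cl_Cons simp del: cl_mult intro: generate.intros)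
  qed
qed

lemma subgroup_parabolic: "subgroup (parabolic m I) (cox_group m)"
  unfolding parabolic_def by (rule generate_is_subgroup) auto

lemma parabolic_in_W [simp, intro]: "w \<in> parabolic m I \<Longrightarrow> w \<in> W"
  and parabolic_mult [simp]: "g \<in> parabolic m I \<Longrightarrow> h \<in> parabolic m I \<Longrightarrow> g \<odot> h \<in> parabolic m I"
  and parabolic_inv [simp]: "g \<in> parabolic m I \<Longrightarrow> ginv g \<in> parabolic m I"
  and parabolic_one [simp]: "e \<in> parabolic m I"
  using subgroup.mem_carrier subgroup.m_closed subgroup.m_inv_closed subgroup.one_closed
    subgroup_parabolic by fast+

lemma parabolic_gen [simp]: "i \<in> I \<Longrightarrow> gen i \<in> parabolic m I"
  by (auto simp: parabolic_def intro: generate.incl)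

lemma parabolic_mono: "I \<subseteq> L \<Longrightarrow> parabolic m I \<subseteq> parabolic m L"
  by (auto simp: parabolic_eq)

text \<open>Every letter subtracts a multiple of its own simple root. Hence coordinates outside
  \<open>I\<close> are invariants of the subgroup.\<close>

lemma parabolic_act_diff: "w \<in> parabolic m I \<Longrightarrow> act m w v - v \<in> V I"
proof -
  have "rep u v - v \<in> V I" if "u \<in> lists I" for u
    using that
  proof (induction u)
    case (Cons i u)
    have "rep (i # u) v - v = (rep u v - v) - (2 * form (\<alpha> i) (rep u v)) *\<^sub>R \<alpha> i"
      by (simp add: simple_refl_def)
    also have "\<dots> \<in> V I"
      using Cons by (intro V_diff[OF _ V_scale]) auto
    finally show ?case .
  qed (simp add: V_def)
  then show "w \<in> parabolic m I \<Longrightarrow> act m w v - v \<in> V I"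
    unfolding parabolic_eq by (metis act_cl imageE)
qed

lemma parabolic_act_nth: "w \<in> parabolic m I \<Longrightarrow> i \<notin> I \<Longrightarrow> act m w v $ i = v $ i"
  using parabolic_act_diff[of w I v] by (simp add: V_def)

lemma parabolic_act_V: "w \<in> parabolic m I \<Longrightarrow> I \<subseteq> L \<Longrightarrow> act m w v \<in> V L \<longleftrightarrow> v \<in> V L"
  using parabolic_act_nth[of w I _ v] by (auto simp: V_def) (metis subsetD)+

text \<open>Read from the right, the word turns \<alpha> i negative at some letter \<open>c\<close>.
  There the intermediate root is \<alpha> c, and the resulting conjugation relation deletes
  \<open>c\<close>. Counting letters of words over \<open>L\<close>, and not
  \<open>cox_length\<close>, keeps the shortened word over \<open>L\<close>.\<close>

lemma exchange:
  assumes "u \<in> lists L" "act m (cl u) (\<alpha> i) \<le> 0"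
  shows "\<exists>u'\<in>lists L. length u = Suc (length u') \<and> cl u \<odot> gen i = cl u'"
  using assms
proof (induction u)
  case Nil
  then show ?case
    using root_not_both[of "\<alpha> i"] by auto
next
  case (Cons c u)
  have root: "act m (cl u) (\<alpha> i) \<in> roots m"
    by blast
  show ?case
  proof (cases "act m (cl u) (\<alpha> i) \<le> 0")
    case True
    with Cons obtain u' where "u' \<in> lists L" "length u = Suc (length u')" "cl u \<odot> gen i = cl u'"
      by auto
    moreover have "c # u' \<in> lists L"
      using Cons.hyps \<open>u' \<in> lists L\<close> by simp
    ultimately show ?thesis
      by (intro bexI[of _ "c # u'"]) (simp_all only: cl_Cons m_assoc cl_in_W gen_in_W length_Cons)
  next
    case False
    then have "act m (cl u) (\<alpha> i) = \<alpha> c"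
      using Cons.prems root by (intro root_refl_neg) (auto simp: root_neg_iff)
    then have "cl u \<odot> gen i = gen c \<odot> cl u"
      by (intro conj_gen) auto
    then have "cl (c # u) \<odot> gen i = gen c \<odot> (gen c \<odot> cl u)"
      unfolding cl_Cons by (metis cl_in_W gen_in_W m_assoc)
    also have "\<dots> = cl u"
      by (metis cl_in_W gen_in_W gen_square l_one m_assoc)
    finally show ?thesis
      using Cons.hyps by (intro bexI[of _ u]) auto
  qed
qed

text \<open>If a shortest word over \<open>L\<close> had a last letter \<open>i\<close>, the prefix
  before it would send \<alpha> i to a negative root, and \<open>exchange\<close> would produce a
  shorter word for \<open>w\<close>.\<close>

lemma parabolic_nonneg_imp_one:
  assumes "w \<in> parabolic m L" "\<And>i. i \<in> L \<Longrightarrow> 0 \<le> act m w (\<alpha> i)"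
  shows "w = e"
proof -
  have "\<exists>u. u \<in> lists L \<and> w = cl u"
    using assms by (auto simp: parabolic_eq)
  then obtain u where u: "u \<in> lists L" "w = cl u"
    and least: "\<And>v. v \<in> lists L \<Longrightarrow> w = cl v \<Longrightarrow> length u \<le> length v"
    using ex_has_least_nat[of "\<lambda>u. u \<in> lists L \<and> w = cl u" _ length] by metis
  have "u = []"
  proof (rule ccontr)
    assume "u \<noteq> []"
    then obtain v i where v: "u = v @ [i]"
      by (metis rev_exhaust)
    then have w: "w = cl v \<odot> gen i"
      using u by (simp add: simple_gen_def)
    have "0 \<le> act m w (\<alpha> i)"
      using assms(2)[of i] u v by auto
    then have "act m (cl v) (\<alpha> i) \<le> 0"
      unfolding w by (simp add: linear_neg[OF linear_rep] less_eq_vec_def)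
    then obtain v' where "v' \<in> lists L" "length v = Suc (length v')" "cl v \<odot> gen i = cl v'"
      using exchange[of v L i] u v by auto
    with least[of v'] v w show False
      by auto
  qed
  with u show ?thesis
    by (simp add: one_eq)
qed

lemma parabolic_eqI:
  assumes "g \<in> parabolic m L" "h \<in> parabolic m L"
    and "\<And>i. i \<in> L \<Longrightarrow> 0 \<le> act m g (act m (ginv h) (\<alpha> i))"
  shows "g = h"
proof -
  have "g \<odot> ginv h = e"
    using assms by (intro parabolic_nonneg_imp_one[of _ L]) auto
  then show ?thesis
    using assms by (metis inv_closed inv_inv inv_equality parabolic_in_W)
qed

text \<open>Prefixing a letter \<open>i\<close> creates at most one new inversion, the root that the
  rest of the word carries to \<alpha> i.\<close>

lemma finite_inversions:
  assumes "w \<in> W"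
  shows "finite {r \<in> roots m. 0 \<le> r \<and> act m w r \<le> 0}"
proof -
  have "finite {r \<in> roots m. 0 \<le> r \<and> rep u r \<le> 0}" for u
  proof (induction u)
    case Nil
    have "{r \<in> roots m. 0 \<le> r \<and> r \<le> 0} = {}"
      using root_not_both by blast
    then show ?case
      by (simp only: foldr.simps id_apply finite.emptyI)
  next
    case (Cons i u)
    have "{r \<in> roots m. 0 \<le> r \<and> rep (i # u) r \<le> 0} \<subseteq>
        {r \<in> roots m. 0 \<le> r \<and> rep u r \<le> 0} \<union> {act m (ginv (cl u)) (\<alpha> i)}"
    proof
      fix r assume "r \<in> {r \<in> roots m. 0 \<le> r \<and> rep (i # u) r \<le> 0}"
      then have r: "r \<in> roots m" "0 \<le> r" "simple_refl m i (rep u r) \<le> 0"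
        by auto
      show "r \<in> {r \<in> roots m. 0 \<le> r \<and> rep u r \<le> 0} \<union> {act m (ginv (cl u)) (\<alpha> i)}"
      proof (cases "rep u r \<le> 0")
        case False
        have "act m (cl u) r \<in> roots m"
          using r by blast
        then have "act m (cl u) r = \<alpha> i"
          using r False by (intro root_refl_neg) (auto simp: root_neg_iff)
        then show ?thesis
          using act_inv[of "cl u" r] by auto
      qed (use r in auto)
    qed
    with Cons show ?case
      by (auto intro: finite_subset)
  qed
  then show ?thesis
    using assms by (auto simp: W_eq)
qed

text \<open>\<open>g\<close> is an element of minimal length in the coset of \<open>w\<close>, so no
  letter of \<open>L\<close> is a descent of it.\<close>

lemma coset_factor:
  assumes "w \<in> W"
  obtains g h where "g \<in> W" "h \<in> parabolic m L" "w = g \<odot> h"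
    "\<And>i. i \<in> L \<Longrightarrow> 0 \<le> act m g (\<alpha> i)"
proof -
  obtain h where h: "h \<in> parabolic m L"
    and least: "\<And>k. k \<in> parabolic m L \<Longrightarrow> len (w \<odot> h) \<le> len (w \<odot> k)"
    using ex_has_least_nat[of "\<lambda>h. h \<in> parabolic m L" e "\<lambda>h. len (w \<odot> h)"] by auto
  show ?thesis
  proof (rule that[of "w \<odot> h" "ginv h"])
    fix i assume "i \<in> L"
    then have "len (w \<odot> h) \<le> len (w \<odot> h \<odot> gen i)"
      using h assms least[of "h \<odot> gen i"] by (auto simp: m_assoc)
    then show "0 \<le> act m (w \<odot> h) (\<alpha> i)"
      using len_mult_gen_neq[of "w \<odot> h" i] h assms by (auto simp: act_nonneg_iff simp del: act_mult)
  qed (use assms h in \<open>auto simp: m_assoc\<close>)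
qed

text \<open>A simple root is indecomposable among the nonnegative combinations of positive roots.\<close>

lemma simple_root_image:
  assumes "w \<in> W" "\<epsilon> = 1 \<or> \<epsilon> = - 1" "0 \<le> \<epsilon> *\<^sub>R act m w (\<alpha> i)"
    and pos: "\<And>l. act m w (\<alpha> i) $ l \<noteq> 0 \<Longrightarrow> 0 \<le> \<epsilon> *\<^sub>R act m (ginv w) (\<alpha> l)"
  shows "\<exists>l. act m w (\<alpha> i) = \<epsilon> *\<^sub>R \<alpha> l"
proof -
  \<comment> \<open>The sign \<open>\<epsilon> = 1\<close> serves elements that carry simple roots
    to simple roots, \<open>\<epsilon> = - 1\<close> the longest elements of finite parabolic
    subgroups.\<close>
  have ee: "\<epsilon> * \<epsilon> = 1"
    using assms(2) by auto
  define v where "v = \<epsilon> *\<^sub>R act m w (\<alpha> i)"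
  have v: "0 \<le> v $ l" for l
    using assms(3) by (simp add: v_def less_eq_vec_def)
  define \<gamma> where "\<gamma> l = \<epsilon> *\<^sub>R act m (ginv w) (\<alpha> l)" for l
  have \<gamma>: "0 \<le> \<gamma> l $ k" if "v $ l \<noteq> 0" for l k
    using pos[of l] that by (simp add: \<gamma>_def v_def less_eq_vec_def)
  have "act m w (\<alpha> i) \<noteq> 0"
    using assms root_nonzero by blast
  then obtain l where l: "v $ l \<noteq> 0"
    using assms(2) by (auto simp: v_def vec_eq_iff)
  have "act m (ginv w) v = \<epsilon> *\<^sub>R \<alpha> i"
    using assms(1) by (simp add: v_def linear_cmul[OF linear_act])
  then have "\<alpha> i = \<epsilon> *\<^sub>R act m (ginv w) v"
    using ee by simp
  also have "\<dots> = (\<Sum>l\<in>UNIV. v $ l *\<^sub>R \<gamma> l)"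
    using assms(1) by (simp add: act_expansion[of "ginv w" v] scaleR_right.sum \<gamma>_def mult.commute)
  finally have sum: "\<alpha> i $ k = (\<Sum>l\<in>UNIV. v $ l * \<gamma> l $ k)" for k
    by (simp add: vec_eq_iff)
  \<comment> \<open>Away from \<open>i\<close> the coordinates of \<alpha> i are vanishing sums of
    nonnegative terms, so every contributing root lies on the line of \<alpha> i.\<close>
  have "\<gamma> l \<in> V {i}"
    unfolding V_def
  proof (clarsimp)
    fix k assume "k \<noteq> i"
    then have "(\<Sum>l\<in>UNIV. v $ l * \<gamma> l $ k) = 0"
      using sum[of k] by (simp add: simple_root_other)
    moreover have "0 \<le> v $ l * \<gamma> l $ k" for l
      using v \<gamma> by (cases "v $ l = 0") auto
    ultimately have "v $ l * \<gamma> l $ k = 0"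
      by (simp add: sum_nonneg_eq_0_iff)
    with l show "\<gamma> l $ k = 0"
      by simp
  qed
  moreover have "\<gamma> l \<in> roots m" "0 \<le> \<gamma> l"
    using assms(1,2) minus_roots \<gamma> l by (auto simp: \<gamma>_def less_eq_vec_def)
  ultimately have "\<gamma> l = \<alpha> i"
    using nonneg_root_single by blast
  then have "act m w (\<alpha> i) = \<epsilon> *\<^sub>R act m w (act m (ginv w) (\<alpha> l))"
    unfolding \<gamma>_def using linear_cmul[OF linear_act[OF assms(1)]] by metis
  then have "act m w (\<alpha> i) = \<epsilon> *\<^sub>R \<alpha> l"
    using assms(1) by simp
  then show ?thesis ..
qed

text \<open>Let \<open>r\<close> in \<open>V I\<close> be the image of \<alpha> s under
  \<open>w\<close>, and factor the inverse of \<open>w\<close> as \<open>g \<odot> h\<close> with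
  \<open>g\<close> positive on \<open>I\<close>. The preimage of \<alpha> s under \<open>g\<close>
  is a positive root in \<open>V I\<close>; as \<open>g\<close> keeps the simple roots in its
  support positive and sends it to a simple root, it is simple by indecomposability. The inverse of
  \<open>h\<close> carries it to \<open>r\<close>.\<close>

lemma roots_of_eq: "roots_of m I = roots m \<inter> V I"
proof (intro equalityI subsetI)
  fix r assume "r \<in> roots_of m I"
  then obtain w i where w: "r = act m w (\<alpha> i)" "i \<in> I" "w \<in> parabolic m I"
    by (auto simp: roots_of_def)
  then show "r \<in> roots m \<inter> V I"
    using parabolic_act_V[of w I I "\<alpha> i"] by auto
next
  fix r assume "r \<in> roots m \<inter> V I"
  then obtain w s where w: "w \<in> W" "r = act m w (\<alpha> s)" and rV: "r \<in> V I"
    by (auto elim: rootsE)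
  obtain g h where g: "g \<in> W" "h \<in> parabolic m I" "ginv w = g \<odot> h"
    and pos: "\<And>i. i \<in> I \<Longrightarrow> 0 \<le> act m g (\<alpha> i)"
    using coset_factor[of "ginv w" I] w by blast
  have "w = ginv h \<odot> ginv g"
    using g w by (metis inv_inv inv_mult_group parabolic_in_W)
  then have r: "r = act m (ginv h) (act m (ginv g) (\<alpha> s))"
    using g w by auto
  define \<gamma> where "\<gamma> = act m (ginv g) (\<alpha> s)"
  have \<gamma>V: "\<gamma> \<in> V I"
    using rV g parabolic_act_V[of "ginv h" I I \<gamma>] by (auto simp: r \<gamma>_def)
  have g\<gamma>: "act m g \<gamma> = \<alpha> s"
    using g by (simp add: \<gamma>_def)
  have "\<gamma> \<in> roots m"
    using g by (auto simp: \<gamma>_def)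
  have "0 \<le> \<gamma>"
  proof (rule ccontr)
    assume "\<not> 0 \<le> \<gamma>"
    then have "0 \<le> - \<gamma>"
      using root_sign[OF \<open>\<gamma> \<in> roots m\<close>] by auto
    then have "0 \<le> act m g (- \<gamma>)"
      using act_nonneg_V[OF g(1) V_minus[OF \<gamma>V] _ pos] by blast
    then have "\<alpha> s \<le> 0"
      using g\<gamma> g by (simp add: act_minus)
    then show False
      using root_not_both[of "\<alpha> s"] by auto
  qed
  then have "\<exists>l. \<gamma> = 1 *\<^sub>R \<alpha> l"
    unfolding \<gamma>_def using g pos \<gamma>V
    by (intro simple_root_image) (auto simp: \<gamma>_def V_def)
  then obtain l where "\<gamma> = \<alpha> l"
    by auto
  then have "r = act m (ginv h) (\<alpha> l)" "l \<in> I"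
    using \<gamma>V r by (auto simp: \<gamma>_def)
  with g show "r \<in> roots_of m I"
    unfolding roots_of_def using parabolic_inv by blast
qed

lemma pos_roots_of_eq: "pos_roots_of m I = {r \<in> roots m. r \<in> V I \<and> 0 \<le> r}"
  and neg_roots_of_eq: "neg_roots_of m I = {r \<in> roots m. r \<in> V I \<and> r \<le> 0}"
  by (auto simp: pos_roots_of_def neg_roots_of_def pos_roots_def neg_roots_def roots_of_eq less_eq_vec_def)

text \<open>Converts the minimality in \<open>Cham\<close> into signs. If \<open>x \<odot> h\<close>
  is shortest in the coset and \<open>h\<close> made a simple root of \<open>I\<close> negative,
  then \<open>x \<odot> h\<close> would do so too, and the corresponding letter would shorten it
  further.\<close>

lemma min_coset_iff:
  assumes "x \<in> W"
  shows "(\<forall>y \<in> x <#\<^bsub>cox_group m\<^esub> parabolic m I. len x \<le> len y) \<longleftrightarrow> (\<forall>i\<in>I. 0 \<le> act m x (\<alpha> i))"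
proof (intro iffI ballI)
  fix i assume min: "\<forall>y \<in> x <#\<^bsub>cox_group m\<^esub> parabolic m I. len x \<le> len y" and "i \<in> I"
  then have "x \<odot> gen i \<in> x <#\<^bsub>cox_group m\<^esub> parabolic m I"
    by (auto simp: l_coset_def)
  then show "0 \<le> act m x (\<alpha> i)"
    using min assms len_mult_gen_neq[OF assms, of i] by (metis act_nonneg_iff(1) le_neq_implies_less)
next
  fix y assume pos: "\<forall>i\<in>I. 0 \<le> act m x (\<alpha> i)" and "y \<in> x <#\<^bsub>cox_group m\<^esub> parabolic m I"
  then obtain k where k: "k \<in> parabolic m I" "y = x \<odot> k"
    by (auto simp: l_coset_def)
  obtain h where h: "h \<in> parabolic m I"
    and least: "\<And>k. k \<in> parabolic m I \<Longrightarrow> len (x \<odot> h) \<le> len (x \<odot> k)"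
    using ex_has_least_nat[of "\<lambda>h. h \<in> parabolic m I" e "\<lambda>h. len (x \<odot> h)"] by auto
  have "h = e"
  proof (rule parabolic_nonneg_imp_one[OF h], rule ccontr)
    fix i assume i: "i \<in> I" and neg: "\<not> 0 \<le> act m h (\<alpha> i)"
    have root: "act m h (\<alpha> i) \<in> roots m"
      using h by blast
    have "0 \<le> - act m h (\<alpha> i)"
      using root_sign[OF root] neg by auto
    moreover have "- act m h (\<alpha> i) \<in> V I"
      using h i parabolic_act_V[of h I I "\<alpha> i"] by (auto intro: V_minus)
    ultimately have "0 \<le> act m x (- act m h (\<alpha> i))"
      using pos assms act_nonneg_V[of x "- act m h (\<alpha> i)" I] by blast
    then have "act m (x \<odot> h) (\<alpha> i) \<le> 0"
      using assms h by (simp add: act_minus parabolic_in_W)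
    then have "len (x \<odot> h \<odot> gen i) < len (x \<odot> h)"
      using assms h act_nonneg_iff(2)[of "x \<odot> h" i] by auto
    then show False
      using least[of "h \<odot> gen i"] i h assms by (auto simp: m_assoc)
  qed
  with least k assms show "len x \<le> len y"
    by auto
qed

end

section \<open>Chambers of the Tits cone intersection\<close>

text \<open>Adding a small positive multiple of \<open>d\<close> turns weak inequalities into strict
  ones.\<close>

lemma closure_open_cone:
  fixes a :: "'i \<Rightarrow> 'e::euclidean_space"
  assumes "\<And>i. i \<in> I \<Longrightarrow> d \<bullet> a i = 0" "\<And>i. i \<in> J \<Longrightarrow> 0 < d \<bullet> a i"
  shows "closure {\<phi>. (\<forall>i\<in>I. \<phi> \<bullet> a i = 0) \<and> (\<forall>i\<in>J. 0 < \<phi> \<bullet> a i)} =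
    {\<phi>. (\<forall>i\<in>I. \<phi> \<bullet> a i = 0) \<and> (\<forall>i\<in>J. 0 \<le> \<phi> \<bullet> a i)}" (is "closure ?S = ?T")
proof
  have "?T = (\<Inter>i\<in>I. {\<phi>. a i \<bullet> \<phi> = 0}) \<inter> (\<Inter>i\<in>J. {\<phi>. a i \<bullet> \<phi> \<ge> 0})"
    by (auto simp: inner_commute)
  then have "closed ?T"
    by (auto intro!: closed_Int closed_INT closed_hyperplane closed_halfspace_ge)
  then show "closure ?S \<subseteq> ?T"
    by (rule closure_minimal[rotated]) (auto intro: less_imp_le)
  show "?T \<subseteq> closure ?S"
  proof
    fix \<phi> assume \<phi>: "\<phi> \<in> ?T"
    have "(\<lambda>n. \<phi> + inverse (real (Suc n)) *\<^sub>R d) \<longlonglongrightarrow> \<phi> + 0 *\<^sub>R d"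
      by (intro tendsto_intros LIMSEQ_inverse_real_of_nat)
    moreover have "\<phi> + inverse (real (Suc n)) *\<^sub>R d \<in> ?S" for n
      using \<phi> assms by (auto simp: inner_add_left intro!: add_nonneg_pos)
    ultimately show "\<phi> \<in> closure ?S"
      unfolding closure_sequential by (metis (no_types, lifting) add.right_neutral scaleR_zero_left)
  qed
qed

context coxeter begin

abbreviation "ch \<equiv> chamber_of m"

section \<open>The pairs in \<open>Cham\<close> in terms of simple roots\<close>

lemma act_V_image:
  assumes "x \<in> W" "act m x ` \<alpha> ` I \<subseteq> \<alpha> ` J" "v \<in> V I"
  shows "act m x v \<in> V J"
proof -
  have "act m x (\<alpha> i) \<in> V J" if "i \<in> I" for i
  proof -
    have "act m x (\<alpha> i) \<in> \<alpha> ` J"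
      using assms(2) that by blast
    then show ?thesis
      by auto
  qed
  then show ?thesis
    unfolding act_V_expansion[OF assms(1,3)]
    by (intro subspace_sum[OF subspace_V] V_scale)
qed

lemma simple_image_inv:
  assumes "x \<in> W" "act m x ` \<alpha> ` I = \<alpha> ` J"
  shows "act m (ginv x) ` \<alpha> ` J = \<alpha> ` I"
  unfolding assms(2)[symmetric] using assms(1) by (simp add: image_image)

text \<open>The inverse of \<open>g\<close> is positive on \<open>J\<close>: a negative root in
  \<open>V I\<close> would be sent by \<open>g\<close> to a negative vector and not to a simple
  root. Then \<open>simple_root_image\<close> applies in both directions.\<close>

lemma simple_image_eq:
  assumes "g \<in> W" "\<And>i. i \<in> I \<Longrightarrow> 0 \<le> act m g (\<alpha> i)" "\<And>i. i \<in> I \<Longrightarrow> act m g (\<alpha> i) \<in> V J"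
    and inv: "\<And>j. j \<in> J \<Longrightarrow> act m (ginv g) (\<alpha> j) \<in> V I"
  shows "act m g ` \<alpha> ` I = \<alpha> ` J"
proof -
  have pos: "0 \<le> act m (ginv g) (\<alpha> j)" if j: "j \<in> J" for j
  proof (rule ccontr)
    assume "\<not> ?thesis"
    moreover have "act m (ginv g) (\<alpha> j) \<in> roots m"
      using assms(1) by auto
    ultimately have "0 \<le> - act m (ginv g) (\<alpha> j)"
      using root_sign by auto
    from act_nonneg_V[OF assms(1) V_minus[OF inv[OF j]] this assms(2)] have "\<alpha> j \<le> 0"
      using assms(1) by (simp add: act_minus)
    then show False
      using root_not_both[of "\<alpha> j"] by auto
  qed
  have 1: "act m g (\<alpha> i) \<in> \<alpha> ` J" if i: "i \<in> I" for i
  proof -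
    have "\<exists>l. act m g (\<alpha> i) = 1 *\<^sub>R \<alpha> l"
      using assms(1,2) assms(3)[OF i] pos i
      by (intro simple_root_image) (auto simp: V_def)
    then show ?thesis
      using assms(3)[OF i] by auto
  qed
  have 2: "act m (ginv g) (\<alpha> j) \<in> \<alpha> ` I" if j: "j \<in> J" for j
  proof -
    have "\<exists>l. act m (ginv g) (\<alpha> j) = 1 *\<^sub>R \<alpha> l"
      using assms(1,2) inv[OF j] pos[OF j]
      by (intro simple_root_image) (auto simp: V_def)
    then show ?thesis
      using inv[OF j] by auto
  qed
  have "\<alpha> j \<in> act m g ` \<alpha> ` I" if j: "j \<in> J" for j
  proof -
    have "\<alpha> j = act m g (act m (ginv g) (\<alpha> j))"
      using assms(1) by simp
    with 2[OF j] show ?thesis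
      by blast
  qed
  with 1 show ?thesis
    by blast
qed

lemma parabolic_conj:
  assumes "x \<in> W" "act m x ` \<alpha> ` I \<subseteq> \<alpha> ` J" "h \<in> parabolic m I"
  shows "x \<odot> h \<odot> ginv x \<in> parabolic m J"
proof -
  have "x \<odot> cl u \<odot> ginv x \<in> parabolic m J" if "set u \<subseteq> I" for u
    using that
  proof (induction u)
    case Nil
    then show ?case
      using assms(1) by (simp add: one_eq[symmetric])
  next
    case (Cons i u)
    then obtain j where j: "j \<in> J" "act m x (\<alpha> i) = \<alpha> j"
      using assms(2) by auto
    have "x \<odot> cl (i # u) \<odot> ginv x = x \<odot> gen i \<odot> cl u \<odot> ginv x"
      using assms(1) by (simp add: cl_Cons m_assoc del: cl_mult)
    also have "\<dots> = gen j \<odot> (x \<odot> cl u \<odot> ginv x)"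
      using assms(1) by (simp add: conj_gen[OF assms(1) j(2)] m_assoc)
    finally show ?case
      using Cons j by simp
  qed
  then show ?thesis
    using assms(3) unfolding parabolic_eq by (auto simp: subset_iff)
qed

text \<open>The form in which chambers are handled from here on. Equality of the cosets turns a
  reflection from \<open>I\<close> into an element of the parabolic subgroup of \<open>J\<close>
  that negates the image of the simple root, and such an element moves vectors only along
  \<open>V J\<close>.\<close>

lemma Cham_iff: "(x, I) \<in> Cham m J \<longleftrightarrow> x \<in> W \<and> act m x ` \<alpha> ` I = \<alpha> ` J"
proof (intro iffI conjI)
  assume C: "(x, I) \<in> Cham m J"
  then show x: "x \<in> W"
    by (simp add: Cham_def)
  have pos: "0 \<le> act m x (\<alpha> i)" if "i \<in> I" for i
    using C min_coset_iff[OF x, of I] that by (auto simp: Cham_def)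
  have eq: "parabolic m J #>\<^bsub>cox_group m\<^esub> x = x <#\<^bsub>cox_group m\<^esub> parabolic m I"
    using C by (simp add: Cham_def)
  \<comment> \<open>Here the displacement of \<open>v\<close> under \<open>h\<close> is
    \<open>- 2 v\<close>, and displacements lie in \<open>V A\<close>.\<close>
  have half: "v \<in> V A" if "h \<in> parabolic m A" "act m h v = - v" for h v A
    using V_scale[OF parabolic_act_diff[OF that(1), of v], of "- 1 / 2"] that(2)
    by (simp flip: scaleR_2)
  show "act m x ` \<alpha> ` I = \<alpha> ` J"
  proof (rule simple_image_eq[OF x pos])
    fix i assume i: "i \<in> I"
    then have "x \<odot> gen i \<in> parabolic m J #>\<^bsub>cox_group m\<^esub> x"
      unfolding eq by (auto simp: l_coset_def)
    then obtain h where h: "h \<in> parabolic m J" "x \<odot> gen i = h \<odot> x"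
      by (auto simp: r_coset_def)
    then have "act m h (act m x (\<alpha> i)) = - act m x (\<alpha> i)"
      using x act_mult[of x "gen i" "\<alpha> i"] by (simp add: act_minus)
    then show "act m x (\<alpha> i) \<in> V J"
      using half h(1) by blast
  next
    fix j assume j: "j \<in> J"
    then have "gen j \<odot> x \<in> x <#\<^bsub>cox_group m\<^esub> parabolic m I"
      unfolding eq[symmetric] by (auto simp: r_coset_def)
    then obtain h where h: "h \<in> parabolic m I" "gen j \<odot> x = x \<odot> h"
      by (auto simp: l_coset_def)
    then have "act m x (act m h (act m (ginv x) (\<alpha> j))) = - \<alpha> j"
      using x act_mult[of "gen j" x "act m (ginv x) (\<alpha> j)"] by simp
    then have "act m h (act m (ginv x) (\<alpha> j)) = - act m (ginv x) (\<alpha> j)"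
      using x h(1) by (metis act_inv act_minus inv_closed)
    then show "act m (ginv x) (\<alpha> j) \<in> V I"
      using half h(1) by blast
  qed
next
  assume C: "x \<in> W \<and> act m x ` \<alpha> ` I = \<alpha> ` J"
  then have x: "x \<in> W" and im: "act m x ` \<alpha> ` I = \<alpha> ` J"
    by auto
  have pos: "0 \<le> act m x (\<alpha> i)" if "i \<in> I" for i
    using im that by (metis imageE image_eqI simple_root_nonneg)
  have "x \<odot> h \<in> parabolic m J #>\<^bsub>cox_group m\<^esub> x" if h: "h \<in> parabolic m I" for h
    unfolding r_coset_def
    using parabolic_conj[OF x _ h, of J] im x h by (auto intro!: bexI[of _ "x \<odot> h \<odot> ginv x"] simp: m_assoc)
  moreover have "h \<odot> x \<in> x <#\<^bsub>cox_group m\<^esub> parabolic m I" if h: "h \<in> parabolic m J" for h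
    unfolding l_coset_def
    using parabolic_conj[OF inv_closed[OF x] _ h, of I] simple_image_inv[OF x im] x h
    by (auto intro!: bexI[of _ "ginv x \<odot> h \<odot> x"] simp: m_assoc[symmetric])
  ultimately have "parabolic m J #>\<^bsub>cox_group m\<^esub> x = x <#\<^bsub>cox_group m\<^esub> parabolic m I"
    by (auto simp: l_coset_def[of _ x] r_coset_def[of _ _ x])
  then show "(x, I) \<in> Cham m J"
    using x pos min_coset_iff[OF x, of I] by (simp add: Cham_def)
qed

lemma ChamD:
  assumes "(x, I) \<in> Cham m J"
  shows "x \<in> W" "act m x ` \<alpha> ` I = \<alpha> ` J" "act m (ginv x) ` \<alpha> ` J = \<alpha> ` I"
  using assms simple_image_inv by (auto simp: Cham_iff)

lemma Cham_V: "(x, I) \<in> Cham m J \<Longrightarrow> act m x v \<in> V J \<longleftrightarrow> v \<in> V I"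
  and Cham_V_inv: "(x, I) \<in> Cham m J \<Longrightarrow> act m (ginv x) v \<in> V I \<longleftrightarrow> v \<in> V J"
  using ChamD[of x I J] act_V_image[of x I J] act_V_image[of "ginv x" J I]
  by (metis act_inv act_inv' inv_closed order_refl)+

lemma Cham_simple: "(x, I) \<in> Cham m J \<Longrightarrow> i \<in> I \<Longrightarrow> \<exists>j\<in>J. act m x (\<alpha> i) = \<alpha> j"
  and Cham_simple_inv: "(x, I) \<in> Cham m J \<Longrightarrow> j \<in> J \<Longrightarrow> \<exists>i\<in>I. act m (ginv x) (\<alpha> j) = \<alpha> i"
  using ChamD[of x I J] by blast+

section \<open>Chambers and the Tits cone through pairings with roots\<close>

lemma inner_dual_act:
  assumes "w \<in> W"
  shows "dual_act m w \<phi> \<bullet> v = \<phi> \<bullet> act m (ginv w) v"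
proof -
  have "dual_act m w \<phi> \<bullet> v = (\<Sum>i\<in>UNIV. v $ i * (\<phi> \<bullet> act m (ginv w) (\<alpha> i)))"
    unfolding dual_act_def by (subst inner_vec_def) (simp add: mult.commute)
  also have "\<dots> = \<phi> \<bullet> act m (ginv w) v"
    using assms by (simp add: act_expansion[of _ v] inner_sum_right)
  finally show ?thesis .
qed

lemma mem_chamber:
  assumes "w \<in> W"
  shows "\<phi> \<in> ch (w, I) \<longleftrightarrow>
    (\<forall>i\<in>I. \<phi> \<bullet> act m w (\<alpha> i) = 0) \<and> (\<forall>i\<in>-I. 0 < \<phi> \<bullet> act m w (\<alpha> i))"
proof
  assume "\<phi> \<in> ch (w, I)"
  then obtain \<theta> where "\<phi> = dual_act m w \<theta>" "\<theta> \<in> open_face I"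
    by (auto simp: chamber_of_def)
  then show "(\<forall>i\<in>I. \<phi> \<bullet> act m w (\<alpha> i) = 0) \<and> (\<forall>i\<in>-I. 0 < \<phi> \<bullet> act m w (\<alpha> i))"
    using assms by (auto simp: open_face_def Theta_def inner_dual_act)
next
  assume *: "(\<forall>i\<in>I. \<phi> \<bullet> act m w (\<alpha> i) = 0) \<and> (\<forall>i\<in>-I. 0 < \<phi> \<bullet> act m w (\<alpha> i))"
  have "dual_act m w (dual_act m (ginv w) \<phi>) \<bullet> v = \<phi> \<bullet> v" for v
    using assms by (simp add: inner_dual_act)
  then have "\<phi> = dual_act m w (dual_act m (ginv w) \<phi>)"
    using vector_eq_rdot by metis
  moreover have "dual_act m (ginv w) \<phi> \<in> open_face I"
    using assms * by (auto simp: open_face_def Theta_def inner_dual_act)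
  ultimately show "\<phi> \<in> ch (w, I)"
    by (auto simp: chamber_of_def)
qed

lemma ex_chamber_point:
  assumes "w \<in> W"
  shows "\<exists>\<phi>. \<phi> \<in> ch (w, I)"
proof -
  have "(\<chi> i. if i \<in> I then 0 else 1) \<in> open_face I"
    by (auto simp: open_face_def Theta_def inner_simple_root)
  then show ?thesis
    by (auto simp: chamber_of_def)
qed

lemma closure_chamber:
  assumes "w \<in> W"
  shows "closure (ch (w, I)) =
    {\<phi>. (\<forall>i\<in>I. \<phi> \<bullet> act m w (\<alpha> i) = 0) \<and> (\<forall>i\<in>-I. 0 \<le> \<phi> \<bullet> act m w (\<alpha> i))}"
proof -
  obtain d where "d \<in> ch (w, I)"
    using ex_chamber_point[OF assms] by blast
  then have d: "\<And>i. i \<in> I \<Longrightarrow> d \<bullet> act m w (\<alpha> i) = 0" "\<And>i. i \<in> - I \<Longrightarrow> 0 < d \<bullet> act m w (\<alpha> i)"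
    using mem_chamber[OF assms] by blast+
  have "ch (w, I) = {\<phi>. (\<forall>i\<in>I. \<phi> \<bullet> act m w (\<alpha> i) = 0) \<and> (\<forall>i\<in>-I. 0 < \<phi> \<bullet> act m w (\<alpha> i))}"
    using mem_chamber[OF assms] by auto
  then show ?thesis
    using closure_open_cone[of I d "\<lambda>i. act m w (\<alpha> i)" "- I"] d by auto
qed

lemma mem_tits_cone: "\<phi> \<in> tits_cone m \<longleftrightarrow> (\<exists>w\<in>W. \<forall>i. 0 \<le> \<phi> \<bullet> act m w (\<alpha> i))"
proof -
  have cl: "closure fund_chamber = {\<phi>. \<forall>i. 0 \<le> \<phi> \<bullet> \<alpha> i}"
    using closure_open_cone[of "{}" "\<chi> i. 1" \<alpha> UNIV] by (simp add: fund_chamber_def inner_simple_root)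
  have eq: "\<phi> = dual_act m w (dual_act m (ginv w) \<phi>)" if "w \<in> W" for w
  proof -
    have "dual_act m w (dual_act m (ginv w) \<phi>) \<bullet> v = \<phi> \<bullet> v" for v
      using that by (simp add: inner_dual_act)
    then show ?thesis
      using vector_eq_rdot by metis
  qed
  show ?thesis
  proof
    assume "\<phi> \<in> tits_cone m"
    then obtain w \<theta> where "w \<in> W" "\<phi> = dual_act m w \<theta>" "\<forall>i. 0 \<le> \<theta> \<bullet> \<alpha> i"
      by (auto simp: tits_cone_def cl)
    then show "\<exists>w\<in>W. \<forall>i. 0 \<le> \<phi> \<bullet> act m w (\<alpha> i)"
      by (intro bexI[of _ w]) (simp_all add: inner_dual_act)
  next
    assume "\<exists>w\<in>W. \<forall>i. 0 \<le> \<phi> \<bullet> act m w (\<alpha> i)"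
    then obtain w where w: "w \<in> W" "\<forall>i. 0 \<le> \<phi> \<bullet> act m w (\<alpha> i)"
      by blast
    then have "dual_act m (ginv w) \<phi> \<in> closure fund_chamber"
      by (simp add: cl inner_dual_act)
    with w(1) eq[OF w(1)] show "\<phi> \<in> tits_cone m"
      unfolding tits_cone_def by blast
  qed
qed

lemma Theta_V: "\<phi> \<in> Theta J \<Longrightarrow> v \<in> V J \<Longrightarrow> \<phi> \<bullet> v = 0"
  by (subst V_expansion[of v J]) (auto simp: inner_sum_right Theta_def)

text \<open>The functional dual to a simple root outside \<open>J\<close> lies in
  \<open>Theta J\<close> and reads off that coordinate of \<open>r\<close>. Thus the arrangement is
  indexed by the roots outside \<open>V J\<close>.\<close>

lemma Theta_subset_root_hyp: "Theta J \<subseteq> root_hyp r \<longleftrightarrow> r \<in> V J"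
proof
  assume sub: "Theta J \<subseteq> root_hyp r"
  have "r $ k = 0" if "k \<notin> J" for k
  proof -
    have "axis k 1 \<in> Theta J"
      using that by (auto simp: Theta_def inner_simple_root axis_def)
    then show ?thesis
      using sub by (auto simp: root_hyp_def inner_axis')
  qed
  then show "r \<in> V J"
    by (simp add: V_def)
qed (auto simp: root_hyp_def Theta_V)

lemma subspace_Theta: "subspace (Theta J)"
  by (auto simp: Theta_def subspace_def inner_add_left)

lemma Cham_Theta:
  assumes "(x, I) \<in> Cham m J"
  shows "\<phi> \<in> Theta J \<longleftrightarrow> (\<forall>i\<in>I. \<phi> \<bullet> act m x (\<alpha> i) = 0)"
proof -
  have "(\<forall>j\<in>J. \<phi> \<bullet> \<alpha> j = 0) \<longleftrightarrow> (\<forall>v\<in>\<alpha> ` J. \<phi> \<bullet> v = 0)"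
    by auto
  also have "\<dots> \<longleftrightarrow> (\<forall>i\<in>I. \<phi> \<bullet> act m x (\<alpha> i) = 0)"
    unfolding ChamD(2)[OF assms, symmetric] by auto
  finally show ?thesis
    by (simp add: Theta_def)
qed

lemma chamber_V:
  assumes "w \<in> W" "\<forall>i\<in>I. \<phi> \<bullet> act m w (\<alpha> i) = 0" "v \<in> V I"
  shows "\<phi> \<bullet> act m w v = 0"
  unfolding act_V_expansion[OF assms(1,3)] using assms(2) by (simp add: inner_sum_right)

lemma chamber_sign:
  assumes "w \<in> W" "\<phi> \<in> ch (w, I)" "\<beta> \<in> roots m"
  shows "\<beta> \<in> V I \<Longrightarrow> \<phi> \<bullet> act m w \<beta> = 0"
    and "\<beta> \<notin> V I \<Longrightarrow> 0 \<le> \<beta> \<Longrightarrow> 0 < \<phi> \<bullet> act m w \<beta>"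
    and "\<beta> \<notin> V I \<Longrightarrow> \<not> 0 \<le> \<beta> \<Longrightarrow> \<phi> \<bullet> act m w \<beta> < 0"
proof -
  have zero: "\<forall>i\<in>I. \<phi> \<bullet> act m w (\<alpha> i) = 0" and pos: "\<forall>i\<in>-I. 0 < \<phi> \<bullet> act m w (\<alpha> i)"
    using mem_chamber[OF assms(1)] assms(2) by blast+
  show "\<phi> \<bullet> act m w \<beta> = 0" if "\<beta> \<in> V I"
    using chamber_V[OF assms(1) zero that] .
  have *: "0 < \<phi> \<bullet> act m w \<beta>" if \<beta>: "\<beta> \<notin> V I" "0 \<le> \<beta>" for \<beta>
  proof -
    obtain k where k: "k \<notin> I" "\<beta> $ k \<noteq> 0"
      using \<beta>(1) by (auto simp: V_def)
    have nn: "0 \<le> \<beta> $ i * (\<phi> \<bullet> act m w (\<alpha> i))" for i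
      using zero pos that(2) by (cases "i \<in> I") (auto simp: less_eq_vec_def intro!: mult_nonneg_nonneg intro: less_imp_le)
    have "0 < (\<Sum>i\<in>UNIV. \<beta> $ i * (\<phi> \<bullet> act m w (\<alpha> i)))"
    proof (rule sum_pos2[of _ k])
      show "0 < \<beta> $ k * (\<phi> \<bullet> act m w (\<alpha> k))"
      proof (rule mult_pos_pos)
        show "0 < \<beta> $ k"
          using k that(2) by (auto simp: less_eq_vec_def order_less_le)
      qed (use k pos in blast)
    qed (use nn in auto)
    then show ?thesis
      using assms(1) by (simp add: act_expansion[of _ \<beta>] inner_sum_right)
  qed
  show "\<beta> \<notin> V I \<Longrightarrow> 0 \<le> \<beta> \<Longrightarrow> 0 < \<phi> \<bullet> act m w \<beta>"
    by (rule *)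
  show "\<phi> \<bullet> act m w \<beta> < 0" if "\<beta> \<notin> V I" "\<not> 0 \<le> \<beta>"
  proof -
    have "0 \<le> - \<beta>"
      using root_sign[OF assms(3)] that(2) by auto
    moreover have "- \<beta> \<notin> V I"
      using that(1) V_minus[of "- \<beta>" I] by auto
    ultimately show ?thesis
      using *[of "- \<beta>"] assms(1) by (simp add: act_minus)
  qed
qed

lemma Cham_sign:
  assumes "(x, I) \<in> Cham m J" "\<phi> \<in> ch (x, I)" "r \<in> roots m" "r \<notin> V J"
  shows "0 \<le> act m (ginv x) r \<Longrightarrow> 0 < \<phi> \<bullet> r" "\<not> 0 \<le> act m (ginv x) r \<Longrightarrow> \<phi> \<bullet> r < 0"
  using chamber_sign(2,3)[of x \<phi> I "act m (ginv x) r"] ChamD(1)[OF assms(1)] assms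
    Cham_V_inv[OF assms(1)] by auto

lemma Cham_neq_zero:
  assumes "(x, I) \<in> Cham m J" "\<phi> \<in> ch (x, I)" "r \<in> roots m" "r \<notin> V J"
  shows "\<phi> \<bullet> r \<noteq> 0"
  using Cham_sign[OF assms] by force

text \<open>Simple roots of \<open>I\<close> go to simple roots of \<open>J\<close> and on to those
  of \<open>K\<close>, so only walls outside \<open>I\<close> can tell the pairs apart. If none of
  them has \<open>(y, K)\<close> on its far side, \<open>ginv y \<odot> x\<close> has no
  descent.\<close>

lemma Cham_eqI:
  assumes "(x, I) \<in> Cham m J" "(y, K) \<in> Cham m J"
    and "\<And>a. a \<notin> I \<Longrightarrow> 0 \<le> act m (ginv y) (act m x (\<alpha> a))"
  shows "x = y" "I = K"
proof -
  have x: "x \<in> W" and y: "y \<in> W"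
    using assms ChamD by auto
  have "ginv y \<odot> x = e"
  proof (rule all_nonneg_imp_one)
    fix i
    show "0 \<le> act m (ginv y \<odot> x) (\<alpha> i)"
    proof (cases "i \<in> I")
      case True
      then obtain j where "j \<in> J" "act m x (\<alpha> i) = \<alpha> j"
        using Cham_simple[OF assms(1)] by blast
      moreover obtain k where "act m (ginv y) (\<alpha> j) = \<alpha> k"
        using Cham_simple_inv[OF assms(2) \<open>j \<in> J\<close>] by blast
      ultimately show ?thesis
        using x y by simp
    qed (use assms(3) x y in simp)
  qed (use x y in simp)
  then show eq: "x = y"
    using x y by (metis inv_closed inv_equality inv_inv)
  have "\<alpha> ` I = \<alpha> ` K"
    using ChamD(3)[OF assms(1)] ChamD(3)[OF assms(2)] eq by simp
  then show "I = K"
    by (metis inj_image_eq_iff injI simple_root_inject)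
qed

lemma chamber_disjoint:
  assumes "(x, I) \<in> Cham m J" "(y, K) \<in> Cham m J" "\<phi> \<in> ch (x, I)" "\<phi> \<in> ch (y, K)"
  shows "(x, I) = (y, K)"
proof -
  have x: "x \<in> W" and y: "y \<in> W"
    using assms ChamD by auto
  have "0 \<le> act m (ginv y) (act m x (\<alpha> a))" if "a \<notin> I" for a
  proof (rule ccontr)
    assume neg: "\<not> ?thesis"
    have "act m x (\<alpha> a) \<notin> V J"
      using Cham_V[OF assms(1)] that by simp
    then have "\<phi> \<bullet> act m x (\<alpha> a) < 0"
      using Cham_sign(2)[OF assms(2,4)] neg x by auto
    moreover have "0 < \<phi> \<bullet> act m x (\<alpha> a)"
      using assms(3) mem_chamber[OF x] that by auto
    ultimately show False
      by simp
  qed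
  then show ?thesis
    using Cham_eqI[OF assms(1,2)] by simp
qed

section \<open>The connected components of the complement of the arrangement\<close>

definition chamber_nbhd :: "'v list set \<times> 'v set \<Rightarrow> (real^'v) set" where
  "chamber_nbhd = (\<lambda>(x, I). {\<phi>. \<forall>i\<in>-I. 0 < \<phi> \<bullet> act m x (\<alpha> i)})"

lemma open_chamber_nbhd: "open (chamber_nbhd D)"
proof -
  obtain x I where D: "D = (x, I)"
    by fastforce
  have "chamber_nbhd D = (\<Inter>i\<in>-I. {\<phi>. act m x (\<alpha> i) \<bullet> \<phi> > 0})"
    by (auto simp: D chamber_nbhd_def inner_commute)
  then show ?thesis
    by (simp only:) (intro open_INT ballI open_halfspace_gt, simp)
qed

lemma chamber_eq_nbhd: "D \<in> Cham m J \<Longrightarrow> ch D = Theta J \<inter> chamber_nbhd D"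
proof (cases D)
  fix x I assume "D \<in> Cham m J" "D = (x, I)"
  then have "(x, I) \<in> Cham m J"
    by simp
  then show "ch D = Theta J \<inter> chamber_nbhd D"
    unfolding \<open>D = (x, I)\<close> chamber_nbhd_def
    using Cham_Theta[of x I J] mem_chamber[OF ChamD(1)[of x I J]] by auto
qed

text \<open>One inclusion holds because each set \<open>ch D\<close> is relatively open, lies in the
  cone and avoids all hyperplanes. For the other, a point off the arrangement lies on a face of type
  \<open>I\<close> of some closed chamber; the roots vanishing at it are exactly those in
  \<open>V J\<close>, which makes the minimal coset representative \<open>g\<close> an element with
  \<open>(g, I)\<close> in \<open>Cham m J\<close>.\<close>

lemma complement_eq:
  "cone_interior m J - \<Union> (arrangement m J) = (\<Union>D\<in>Cham m J. ch D)"
proof (intro equalityI subsetI)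
  fix \<phi> assume "\<phi> \<in> (\<Union>D\<in>Cham m J. ch D)"
  then obtain x I where D: "(x, I) \<in> Cham m J" and \<phi>: "\<phi> \<in> ch (x, I)"
    by fastforce
  have x: "x \<in> W"
    using D ChamD by auto
  have "openin (top_of_set (Theta J)) (ch (x, I))"
    unfolding chamber_eq_nbhd[OF D] by (intro openin_open_Int open_chamber_nbhd)
  moreover have "ch (x, I) \<subseteq> tits_cone m \<inter> Theta J"
  proof
    fix \<psi> assume "\<psi> \<in> ch (x, I)"
    then have "0 \<le> \<psi> \<bullet> act m x (\<alpha> i)" for i
      using mem_chamber[OF x] by (cases "i \<in> I") (auto intro: less_imp_le)
    then show "\<psi> \<in> tits_cone m \<inter> Theta J"
      using x chamber_eq_nbhd[OF D] \<open>\<psi> \<in> ch (x, I)\<close> by (auto simp: mem_tits_cone)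
  qed
  ultimately have "\<phi> \<in> cone_interior m J"
    unfolding cone_interior_def interior_of_def using \<phi> by blast
  moreover have "\<phi> \<notin> H" if "H \<in> arrangement m J" for H
    using that Cham_neq_zero[OF D \<phi>] Theta_subset_root_hyp
    by (fastforce simp: arrangement_def root_hyp_def)
  ultimately show "\<phi> \<in> cone_interior m J - \<Union> (arrangement m J)"
    by blast
next
  fix \<phi> assume \<phi>: "\<phi> \<in> cone_interior m J - \<Union> (arrangement m J)"
  then have \<phi>T: "\<phi> \<in> Theta J" and "\<phi> \<in> tits_cone m"
    using interior_of_subset[of "top_of_set (Theta J)" "tits_cone m \<inter> Theta J"]
    unfolding cone_interior_def by auto
  then obtain w where w: "w \<in> W" "\<And>i. 0 \<le> \<phi> \<bullet> act m w (\<alpha> i)"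
    by (auto simp: mem_tits_cone)
  \<comment> \<open>The type of the face of the closed chamber of \<open>w\<close> that contains the
    point.\<close>
  define I where "I = {i. \<phi> \<bullet> act m w (\<alpha> i) = 0}"
  obtain g h where g: "g \<in> W" "h \<in> parabolic m I" "w = g \<odot> h"
    and pos: "\<And>i. i \<in> I \<Longrightarrow> 0 \<le> act m g (\<alpha> i)"
    using coset_factor[OF w(1), of I] by blast
  \<comment> \<open>The factor \<open>h\<close> changes simple roots only along \<open>V I\<close>,
    and \<phi> vanishes on the image of \<open>V I\<close> under \<open>w\<close>.\<close>
  have same: "\<phi> \<bullet> act m g (\<alpha> i) = \<phi> \<bullet> act m w (\<alpha> i)" for i
  proof -
    have "act m g (\<alpha> i) = act m w (act m (ginv h) (\<alpha> i))"
      using g by simp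
    also have "\<dots> = act m w (act m (ginv h) (\<alpha> i) - \<alpha> i) + act m w (\<alpha> i)"
      using w(1) by (simp add: linear_diff[OF linear_act])
    finally show ?thesis
      using chamber_V[OF w(1) _ parabolic_act_diff[OF parabolic_inv[OF g(2)], of "\<alpha> i"], of \<phi>]
      by (simp add: I_def inner_add_right)
  qed
  have \<phi>g: "\<phi> \<in> ch (g, I)"
    using w(2) same by (auto simp: mem_chamber[OF g(1)] I_def order_less_le)
  have vanish: "r \<in> V J \<longleftrightarrow> \<phi> \<bullet> r = 0" if "r \<in> roots m" for r
    using \<phi> \<phi>T Theta_V[of \<phi> J r] Theta_subset_root_hyp[of J r] that
    by (auto simp: arrangement_def root_hyp_def)
  have vanish': "\<beta> \<in> V I \<longleftrightarrow> \<phi> \<bullet> act m g \<beta> = 0" if "\<beta> \<in> roots m" for \<beta>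
    using chamber_sign[OF g(1) \<phi>g that] by (metis less_irrefl)
  have "act m g ` \<alpha> ` I = \<alpha> ` J"
  proof (rule simple_image_eq[OF g(1) pos])
    show "act m g (\<alpha> i) \<in> V J" if "i \<in> I" for i
      using that vanish vanish'[of "\<alpha> i"] g(1) by auto
    show "act m (ginv g) (\<alpha> j) \<in> V I" if "j \<in> J" for j
      using that vanish[of "\<alpha> j"] vanish'[of "act m (ginv g) (\<alpha> j)"] g(1) by auto
  qed
  then have "(g, I) \<in> Cham m J"
    using g(1) by (simp add: Cham_iff)
  with \<phi>g show "\<phi> \<in> (\<Union>D\<in>Cham m J. ch D)"
    by blast
qed

lemma convex_chamber:
  assumes "w \<in> W"
  shows "convex (ch (w, I))"
proof -
  have "ch (w, I) = (\<Inter>i\<in>I. {\<phi>. act m w (\<alpha> i) \<bullet> \<phi> = 0}) \<inter> (\<Inter>i\<in>-I. {\<phi>. act m w (\<alpha> i) \<bullet> \<phi> > 0})"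
    by (auto simp: mem_chamber[OF assms] inner_commute)
  then show ?thesis
    by (auto intro!: convex_Int convex_INT convex_hyperplane convex_halfspace_gt)
qed

text \<open>Convexity gives connectedness. A connected subset of the complement containing the
  chamber is cut into two disjoint relatively open pieces, by the neighbourhood of this chamber and
  by those of all others, so the second piece is empty.\<close>

lemma chamber_in_chambers:
  assumes "D \<in> Cham m J"
  shows "ch D \<in> chambers m J"
  unfolding chambers_def complement_eq in_components_maximal
proof (intro conjI allI impI)
  show "ch D \<noteq> {}" "connected (ch D)"
    using assms ex_chamber_point ChamD(1) convex_chamber convex_connected
    by (metis empty_iff surj_pair)+
  show "ch D \<subseteq> \<Union> (ch ` Cham m J)"
    using assms by blast
  fix T assume T: "T \<noteq> {} \<and> ch D \<subseteq> T \<and> T \<subseteq> \<Union> (ch ` Cham m J) \<and> connected T"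
  define U where "U = (\<Union>E\<in>Cham m J - {D}. chamber_nbhd E)"
  have sub: "T \<subseteq> Theta J"
    using T chamber_eq_nbhd by blast
  have open_part: "openin (top_of_set T) (T \<inter> chamber_nbhd D)" "openin (top_of_set T) (T \<inter> U)"
    unfolding U_def by (intro openin_open_Int open_chamber_nbhd open_UN ballI)+
  have "T \<inter> chamber_nbhd D \<inter> U = {}"
  proof -
    have False if "E \<in> Cham m J" "E \<noteq> D" "\<phi> \<in> T" "\<phi> \<in> chamber_nbhd D" "\<phi> \<in> chamber_nbhd E" for E \<phi>
    proof -
      have "\<phi> \<in> ch D" "\<phi> \<in> ch E"
        using that sub assms chamber_eq_nbhd[of D J] chamber_eq_nbhd[of E J] by blast+
      with chamber_disjoint that assms show False
        by (metis surj_pair)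
    qed
    then show ?thesis
      unfolding U_def by blast
  qed
  moreover have "T \<subseteq> chamber_nbhd D \<union> U"
    unfolding U_def using T chamber_eq_nbhd by blast
  ultimately have "T \<inter> U = T - (T \<inter> chamber_nbhd D)"
    by blast
  then have "closedin (top_of_set T) (T \<inter> chamber_nbhd D)"
    using open_part by (auto simp: closedin_def)
  then have "T \<inter> chamber_nbhd D = {} \<or> T \<inter> chamber_nbhd D = T"
    using T open_part connected_clopen by blast
  then show "T = ch D"
    using T sub chamber_eq_nbhd[OF assms] \<open>ch D \<noteq> {}\<close> by blast
qed

lemma chambers_eq: "chambers m J = ch ` Cham m J"
proof (intro equalityI subsetI)
  fix C assume C: "C \<in> chambers m J"
  then obtain \<phi> where "\<phi> \<in> C"
    unfolding chambers_def using in_components_nonempty by blast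
  then obtain D where D: "D \<in> Cham m J" "\<phi> \<in> ch D"
    using C in_components_subset unfolding chambers_def complement_eq by blast
  have "C = ch D"
    using components_nonoverlap C chamber_in_chambers[OF D(1)] \<open>\<phi> \<in> C\<close> D(2)
    unfolding chambers_def by blast
  with D show "C \<in> ch ` Cham m J"
    by blast
qed (use chamber_in_chambers in blast)

end

section \<open>Separating hyperplanes and opposite chambers\<close>

context coxeter begin

section \<open>Separating hyperplanes\<close>

definition separators :: "'v set \<Rightarrow> real^'v \<Rightarrow> real^'v \<Rightarrow> (real^'v) set set" where
  "separators J d d' = {H \<in> arrangement m J. closed_segment d d' \<inter> H \<noteq> {}}"

text \<open>Paths are lists of point sets, hence the arguments are sets and a point of each is
  chosen. For chambers \<open>Sep_iff\<close> shows that the choice is immaterial.\<close>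

definition Sep :: "'v set \<Rightarrow> (real^'v) set \<Rightarrow> (real^'v) set \<Rightarrow> (real^'v) set set" where
  "Sep J D E = separators J (SOME d. d \<in> D) (SOME d. d \<in> E)"

lemma arrangementE:
  assumes "H \<in> arrangement m J"
  obtains r where "r \<in> roots m" "r \<notin> V J" "H = root_hyp r \<inter> Theta J"
  using assms by (auto simp: arrangement_def Theta_subset_root_hyp)

lemma mem_arrangement: "r \<in> roots m \<Longrightarrow> r \<notin> V J \<Longrightarrow> root_hyp r \<inter> Theta J \<in> arrangement m J"
  by (auto simp: arrangement_def Theta_subset_root_hyp)

lemma mem_separators_iff:
  assumes "d \<in> Theta J" "d' \<in> Theta J" "r \<in> roots m" "r \<notin> V J" "d \<bullet> r \<noteq> 0" "d' \<bullet> r \<noteq> 0"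
  shows "root_hyp r \<inter> Theta J \<in> separators J d d' \<longleftrightarrow> (0 < d \<bullet> r) \<noteq> (0 < d' \<bullet> r)"
proof
  assume "root_hyp r \<inter> Theta J \<in> separators J d d'"
  then obtain p where "p \<in> closed_segment d d'" "p \<bullet> r = 0"
    by (auto simp: separators_def root_hyp_def)
  then obtain t where t: "0 \<le> t" "t \<le> 1" "p = (1 - t) *\<^sub>R d + t *\<^sub>R d'"
    by (auto simp: closed_segment_def)
  then have eq: "(1 - t) * (d \<bullet> r) + t * (d' \<bullet> r) = 0"
    using \<open>p \<bullet> r = 0\<close> by (simp add: inner_add_left)
  show "(0 < d \<bullet> r) \<noteq> (0 < d' \<bullet> r)"
  proof
    assume same: "(0 < d \<bullet> r) = (0 < d' \<bullet> r)"
    show False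
    proof (cases "0 < d \<bullet> r")
      case True
      then have "0 < (1 - t) * (d \<bullet> r) + t * (d' \<bullet> r)"
        using same t by (cases "t = 0") (auto intro!: add_nonneg_pos mult_pos_pos)
      with eq show False by simp
    next
      case False
      then have "d \<bullet> r < 0" "d' \<bullet> r < 0"
        using same assms by auto
      then have "(1 - t) * (d \<bullet> r) + t * (d' \<bullet> r) < 0"
        using t by (cases "t = 0") (auto intro!: add_nonpos_neg mult_pos_neg mult_nonneg_nonpos)
      with eq show False by simp
    qed
  qed
next
  assume opp: "(0 < d \<bullet> r) \<noteq> (0 < d' \<bullet> r)"
  \<comment> \<open>The parameter at which the line through the two points meets the
    hyperplane.\<close>
  define t where "t = d \<bullet> r / (d \<bullet> r - d' \<bullet> r)"
  have ne: "d \<bullet> r - d' \<bullet> r \<noteq> 0"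
    using opp by auto
  have t: "0 \<le> t" "t \<le> 1"
    using opp assms(5,6) by (auto simp: t_def field_simps not_less)
  define p where "p = (1 - t) *\<^sub>R d + t *\<^sub>R d'"
  have "p \<bullet> r = d \<bullet> r - t * (d \<bullet> r - d' \<bullet> r)"
    by (simp add: p_def inner_add_left algebra_simps)
  then have "p \<bullet> r = 0"
    using ne by (simp add: t_def)
  moreover have "p \<in> closed_segment d d'"
    using t by (auto simp: p_def closed_segment_def)
  moreover have "p \<in> Theta J"
    unfolding p_def using assms(1,2) subspace_Theta by (intro subspace_add subspace_scale)
  ultimately show "root_hyp r \<inter> Theta J \<in> separators J d d'"
    using mem_arrangement[OF assms(3,4)] by (auto simp: separators_def root_hyp_def)
qed

lemma some_in_chamber: "D \<in> Cham m J \<Longrightarrow> (SOME d. d \<in> ch D) \<in> ch D"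
  using ex_chamber_point ChamD(1) by (metis someI_ex surj_pair)

lemma Sep_iff:
  assumes "(x, I) \<in> Cham m J" "(y, K) \<in> Cham m J" "r \<in> roots m" "r \<notin> V J"
  shows "root_hyp r \<inter> Theta J \<in> Sep J (ch (x, I)) (ch (y, K)) \<longleftrightarrow>
    (0 \<le> act m (ginv x) r) \<noteq> (0 \<le> act m (ginv y) r)"
proof -
  define d where "d = (SOME d. d \<in> ch (x, I))"
  define d' where "d' = (SOME d. d \<in> ch (y, K))"
  have d: "d \<in> ch (x, I)" and d': "d' \<in> ch (y, K)"
    unfolding d_def d'_def using some_in_chamber assms by blast+
  have "root_hyp r \<inter> Theta J \<in> separators J d d' \<longleftrightarrow> (0 < d \<bullet> r) \<noteq> (0 < d' \<bullet> r)"
    using d d' chamber_eq_nbhd assms Cham_neq_zero[OF assms(1) d] Cham_neq_zero[OF assms(2) d']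
    by (intro mem_separators_iff) blast+
  moreover have "0 < d \<bullet> r \<longleftrightarrow> 0 \<le> act m (ginv x) r" "0 < d' \<bullet> r \<longleftrightarrow> 0 \<le> act m (ginv y) r"
    using Cham_sign[OF assms(1) d assms(3,4)] Cham_sign[OF assms(2) d' assms(3,4)] by force+
  ultimately show ?thesis
    by (simp add: Sep_def d_def d'_def)
qed

lemma Sep_subset: "Sep J D E \<subseteq> arrangement m J"
  by (auto simp: Sep_def separators_def)

lemma SepE:
  assumes "H \<in> Sep J D E"
  obtains r where "r \<in> roots m" "r \<notin> V J" "H = root_hyp r \<inter> Theta J"
  using subsetD[OF Sep_subset assms] by (rule arrangementE)

lemma Sep_triangle:
  assumes "D \<in> Cham m J" "E \<in> Cham m J" "F \<in> Cham m J"
  shows "Sep J (ch D) (ch F) \<subseteq> Sep J (ch D) (ch E) \<union> Sep J (ch E) (ch F)"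
proof
  fix H assume H: "H \<in> Sep J (ch D) (ch F)"
  then obtain r where r: "r \<in> roots m" "r \<notin> V J" "H = root_hyp r \<inter> Theta J"
    by (rule SepE)
  with H assms show "H \<in> Sep J (ch D) (ch E) \<union> Sep J (ch E) (ch F)"
    by (cases D; cases E; cases F) (auto simp: Sep_iff)
qed

lemma Sep_self: "D \<in> Cham m J \<Longrightarrow> Sep J (ch D) (ch D) = {}"
proof (rule ccontr)
  assume D: "D \<in> Cham m J" and "Sep J (ch D) (ch D) \<noteq> {}"
  then obtain H where H: "H \<in> Sep J (ch D) (ch D)"
    by blast
  then obtain r where "r \<in> roots m" "r \<notin> V J" "H = root_hyp r \<inter> Theta J"
    by (rule SepE)
  with H D show False
    by (cases D) (simp add: Sep_iff)
qed

text \<open>A separating root is pulled back to the chamber on its positive side, where it becomes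
  an inversion of the element relating the two chambers.\<close>

lemma finite_Sep:
  assumes "D \<in> Cham m J" "E \<in> Cham m J"
  shows "finite (Sep J (ch D) (ch E))"
proof -
  obtain x I y K where D: "D = (x, I)" and E: "E = (y, K)"
    by fastforce
  have x: "x \<in> W" and y: "y \<in> W"
    using assms ChamD D E by auto
  define N where "N g = {r \<in> roots m. 0 \<le> r \<and> act m g r \<le> 0}" for g
  define hyp where "hyp r = root_hyp r \<inter> Theta J" for r :: "real^'v"
  have "Sep J (ch D) (ch E) \<subseteq> hyp ` act m x ` N (ginv y \<odot> x) \<union> hyp ` act m y ` N (ginv x \<odot> y)"
  proof
    fix H assume H: "H \<in> Sep J (ch D) (ch E)"
    then obtain r where r: "r \<in> roots m" "r \<notin> V J" "H = hyp r"
      unfolding hyp_def by (rule SepE)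
    then have "(0 \<le> act m (ginv x) r) \<noteq> (0 \<le> act m (ginv y) r)"
      using H assms D E by (simp add: Sep_iff hyp_def)
    then consider "0 \<le> act m (ginv x) r" "act m (ginv y) r \<le> 0" | "0 \<le> act m (ginv y) r" "act m (ginv x) r \<le> 0"
      using root_sign x y r(1) by (metis act_roots inv_closed)
    then show "H \<in> hyp ` act m x ` N (ginv y \<odot> x) \<union> hyp ` act m y ` N (ginv x \<odot> y)"
    proof cases
      case 1
      then have "act m (ginv x) r \<in> N (ginv y \<odot> x)"
        using x y r(1) by (auto simp: N_def)
      moreover have "r = act m x (act m (ginv x) r)"
        using x by simp
      ultimately show ?thesis
        using r(3) by blast
    next
      case 2
      then have "act m (ginv y) r \<in> N (ginv x \<odot> y)"
        using x y r(1) by (auto simp: N_def)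
      moreover have "r = act m y (act m (ginv y) r)"
        using y by simp
      ultimately show ?thesis
        using r(3) by blast
    qed
  qed
  moreover have "finite (N (ginv y \<odot> x))" "finite (N (ginv x \<odot> y))"
    unfolding N_def using x y finite_inversions m_closed inv_closed by blast+
  ultimately show ?thesis
    by (auto intro: finite_subset)
qed

lemma Sep_nonempty:
  assumes "(x, I) \<in> Cham m J" "(y, K) \<in> Cham m J" "ch (x, I) \<noteq> ch (y, K)"
  obtains a where "a \<notin> I" "\<not> 0 \<le> act m (ginv y) (act m x (\<alpha> a))"
  using Cham_eqI[OF assms(1,2)] assms(3) by blast

lemma mem_Sep_simple:
  assumes "(x, I) \<in> Cham m J" "(y, K) \<in> Cham m J" "a \<notin> I"
  shows "root_hyp (act m x (\<alpha> a)) \<inter> Theta J \<in> Sep J (ch (x, I)) (ch (y, K)) \<longleftrightarrow>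
    \<not> 0 \<le> act m (ginv y) (act m x (\<alpha> a))"
  using assms ChamD(1)[OF assms(1)] Cham_V[OF assms(1)] by (subst Sep_iff[OF assms(1,2)]) auto

section \<open>Closures, walls and adjacency\<close>

lemma aff_dim_arrangement:
  assumes "H \<in> arrangement m J"
  shows "aff_dim H = aff_dim (Theta J) - 1" "affine H"
proof -
  obtain r where r: "r \<notin> V J" "H = root_hyp r \<inter> Theta J"
    using assms by (rule arrangementE)
  then have H: "H = Theta J \<inter> {\<phi>. r \<bullet> \<phi> = 0}"
    by (auto simp: root_hyp_def inner_commute)
  have "\<not> Theta J \<subseteq> {\<phi>. r \<bullet> \<phi> = 0}"
    using r Theta_subset_root_hyp[of J r] by (simp add: root_hyp_def inner_commute)
  moreover have "0 \<in> Theta J"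
    using subspace_0[OF subspace_Theta] .
  ultimately show "aff_dim H = aff_dim (Theta J) - 1"
    unfolding H using aff_dim_affine_Int_hyperplane[OF subspace_imp_affine[OF subspace_Theta], of J r 0]
    by auto
  show "affine H"
    unfolding H by (intro affine_Int affine_hyperplane subspace_imp_affine subspace_Theta)
qed

lemma closure_chamber_halfspace:
  assumes "(x, I) \<in> Cham m J" "r \<in> roots m" "r \<notin> V J" "\<phi> \<in> closure (ch (x, I))"
  shows "0 \<le> act m (ginv x) r \<Longrightarrow> 0 \<le> \<phi> \<bullet> r" "\<not> 0 \<le> act m (ginv x) r \<Longrightarrow> \<phi> \<bullet> r \<le> 0"
proof -
  show "0 \<le> \<phi> \<bullet> r" if "0 \<le> act m (ginv x) r"
  proof -
    have "closure (ch (x, I)) \<subseteq> {\<phi>. r \<bullet> \<phi> \<ge> 0}"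
      using Cham_sign(1)[OF assms(1) _ assms(2,3) that]
      by (intro closure_minimal closed_halfspace_ge) (auto simp: inner_commute intro: less_imp_le)
    then show ?thesis
      using assms(4) by (auto simp: inner_commute)
  qed
  show "\<phi> \<bullet> r \<le> 0" if "\<not> 0 \<le> act m (ginv x) r"
  proof -
    have "closure (ch (x, I)) \<subseteq> {\<phi>. r \<bullet> \<phi> \<le> 0}"
      using Cham_sign(2)[OF assms(1) _ assms(2,3) that]
      by (intro closure_minimal closed_halfspace_le) (auto simp: inner_commute intro: less_imp_le)
    then show ?thesis
      using assms(4) by (auto simp: inner_commute)
  qed
qed

text \<open>On points common to both closures the root of a separating hyperplane is both
  nonnegative and nonpositive, so the hyperplane contains the common wall. By its dimension the wall
  affinely spans every hyperplane of the arrangement that contains it, so there is only one.\<close>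

lemma adjacent_Sep:
  assumes "D \<in> Cham m J" "E \<in> Cham m J" "adjacent m J (ch D) (ch E)"
  obtains H where "Sep J (ch D) (ch E) \<subseteq> {H}"
proof -
  obtain x I y K where D: "D = (x, I)" and E: "E = (y, K)"
    by fastforce
  obtain H H' where H: "H \<in> arrangement m J" and eq: "closure (ch D) \<inter> H = closure (ch E) \<inter> H'"
    and dim: "aff_dim (closure (ch D) \<inter> H) = aff_dim (Theta J) - 1"
    using assms(3) by (auto simp: adjacent_def walls_def)
  define P where "P = closure (ch D) \<inter> H"
  have "0 \<in> H"
    using H subspace_0[OF subspace_Theta] by (auto simp: arrangement_def root_hyp_def)
  then have "0 \<in> P"
    using assms(1) by (simp add: P_def D closure_chamber ChamD(1))
  have hull: "affine hull P = H'" if H': "H' \<in> arrangement m J" "P \<subseteq> H'" for H'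
  proof (rule affine_dim_equal)
    show "affine hull P \<subseteq> H'"
      using that aff_dim_arrangement(2) by (simp add: hull_minimal)
    show "aff_dim (affine hull P) = aff_dim H'"
      using dim aff_dim_arrangement(1)[OF H'(1)] by (simp add: P_def)
  qed (use aff_dim_arrangement H' \<open>0 \<in> P\<close> hull_inc in force)+
  have "H'' = H" if H'': "H'' \<in> Sep J (ch D) (ch E)" for H''
  proof -
    obtain r where r: "r \<in> roots m" "r \<notin> V J" "H'' = root_hyp r \<inter> Theta J"
      using H'' by (rule SepE)
    then have opp: "(0 \<le> act m (ginv x) r) \<noteq> (0 \<le> act m (ginv y) r)"
      using H'' assms D E by (simp add: Sep_iff)
    have "P \<subseteq> H''"
    proof
      fix \<phi> assume \<phi>: "\<phi> \<in> P"
      then have cl: "\<phi> \<in> closure (ch (x, I))" "\<phi> \<in> closure (ch (y, K))"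
        using eq by (auto simp: P_def D E)
      have "\<phi> \<bullet> r = 0"
        using closure_chamber_halfspace[OF _ r(1,2) cl(1)] closure_chamber_halfspace[OF _ r(1,2) cl(2)]
          assms opp D E by (metis order_antisym)
      moreover have "\<phi> \<in> Theta J"
        using \<phi> H by (auto simp: P_def arrangement_def)
      ultimately show "\<phi> \<in> H''"
        by (simp add: r(3) root_hyp_def)
    qed
    then have "affine hull P = H''"
      using hull H'' Sep_subset by blast
    moreover have "affine hull P = H"
      using hull H by (simp add: P_def)
    ultimately show ?thesis
      by simp
  qed
  then show ?thesis
    using that by blast
qed

text \<open>\<open>u\<close> moves vectors only along the span of \<open>insert a I\<close>, and
  functionals in the wall hyperplane vanish on the image of that span under \<open>x\<close>. Both
  closures therefore cut this hyperplane in the same set \<open>T\<close>.\<close>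

lemma adjacentI:
  assumes xI: "(x, I) \<in> Cham m J" and a: "a \<notin> I" and u: "u \<in> parabolic m (insert a I)"
    and yK: "(x \<odot> ginv u, K) \<in> Cham m J" and K: "K \<subseteq> insert a I"
    and ne: "ch (x, I) \<noteq> ch (x \<odot> ginv u, K)"
  shows "adjacent m J (ch (x, I)) (ch (x \<odot> ginv u, K))"
proof -
  define L where "L = insert a I"
  define y where "y = x \<odot> ginv u"
  define H where "H = root_hyp (act m x (\<alpha> a)) \<inter> Theta J"
  define T where "T = {\<phi>. (\<forall>l\<in>L. \<phi> \<bullet> act m x (\<alpha> l) = 0) \<and> (\<forall>l\<in>-L. 0 \<le> \<phi> \<bullet> act m x (\<alpha> l))}"
  have x: "x \<in> W" and y: "y \<in> W"
    using ChamD(1) xI yK by (auto simp: y_def)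
  have H_arr: "H \<in> arrangement m J"
    unfolding H_def using x a Cham_V[OF xI] by (intro mem_arrangement) auto
  have H: "\<phi> \<in> H \<longleftrightarrow> (\<forall>l\<in>L. \<phi> \<bullet> act m x (\<alpha> l) = 0)" for \<phi>
    using Cham_Theta[OF xI] by (auto simp: H_def root_hyp_def L_def)
  have u': "ginv u \<in> parabolic m L"
    using u by (simp add: L_def)
  have y_eq: "\<phi> \<bullet> act m y v = \<phi> \<bullet> act m x v" if "\<phi> \<in> H" for \<phi> v
  proof -
    have "act m y v = act m x (act m (ginv u) v - v) + act m x v"
      using x u by (simp add: y_def linear_diff[OF linear_act])
    then show ?thesis
      using chamber_V[OF x _ parabolic_act_diff[OF u', of v], of \<phi>] that
      by (simp add: H inner_add_right)
  qed
  have 1: "closure (ch (x, I)) \<inter> H = T"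
    by (auto simp: closure_chamber[OF x] H T_def L_def)
  have 2: "closure (ch (y, K)) \<inter> H = T"
  proof (intro equalityI subsetI)
    fix \<phi> assume "\<phi> \<in> closure (ch (y, K)) \<inter> H"
    then show "\<phi> \<in> T"
      using y_eq[of \<phi>] K by (auto simp: closure_chamber[OF y] H T_def L_def)
  next
    fix \<phi> assume \<phi>: "\<phi> \<in> T"
    then have \<phi>H: "\<phi> \<in> H"
      by (simp add: H T_def)
    have "0 \<le> \<phi> \<bullet> act m x (\<alpha> l)" for l
      using \<phi> by (cases "l \<in> L") (auto simp: T_def)
    then show "\<phi> \<in> closure (ch (y, K)) \<inter> H"
      using y_eq[OF \<phi>H] \<phi> \<phi>H K by (auto simp: closure_chamber[OF y] T_def L_def)
  qed
  \<comment> \<open>\<open>T\<close> contains a nonempty relatively open subset of \<open>H\<close>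
    and so has the dimension of \<open>H\<close>.\<close>
  have dim: "aff_dim T = aff_dim (Theta J) - 1"
  proof -
    define U where "U = chamber_nbhd (x, L)"
    obtain \<theta> where "\<theta> \<in> ch (x, L)"
      using ex_chamber_point[OF x] by blast
    then have "\<theta> \<in> H \<inter> U"
      using mem_chamber[OF x] by (auto simp: H U_def chamber_nbhd_def)
    then have "affine hull (H \<inter> U) = affine hull H"
      using aff_dim_arrangement(2)[OF H_arr] open_chamber_nbhd
      by (intro affine_hull_affine_Int_open) (auto simp: U_def)
    then have "aff_dim (H \<inter> U) = aff_dim H"
      by (rule aff_dim_affine_hull2)
    moreover have "H \<inter> U \<subseteq> T" "T \<subseteq> H"
      by (auto simp: T_def H U_def chamber_nbhd_def intro: less_imp_le)
    ultimately have "aff_dim T = aff_dim H"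
      using aff_dim_subset by (metis order_antisym)
    then show ?thesis
      using aff_dim_arrangement(1)[OF H_arr] by simp
  qed
  have "T \<in> walls m J (ch (x, I))" "T \<in> walls m J (ch (y, K))"
    unfolding walls_def mem_Collect_eq
    using H_arr 1 2 dim by (intro exI[of _ H]; simp)+
  then show ?thesis
    using xI yK ne chamber_in_chambers unfolding adjacent_def y_def by blast
qed

text \<open>The element \<open>u\<close> of a codimension two relation, with an arbitrary
  \<open>L\<close> in place of \<open>I + a + b\<close>; for \<open>L = I + a\<close> it describes a
  simple wall crossing. Positivity on the simple roots of \<open>I\<close> passes to all positive
  roots in \<open>V I\<close>.\<close>

definition flips :: "'v list set \<Rightarrow> 'v set \<Rightarrow> 'v set \<Rightarrow> bool" where
  "flips u I L \<longleftrightarrow> I \<subseteq> L \<and> u \<in> parabolic m L \<and> (\<forall>i\<in>I. 0 \<le> act m u (\<alpha> i)) \<and>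
     (\<forall>r\<in>roots m. r \<in> V L \<longrightarrow> r \<notin> V I \<longrightarrow> 0 \<le> r \<longrightarrow> act m u r \<le> 0)"

lemma flips_inv:
  assumes "flips u I L" "l \<in> L"
  shows "act m (ginv u) (\<alpha> l) \<in> V I \<Longrightarrow> 0 \<le> act m (ginv u) (\<alpha> l)"
    and "act m (ginv u) (\<alpha> l) \<notin> V I \<Longrightarrow> act m (ginv u) (\<alpha> l) \<le> 0"
proof -
  have u: "u \<in> W" "u \<in> parabolic m L" and pos: "\<And>i. i \<in> I \<Longrightarrow> 0 \<le> act m u (\<alpha> i)"
    using assms by (auto simp: flips_def)
  define \<gamma> where "\<gamma> = act m (ginv u) (\<alpha> l)"
  have \<gamma>: "\<gamma> \<in> roots m" "\<gamma> \<in> V L" "act m u \<gamma> = \<alpha> l"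
    using u assms(2) parabolic_act_V[of "ginv u" L L "\<alpha> l"] by (auto simp: \<gamma>_def)
  have not_neg: "\<not> \<alpha> l \<le> 0"
    using root_not_both[of "\<alpha> l"] by auto
  show "0 \<le> \<gamma>" if V: "\<gamma> \<in> V I"
  proof (rule ccontr)
    assume "\<not> 0 \<le> \<gamma>"
    then have "0 \<le> - \<gamma>"
      using root_sign[OF \<gamma>(1)] by auto
    from act_nonneg_V[OF u(1) V_minus[OF V] this pos] show False
      using \<gamma> u not_neg by (simp add: act_minus)
  qed
  show "\<gamma> \<le> 0" if "\<gamma> \<notin> V I"
    using assms(1) \<gamma> that not_neg root_sign[OF \<gamma>(1)] unfolding flips_def by metis
qed

text \<open>Supplies the uniqueness behind \<open>THE\<close> in \<open>codim2_elt\<close>. The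
  inverse of \<open>u'\<close> makes a simple root of \<open>L\<close> negative exactly when it
  moves it out of \<open>V I\<close>, and then \<open>u\<close> makes it positive again.\<close>

lemma flips_unique:
  assumes "flips u I L" "flips u' I L"
  shows "u = u'"
proof (rule parabolic_eqI)
  show u: "u \<in> parabolic m L" "u' \<in> parabolic m L"
    using assms by (auto simp: flips_def)
  fix l assume l: "l \<in> L"
  define \<gamma> where "\<gamma> = act m (ginv u') (\<alpha> l)"
  have \<gamma>: "\<gamma> \<in> roots m" "\<gamma> \<in> V L"
    using u l parabolic_act_V[of "ginv u'" L L "\<alpha> l"] by (auto simp: \<gamma>_def)
  show "0 \<le> act m u \<gamma>"
  proof (cases "\<gamma> \<in> V I")
    case True
    then show ?thesis
      using flips_inv(1)[OF assms(2) l] assms(1) u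
      by (intro act_nonneg_V[of u \<gamma> I]) (auto simp: \<gamma>_def flips_def)
  next
    case False
    then have "0 \<le> - \<gamma>"
      using flips_inv(2)[OF assms(2) l] by (simp add: \<gamma>_def)
    moreover have "- \<gamma> \<in> roots m" "- \<gamma> \<in> V L" "- \<gamma> \<notin> V I"
      using \<gamma> False minus_roots V_minus[of \<gamma> L] V_minus[of "- \<gamma>" I] by auto
    ultimately have "act m u (- \<gamma>) \<le> 0"
      using assms(1) unfolding flips_def by blast
    then show ?thesis
      using u by (simp add: act_minus)
  qed
qed

lemma codim2_elt_eq:
  assumes "flips u I (I \<union> {a, b})"
  shows "codim2_elt m a b I = ginv u"
proof -
  let ?L = "I \<union> {a, b}"
  have V_sub: "V I \<subseteq> V ?L"
    by (rule V_mono) auto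
  have iff: "(v \<in> parabolic m ?L \<and>
      act m v ` (pos_roots_of m ?L - pos_roots_of m I) \<subseteq> neg_roots_of m ?L \<and>
      act m v ` pos_roots_of m I \<subseteq> pos_roots_of m ?L) \<longleftrightarrow> flips v I ?L" (is "?P v \<longleftrightarrow> _") for v
  proof
    assume P: "?P v"
    have "0 \<le> act m v (\<alpha> i)" if "i \<in> I" for i
    proof -
      have "\<alpha> i \<in> pos_roots_of m I"
        using that by (simp add: pos_roots_of_eq)
      then have "act m v (\<alpha> i) \<in> pos_roots_of m ?L"
        using P by blast
      then show ?thesis
        by (simp add: pos_roots_of_eq)
    qed
    moreover have "act m v r \<le> 0" if "r \<in> roots m" "r \<in> V ?L" "r \<notin> V I" "0 \<le> r" for r
    proof -
      have "r \<in> pos_roots_of m ?L - pos_roots_of m I"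
        using that by (simp add: pos_roots_of_eq)
      then have "act m v r \<in> neg_roots_of m ?L"
        using P by blast
      then show ?thesis
        by (simp add: neg_roots_of_eq)
    qed
    ultimately show "flips v I ?L"
      using P by (auto simp: flips_def)
  next
    assume v: "flips v I ?L"
    then have vp: "v \<in> parabolic m ?L" "v \<in> W"
      by (auto simp: flips_def)
    have "act m v r \<in> neg_roots_of m ?L" if "r \<in> pos_roots_of m ?L - pos_roots_of m I" for r
      using that v vp parabolic_act_V[OF vp(1), of ?L r] by (auto simp: flips_def pos_roots_of_eq neg_roots_of_eq)
    moreover have "act m v r \<in> pos_roots_of m ?L" if "r \<in> pos_roots_of m I" for r
      using that v vp V_sub parabolic_act_V[OF vp(1), of ?L r] act_nonneg_V[OF vp(2), of r I]
      by (auto simp: flips_def pos_roots_of_eq)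
    ultimately show "?P v"
      using vp by blast
  qed
  show ?thesis
    unfolding codim2_elt_def iff using assms flips_unique by (metis (mono_tags, lifting) the_equality)
qed

text \<open>When \<alpha> i is expanded through the preimages of the simple roots of
  \<open>L\<close>, a coordinate outside \<open>I\<close> is a vanishing sum of nonpositive terms.
  So every contributing preimage lies in \<open>V I\<close>, is positive there, and
  indecomposability applies.\<close>

lemma flips_image:
  assumes "flips u I L"
  obtains K where "K \<subseteq> L" "act m u ` \<alpha> ` I = \<alpha> ` K"
proof -
  have u: "u \<in> W" "u \<in> parabolic m L" "I \<subseteq> L" and pos: "\<And>i. i \<in> I \<Longrightarrow> 0 \<le> act m u (\<alpha> i)"
    using assms by (auto simp: flips_def)
  have "act m u (\<alpha> i) \<in> \<alpha> ` L" if i: "i \<in> I" for i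
  proof -
    define c where "c = act m u (\<alpha> i)"
    have cL: "c \<in> V L"
      using u i parabolic_act_V[of u L L "\<alpha> i"] by (auto simp: c_def)
    define \<gamma> where "\<gamma> l = act m (ginv u) (\<alpha> l)" for l
    have \<gamma>: "(\<gamma> l \<in> V I \<and> 0 \<le> \<gamma> l) \<or> \<gamma> l \<le> 0" if "l \<in> L" for l
      using flips_inv[OF assms that] unfolding \<gamma>_def by blast
    have sum: "\<alpha> i $ k = (\<Sum>l\<in>L. c $ l * \<gamma> l $ k)" for k
    proof -
      have "\<alpha> i = act m (ginv u) c"
        using u by (simp add: c_def)
      also have "\<dots> = (\<Sum>l\<in>L. c $ l *\<^sub>R \<gamma> l)"
        using act_V_expansion[OF _ cL, of "ginv u"] u by (simp add: \<gamma>_def)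
      finally show ?thesis
        by (simp add: vec_eq_iff)
    qed
    have "0 \<le> \<gamma> l" if l: "c $ l \<noteq> 0" for l
    proof -
      have lL: "l \<in> L"
        using l cL by (auto simp: V_def)
      have "\<gamma> l $ k = 0" if k: "k \<notin> I" for k
      proof -
        have "(\<Sum>l\<in>L. - (c $ l * \<gamma> l $ k)) = 0"
          using sum[of k] k i by (simp add: simple_root_nth sum_negf split: if_splits)
        moreover have "0 \<le> - (c $ l * \<gamma> l $ k)" if "l \<in> L" for l
        proof -
          have "\<gamma> l $ k \<le> 0"
            using \<gamma>[OF that] k by (auto simp: V_def less_eq_vec_def)
          moreover have "0 \<le> c $ l"
            using pos[OF i] by (simp add: c_def less_eq_vec_def)
          ultimately show ?thesis
            by (simp add: mult_nonneg_nonpos)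
        qed
        ultimately have "- (c $ l * \<gamma> l $ k) = 0"
          using lL by (simp add: sum_nonneg_eq_0_iff)
        with l show ?thesis
          by simp
      qed
      then have "\<gamma> l \<in> V I"
        by (simp add: V_def)
      then show ?thesis
        using flips_inv(1)[OF assms lL] by (simp add: \<gamma>_def)
    qed
    then have "\<exists>l. act m u (\<alpha> i) = 1 *\<^sub>R \<alpha> l"
      using u pos[OF i] by (intro simple_root_image) (auto simp: c_def \<gamma>_def)
    then show ?thesis
      using cL by (auto simp: c_def)
  qed
  then have "act m u ` \<alpha> ` I \<subseteq> \<alpha> ` L"
    by blast
  then show ?thesis
    unfolding subset_image_iff using that by blast
qed

lemma Cham_mult_inv:
  assumes "(x, I) \<in> Cham m J" "u \<in> W" "act m u ` \<alpha> ` I = \<alpha> ` K"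
  shows "(x \<odot> ginv u, K) \<in> Cham m J"
proof -
  have "act m (x \<odot> ginv u) ` act m u ` \<alpha> ` I = act m x ` \<alpha> ` I"
    using ChamD(1)[OF assms(1)] assms(2) by (simp add: image_image)
  then show ?thesis
    using assms by (simp add: Cham_iff)
qed

text \<open>A coordinate outside \<open>L\<close> is unchanged, and one nonzero coordinate fixes the
  sign of a root.\<close>

lemma parabolic_sign:
  assumes "u \<in> parabolic m L" "\<beta> \<in> roots m" "\<beta> \<notin> V L"
  shows "0 \<le> act m u \<beta> \<longleftrightarrow> 0 \<le> \<beta>"
proof -
  obtain k where k: "k \<notin> L" "\<beta> $ k \<noteq> 0"
    using assms(3) by (auto simp: V_def)
  have eq: "act m u \<beta> $ k = \<beta> $ k"
    using parabolic_act_nth[OF assms(1) k(1)] .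
  have root: "act m u \<beta> \<in> roots m"
    using assms by auto
  show ?thesis
    using k(2) eq root_sign_coordinate[OF root, of k] root_sign_coordinate[OF assms(2), of k]
      root_neg_iff[OF root] root_neg_iff[OF assms(2)] by (metis linorder_neqE)
qed

text \<open>
  The element \<open>u\<close> is the \<open>W\<^bsub>I \<union> A\<^esub>\<close>-component of \<open>y\<inverse> x\<close>, and \<open>(x u\<inverse>, K')\<close> is the chamber opposite
  to \<open>(x, I)\<close> at its face \<open>x C\<^bsub>I \<union> A\<^esub>\<close>: it lies between \<open>(x, I)\<close> and \<open>(y, K)\<close>.
\<close>

lemma opposite_chamber:
  assumes xI: "(x, I) \<in> Cham m J" and yK: "(y, K) \<in> Cham m J" and A: "A \<inter> I = {}"
    and neg: "\<And>a. a \<in> A \<Longrightarrow> \<not> 0 \<le> act m (ginv y) (act m x (\<alpha> a))"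
  obtains u K' where "flips u I (I \<union> A)" "K' \<subseteq> I \<union> A" "act m u ` \<alpha> ` I = \<alpha> ` K'"
    "(x \<odot> ginv u, K') \<in> Cham m J"
    "Sep J (ch (x, I)) (ch (y, K)) =
       Sep J (ch (x, I)) (ch (x \<odot> ginv u, K')) \<union> Sep J (ch (x \<odot> ginv u, K')) (ch (y, K))"
    "Sep J (ch (x, I)) (ch (x \<odot> ginv u, K')) \<inter> Sep J (ch (x \<odot> ginv u, K')) (ch (y, K)) = {}"
    "\<And>r. r \<in> roots m \<Longrightarrow> r \<notin> V J \<Longrightarrow>
       root_hyp r \<inter> Theta J \<in> Sep J (ch (x, I)) (ch (x \<odot> ginv u, K')) \<longleftrightarrow> act m (ginv x) r \<in> V (I \<union> A)"
proof -
  define L where "L = I \<union> A"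
  have x: "x \<in> W" and y: "y \<in> W"
    using ChamD xI yK by auto
  obtain g u where g: "g \<in> W" "u \<in> parabolic m L" "ginv y \<odot> x = g \<odot> u"
    and gpos: "\<And>l. l \<in> L \<Longrightarrow> 0 \<le> act m g (\<alpha> l)"
    using coset_factor[of "ginv y \<odot> x" L] x y by blast
  have u: "u \<in> W"
    using g by blast
  have gu: "act m g (act m u v) = act m (ginv y) (act m x v)" for v
    using g(3) act_mult x y g(1) u by (metis inv_closed)
  \<comment> \<open>On roots in \<open>V L\<close> the factor \<open>g\<close> preserves signs, so
    there \<open>u\<close> alone gives the signs of the whole element relating the chambers.\<close>
  have gsign: "0 \<le> act m g \<beta> \<longleftrightarrow> 0 \<le> \<beta>" if \<beta>: "\<beta> \<in> roots m" "\<beta> \<in> V L" for \<beta>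
  proof
    show "0 \<le> act m g \<beta>" if "0 \<le> \<beta>"
      using act_nonneg_V[OF g(1) \<beta>(2) that gpos] .
    show "0 \<le> \<beta>" if pos: "0 \<le> act m g \<beta>"
    proof (rule ccontr)
      assume "\<not> 0 \<le> \<beta>"
      then have "0 \<le> - \<beta>"
        using root_sign[OF \<beta>(1)] by auto
      from act_nonneg_V[OF g(1) V_minus[OF \<beta>(2)] this gpos] have "act m g \<beta> \<le> 0"
        using g(1) by (simp add: act_minus)
      then show False
        using root_not_both[OF act_roots[OF g(1) \<beta>(1)] pos] by simp
    qed
  qed
  have usign: "0 \<le> act m u \<beta> \<longleftrightarrow> 0 \<le> act m (ginv y) (act m x \<beta>)" if \<beta>: "\<beta> \<in> roots m" "\<beta> \<in> V L" for \<beta>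
    using gsign[of "act m u \<beta>"] gu[of \<beta>] \<beta> u parabolic_act_V[OF g(2), of L \<beta>] by simp
  obtain \<phi> where \<phi>: "\<phi> \<in> ch (y, K)"
    using ex_chamber_point y by blast
  have neg_inner: "\<phi> \<bullet> act m x (\<alpha> a) < 0" if "a \<in> A" for a
    using Cham_sign(2)[OF yK \<phi> _ _ neg[OF that]] that A x Cham_V[OF xI, of "\<alpha> a"] by auto
  have zero_inner: "\<phi> \<bullet> act m x (\<alpha> i) = 0" if "i \<in> I" for i
    using Cham_Theta[OF xI] chamber_eq_nbhd[OF yK] \<phi> that by blast
  \<comment> \<open>A point of the chamber of \<open>(y, K)\<close> vanishes on the images of the
    simple roots of \<open>I\<close> and is negative on those of \<open>A\<close>, hence negative on
    the image of a positive combination involving \<open>A\<close>.\<close>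
  have flip: "\<not> 0 \<le> act m u \<beta>" if \<beta>: "\<beta> \<in> roots m" "\<beta> \<in> V L" "\<beta> \<notin> V I" "0 \<le> \<beta>" for \<beta>
  proof -
    obtain k where k: "k \<notin> I" "\<beta> $ k \<noteq> 0"
      using \<beta>(3) by (auto simp: V_def)
    have kA: "k \<in> A"
      using k \<beta>(2) by (auto simp: V_def L_def)
    have "0 < (\<Sum>i\<in>L. - (\<beta> $ i * (\<phi> \<bullet> act m x (\<alpha> i))))"
    proof (rule sum_pos2[of _ k])
      show "0 < - (\<beta> $ k * (\<phi> \<bullet> act m x (\<alpha> k)))"
        using k \<beta>(4) mult_pos_neg[of "\<beta> $ k", OF _ neg_inner[OF kA]]
        by (auto simp: less_eq_vec_def order_less_le[of 0])
      show "0 \<le> - (\<beta> $ i * (\<phi> \<bullet> act m x (\<alpha> i)))" if "i \<in> L" for i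
      proof -
        have "\<phi> \<bullet> act m x (\<alpha> i) \<le> 0"
          using that zero_inner[of i] neg_inner[of i] by (cases "i \<in> I") (auto simp: L_def)
        then show ?thesis
          using \<beta>(4) by (simp add: less_eq_vec_def mult_nonneg_nonpos)
      qed
    qed (use kA in \<open>auto simp: L_def\<close>)
    then have "\<phi> \<bullet> act m x \<beta> < 0"
      by (simp add: act_V_expansion[OF x \<beta>(2)] inner_sum_right sum_negf)
    then have "\<not> 0 \<le> act m (ginv y) (act m x \<beta>)"
      using Cham_sign(1)[OF yK \<phi>, of "act m x \<beta>"] \<beta>(1,3) x Cham_V[OF xI, of \<beta>] by fastforce
    then show ?thesis
      using usign[OF \<beta>(1,2)] by simp
  qed
  have "0 \<le> act m u (\<alpha> i)" if i: "i \<in> I" for i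
  proof -
    obtain j where j: "j \<in> J" "act m x (\<alpha> i) = \<alpha> j"
      using Cham_simple[OF xI i] by blast
    then obtain k where "act m (ginv y) (\<alpha> j) = \<alpha> k"
      using Cham_simple_inv[OF yK] by blast
    then show ?thesis
      using usign[of "\<alpha> i"] i j by (simp add: L_def)
  qed
  moreover have "act m u r \<le> 0" if "r \<in> roots m" "r \<in> V L" "r \<notin> V I" "0 \<le> r" for r
    using flip[OF that] root_neg_iff[of "act m u r"] that(1) u by simp
  ultimately have flips: "flips u I L"
    using g by (auto simp: flips_def L_def)
  obtain K' where K': "K' \<subseteq> L" "act m u ` \<alpha> ` I = \<alpha> ` K'"
    using flips_image[OF flips] .
  define z where "z = x \<odot> ginv u"
  have zK: "(z, K') \<in> Cham m J"
    unfolding z_def by (rule Cham_mult_inv[OF xI u K'(2)])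
  have z_inv: "act m (ginv z) r = act m u (act m (ginv x) r)" for r
    using x u by (simp add: z_def inv_mult_group)
  \<comment> \<open>The hyperplanes through the face are those with \<open>act m (ginv x) r\<close>
    in \<open>V L\<close>. They separate \<open>x\<close> from both \<open>z\<close> and
    \<open>y\<close>; for all other hyperplanes \<open>x\<close> and \<open>z\<close> lie on the
    same side.\<close>
  have cases_L: "(root_hyp r \<inter> Theta J \<in> Sep J (ch (x, I)) (ch (z, K')) \<longleftrightarrow> act m (ginv x) r \<in> V L) \<and>
      (act m (ginv x) r \<in> V L \<longrightarrow> root_hyp r \<inter> Theta J \<notin> Sep J (ch (z, K')) (ch (y, K)) \<and>
        root_hyp r \<inter> Theta J \<in> Sep J (ch (x, I)) (ch (y, K))) \<and>
      (act m (ginv x) r \<notin> V L \<longrightarrow> (root_hyp r \<inter> Theta J \<in> Sep J (ch (z, K')) (ch (y, K)) \<longleftrightarrow>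
        root_hyp r \<inter> Theta J \<in> Sep J (ch (x, I)) (ch (y, K))))"
    if r: "r \<in> roots m" "r \<notin> V J" for r
  proof -
    define \<beta> where "\<beta> = act m (ginv x) r"
    have \<beta>: "\<beta> \<in> roots m" "\<beta> \<notin> V I" "act m x \<beta> = r"
      using r x Cham_V_inv[OF xI] by (auto simp: \<beta>_def)
    have 1: "(0 \<le> act m u \<beta>) \<noteq> (0 \<le> \<beta>)" "0 \<le> act m u \<beta> \<longleftrightarrow> 0 \<le> act m (ginv y) r" if "\<beta> \<in> V L"
    proof -
      show "0 \<le> act m u \<beta> \<longleftrightarrow> 0 \<le> act m (ginv y) r"
        using usign[OF \<beta>(1) that] \<beta>(3) by simp
      show "(0 \<le> act m u \<beta>) \<noteq> (0 \<le> \<beta>)"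
      proof (cases "0 \<le> \<beta>")
        case True
        then show ?thesis
          using flip[OF \<beta>(1) that \<beta>(2)] by simp
      next
        case False
        then have "0 \<le> - \<beta>"
          using root_sign[OF \<beta>(1)] by auto
        moreover have "- \<beta> \<notin> V I"
          using \<beta>(2) V_minus[of "- \<beta>" I] by auto
        ultimately have "\<not> 0 \<le> act m u (- \<beta>)"
          using flip[of "- \<beta>"] \<beta>(1) minus_roots V_minus[OF that] by blast
        then have "0 \<le> act m u \<beta>"
          using u \<beta>(1) root_neg_iff[of "act m u \<beta>"] by (simp add: act_minus)
        with False show ?thesis
          by simp
      qed
    qed
    have 2: "0 \<le> act m u \<beta> \<longleftrightarrow> 0 \<le> \<beta>" if "\<beta> \<notin> V L"
      using parabolic_sign[OF g(2) \<beta>(1) that] .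
    show ?thesis
      using 1 2 Sep_iff[OF xI zK r] Sep_iff[OF zK yK r] Sep_iff[OF xI yK r]
      unfolding z_inv \<beta>_def[symmetric] by blast
  qed
  have memE: "\<exists>r\<in>roots m. r \<notin> V J \<and> H = root_hyp r \<inter> Theta J" if "H \<in> Sep J D E" for H D E
    using that by (rule SepE) blast
  have "Sep J (ch (x, I)) (ch (y, K)) = Sep J (ch (x, I)) (ch (z, K')) \<union> Sep J (ch (z, K')) (ch (y, K))"
  proof (intro equalityI subsetI)
    fix H assume H: "H \<in> Sep J (ch (x, I)) (ch (y, K))"
    with memE cases_L show "H \<in> Sep J (ch (x, I)) (ch (z, K')) \<union> Sep J (ch (z, K')) (ch (y, K))"
      by blast
  next
    fix H assume H: "H \<in> Sep J (ch (x, I)) (ch (z, K')) \<union> Sep J (ch (z, K')) (ch (y, K))"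
    then obtain r where "r \<in> roots m" "r \<notin> V J" "H = root_hyp r \<inter> Theta J"
      using memE by blast
    with H cases_L show "H \<in> Sep J (ch (x, I)) (ch (y, K))"
      by blast
  qed
  moreover have "Sep J (ch (x, I)) (ch (z, K')) \<inter> Sep J (ch (z, K')) (ch (y, K)) = {}"
    using memE cases_L by blast
  ultimately show thesis
    using that[of u K'] flips K' zK cases_L unfolding z_def L_def by blast
qed

end

section \<open>Simple wall crossings and geodesics\<close>

context coxeter begin

section \<open>Longest elements of finite parabolic subgroups\<close>

lemma act_nonpos_V:
  assumes "g \<in> W" "v \<in> V I" "0 \<le> v" "\<And>i. i \<in> I \<Longrightarrow> act m g (\<alpha> i) \<le> 0"
  shows "act m g v \<le> 0"
proof -
  have "0 \<le> act m g (- v) \<longleftrightarrow> 0 \<le> (\<Sum>i\<in>I. v $ i *\<^sub>R - act m g (\<alpha> i))"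
    using assms(1) by (simp add: act_minus act_V_expansion[OF assms(1,2)] sum_negf)
  moreover have "0 \<le> v $ i *\<^sub>R - act m g (\<alpha> i) $ k" if "i \<in> I" for i k
    using assms(3) assms(4)[OF that] by (simp add: less_eq_vec_def mult_nonneg_nonpos)
  ultimately show ?thesis
    using assms(1) by (simp add: act_minus less_eq_vec_def sum_nonneg sum_nonpos)
qed

lemma negating_inv:
  assumes "w \<in> parabolic m M" "\<And>k. k \<in> M \<Longrightarrow> act m w (\<alpha> k) \<le> 0" "k \<in> M"
  shows "act m (ginv w) (\<alpha> k) \<le> 0"
proof (rule ccontr)
  assume neg: "\<not> ?thesis"
  have "act m (ginv w) (\<alpha> k) \<in> roots m"
    using assms by auto
  then have "0 \<le> act m (ginv w) (\<alpha> k)"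
    using root_sign neg by blast
  moreover have "act m (ginv w) (\<alpha> k) \<in> V M"
    using assms parabolic_act_V[of "ginv w" M M "\<alpha> k"] by simp
  ultimately have "act m w (act m (ginv w) (\<alpha> k)) \<le> 0"
    using assms act_nonpos_V[of w "act m (ginv w) (\<alpha> k)" M] by blast
  then show False
    using assms(1) root_not_both[of "\<alpha> k"] by auto
qed

text \<open>Characterizes the longest element by signs. The inverse of \<open>w'\<close> makes the
  simple roots of \<open>M\<close> nonpositive and \<open>w\<close> turns them back, so the quotient
  of the two elements keeps them nonnegative.\<close>

lemma negating_unique:
  assumes "w \<in> parabolic m M" "\<And>k. k \<in> M \<Longrightarrow> act m w (\<alpha> k) \<le> 0"
    and "w' \<in> parabolic m M" "\<And>k. k \<in> M \<Longrightarrow> act m w' (\<alpha> k) \<le> 0"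
  shows "w = w'"
proof (rule parabolic_eqI[OF assms(1,3)])
  fix k assume k: "k \<in> M"
  have "- act m (ginv w') (\<alpha> k) \<in> V M"
    using assms(3) k parabolic_act_V[of "ginv w'" M M "\<alpha> k"] by (simp add: V_minus)
  then have "act m w (- act m (ginv w') (\<alpha> k)) \<le> 0"
    using assms(1,2) negating_inv[OF assms(3,4) k] act_nonpos_V[of w "- act m (ginv w') (\<alpha> k)" M]
    by auto
  then show "0 \<le> act m w (act m (ginv w') (\<alpha> k))"
    using assms(1) by (simp add: act_minus)
qed

text \<open>Every letter of \<open>M\<close> is a descent of an element of maximal length. By
  \<open>negating_unique\<close> there is then just one such element, which justifies
  \<open>THE\<close> in \<open>longest\<close>.\<close>

lemma longest_parabolic:
  assumes "finite (parabolic m M)"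
  shows "longest m M \<in> parabolic m M" "\<And>k. k \<in> M \<Longrightarrow> act m (longest m M) (\<alpha> k) \<le> 0"
proof -
  let ?P = "\<lambda>w. w \<in> parabolic m M \<and> (\<forall>u \<in> parabolic m M. len u \<le> len w)"
  have max_neg: "act m w (\<alpha> k) \<le> 0" if w: "?P w" and k: "k \<in> M" for w k
  proof -
    have "len (w \<odot> gen k) \<le> len w"
      using w k by auto
    then show ?thesis
      using w len_mult_gen_neq[of w k] act_nonneg_iff(2)[of w k] by fastforce
  qed
  have "Max (len ` parabolic m M) \<in> len ` parabolic m M"
    using assms parabolic_one[of M] by (intro Max_in) blast+
  then obtain w where "w \<in> parabolic m M" "len w = Max (len ` parabolic m M)"
    by auto
  then have w: "?P w"
    using assms by simp
  then have "longest m M = w"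
    unfolding longest_def
  proof (rule the_equality)
    fix w' assume "?P w'"
    then show "w' = w"
      using negating_unique[of w' M w] max_neg[of w'] max_neg[OF w] w by blast
  qed
  with w max_neg show "longest m M \<in> parabolic m M" "\<And>k. k \<in> M \<Longrightarrow> act m (longest m M) (\<alpha> k) \<le> 0"
    by auto
qed

lemma inv_longest:
  assumes "finite (parabolic m M)"
  shows "ginv (longest m M) = longest m M"
  using longest_parabolic[OF assms] negating_inv[of "longest m M" M]
  by (intro negating_unique[of _ M]) auto

text \<open>Up to sign these roots are inversions of \<open>u\<close>. The finiteness condition of
  the codimension two relations comes from here.\<close>

lemma finite_flipped:
  assumes "flips u I L"
  shows "finite {r \<in> roots m. r \<in> V L \<and> r \<notin> V I}"
proof -
  define N where "N = {r \<in> roots m. 0 \<le> r \<and> act m u r \<le> 0}"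
  have "finite N"
    unfolding N_def using assms finite_inversions[of u] by (auto simp: flips_def)
  moreover have "{r \<in> roots m. r \<in> V L \<and> r \<notin> V I} \<subseteq> N \<union> uminus ` N"
  proof
    fix r assume "r \<in> {r \<in> roots m. r \<in> V L \<and> r \<notin> V I}"
    then have r: "r \<in> roots m" "r \<in> V L" "r \<notin> V I"
      by auto
    show "r \<in> N \<union> uminus ` N"
    proof (cases "0 \<le> r")
      case True
      then show ?thesis
        using r assms by (auto simp: N_def flips_def)
    next
      case False
      then have "0 \<le> - r"
        using root_sign[OF r(1)] by auto
      moreover have "- r \<notin> V I"
        using r(3) V_minus[of "- r" I] by auto
      ultimately have "- r \<in> N"
        using r assms minus_roots V_minus[of r L] unfolding N_def flips_def by blast
      then show ?thesis
        by (metis UnCI image_eqI minus_minus)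
    qed
  qed
  ultimately show ?thesis
    by (auto intro: finite_subset)
qed

lemma finite_faithful:
  assumes "finite X" "\<And>w r. w \<in> Q \<Longrightarrow> r \<in> X \<Longrightarrow> act m w r \<in> X"
    and "\<And>w w'. w \<in> Q \<Longrightarrow> w' \<in> Q \<Longrightarrow> (\<And>r. r \<in> X \<Longrightarrow> act m w r = act m w' r) \<Longrightarrow> w = w'"
  shows "finite Q"
proof (rule finite_imageD)
  have "(\<lambda>w. restrict (act m w) X) ` Q \<subseteq> X \<rightarrow>\<^sub>E X"
    using assms(2) by auto
  then show "finite ((\<lambda>w. restrict (act m w) X) ` Q)"
    using assms(1) finite_PiE[of X "\<lambda>_. X"] finite_subset by blast
  show "inj_on (\<lambda>w. restrict (act m w) X) Q"
  proof (rule inj_onI)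
    fix w w' assume "w \<in> Q" "w' \<in> Q" "restrict (act m w) X = restrict (act m w') X"
    then show "w = w'"
      using assms(3) by (metis restrict_apply')
  qed
qed

lemma parabolic_eq_on_roots:
  assumes "w \<in> parabolic m M" "w' \<in> parabolic m M" "\<And>i. i \<in> M \<Longrightarrow> act m w (\<alpha> i) = act m w' (\<alpha> i)"
  shows "w = w'"
proof -
  have "act m (ginv w) (act m (ginv (ginv w')) (\<alpha> i)) = \<alpha> i" if "i \<in> M" for i
  proof -
    have "act m (ginv (ginv w')) (\<alpha> i) = act m w (\<alpha> i)"
      using assms that by simp
    then show ?thesis
      using assms by simp
  qed
  then have "ginv w = ginv w'"
    using assms by (intro parabolic_eqI[of _ M]) auto
  then show ?thesis
    using assms by (metis inv_inv parabolic_in_W)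
qed

section \<open>Components of the diagram and the formula for a simple wall crossing\<close>

lemma comp_of_self: "a \<in> comp_of m I a"
  by (simp add: comp_of_def)

lemma comp_of_subset: "comp_of m I a \<subseteq> insert a I"
proof
  fix b assume "b \<in> comp_of m I a"
  then show "b \<in> insert a I"
    unfolding comp_of_def mem_Collect_eq by (induction rule: rtrancl_induct) auto
qed

lemma comp_of_orthogonal:
  assumes "i \<in> comp_of m I a" "j \<in> insert a I" "j \<notin> comp_of m I a"
  shows "cox_coeff m i j = 0"
proof -
  have ij: "i \<noteq> j" "i \<in> insert a I"
    using assms comp_of_subset by auto
  have "\<not> 3 \<le> m i j"
    using assms ij unfolding comp_of_def by (auto dest: rtrancl_into_rtrancl)
  with m_ge2[OF ij(1)] have "m i j = enat 2"
    by (cases "m i j") (auto simp: numeral_eq_enat)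
  then show ?thesis
    by (simp add: cox_coeff_def)
qed

lemma cox_coeff_nonzero:
  assumes "3 \<le> m i j"
  shows "cox_coeff m i j \<noteq> 0"
proof (cases "m i j")
  case (enat k)
  then have k: "3 \<le> k"
    using assms by (simp add: numeral_eq_enat)
  then have "0 < cos (pi / real k)"
    by (intro cos_gt_zero_pi) (auto simp: field_simps intro: less_le_trans[of _ 0])
  with enat show ?thesis
    by (simp add: cox_coeff_def)
qed (simp add: cox_coeff_def)

lemma parabolic_fixes:
  assumes "w \<in> parabolic m M" "\<And>i. i \<in> M \<Longrightarrow> cox_coeff m i j = 0"
  shows "act m w (\<alpha> j) = \<alpha> j"
proof -
  have "rep u (\<alpha> j) = \<alpha> j" if "set u \<subseteq> M" for u
    using that by (induction u) (auto simp: simple_refl_def form_roots assms(2))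
  then show ?thesis
    using assms(1) unfolding parabolic_eq by (auto simp: subset_iff)
qed

text \<open>
  The group \<open>W\<^bsub>[I,a]-a\<^esub>\<close> acts on the finite set of roots of \<open>I + a\<close> that are not roots of \<open>I\<close>; since
  this set spans a space containing every simple root of the connected set \<open>[I,a]\<close>, the action is
  faithful.
\<close>

lemma finite_parabolic_comp:
  assumes "a \<notin> I" "flips u I (insert a I)"
  shows "finite (parabolic m (comp_of m I a))"
proof -
  define M where "M = comp_of m I a"
  define N where "N = M - {a}"
  define L where "L = insert a I"
  define F where "F = {r \<in> roots m. r \<in> V L \<and> r \<notin> V I}"
  have finF: "finite F"
    unfolding F_def L_def using finite_flipped[OF assms(2)] .
  have M: "a \<in> M" "M \<subseteq> L" "N \<subseteq> I" "N \<subseteq> M"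
    using comp_of_self[of a I] comp_of_subset[of I a] by (auto simp: M_def N_def L_def)
  have stable: "act m w r \<in> F" if "w \<in> parabolic m I" "r \<in> F" for w r
    using that parabolic_act_V[of w I I r] parabolic_act_V[of w I L r] by (auto simp: F_def L_def)
  have span_stable: "simple_refl m i v \<in> span F" if i: "i \<in> I" and "v \<in> span F" for i v
  proof -
    have "simple_refl m i v \<in> simple_refl m i ` span F"
      using that by blast
    also have "\<dots> = span (simple_refl m i ` F)"
      using linear_span_image[OF linear_refl] by metis
    also have "\<dots> \<subseteq> span F"
      using stable[of "gen i"] i by (intro span_mono) auto
    finally show ?thesis .
  qed
  have span: "\<alpha> j \<in> span F" if "j \<in> M" for j
    using that unfolding M_def comp_of_def mem_Collect_eq
  proof (induction rule: rtrancl_induct)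
    case base
    have "\<alpha> a \<in> F"
      using assms(1) by (simp add: F_def L_def)
    then show ?case
      by (rule span_base)
  next
    case (step j k)
    show ?case
    proof (cases "k = a")
      case True
      have "\<alpha> a \<in> F"
        using assms(1) by (simp add: F_def L_def)
      with True show ?thesis
        by (auto intro: span_base)
    next
      case False
      then have k: "k \<in> I" "3 \<le> m k j"
        using step.hyps m_sym by auto
      define c where "c = cox_coeff m k j"
      have c: "c \<noteq> 0"
        using cox_coeff_nonzero k by (simp add: c_def)
      \<comment> \<open>The form is nonzero along an edge, so \<alpha> k is recovered from \<alpha>
        j and its reflection in \<alpha> k.\<close>
      have "\<alpha> k = (1 / (2 * c)) *\<^sub>R (\<alpha> j - simple_refl m k (\<alpha> j))"
        using c by (simp add: simple_refl_def form_roots c_def)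
      also have "\<dots> \<in> span F"
        using span_stable[OF k(1) step.IH] step.IH by (intro span_scale span_diff)
      finally show ?thesis .
    qed
  qed
  have "finite (parabolic m N)"
  proof (rule finite_faithful[OF finF])
    show "act m w r \<in> F" if "w \<in> parabolic m N" "r \<in> F" for w r
      using that stable parabolic_mono[OF M(3)] by blast
    fix w w' assume w: "w \<in> parabolic m N" "w' \<in> parabolic m N" and eq: "\<And>r. r \<in> F \<Longrightarrow> act m w r = act m w' r"
    have lin: "linear (act m w)" "linear (act m w')"
      using w linear_act by blast+
    have "act m w (\<alpha> i) = act m w' (\<alpha> i)" if "i \<in> N" for i
      using linear_eq_on_span[OF lin eq span] that M(4) by blast
    then show "w = w'"
      using w parabolic_eq_on_roots by blast
  qed
  moreover have "roots_of m N = (\<lambda>(w, i). act m w (\<alpha> i)) ` (parabolic m N \<times> N)"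
    by (auto simp: roots_of_def)
  ultimately have finN: "finite (roots m \<inter> V N)"
    by (simp flip: roots_of_eq)
  \<comment> \<open>A root of \<open>M\<close> with nonzero coordinate at \<open>a\<close> belongs
    to \<open>F\<close>; otherwise it is one of the finitely many roots of \<open>N\<close>.\<close>
  have "roots m \<inter> V M \<subseteq> (roots m \<inter> V N) \<union> F"
  proof
    fix r assume r: "r \<in> roots m \<inter> V M"
    then have "r \<in> V L"
      using V_mono[OF M(2)] by auto
    then show "r \<in> (roots m \<inter> V N) \<union> F"
      using r assms(1) by (cases "r $ a = 0") (auto simp: F_def V_def N_def)
  qed
  then have finM: "finite (roots m \<inter> V M)"
    using finN finF by (auto intro: finite_subset)
  have "finite (parabolic m M)"
  proof (rule finite_faithful[OF finM])
    show "act m w r \<in> roots m \<inter> V M" if "w \<in> parabolic m M" "r \<in> roots m \<inter> V M" for w r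
      using that parabolic_act_V[of w M M r] by auto
    show "w = w'" if "w \<in> parabolic m M" "w' \<in> parabolic m M"
      "\<And>r. r \<in> roots m \<inter> V M \<Longrightarrow> act m w r = act m w' r" for w w'
      using that by (intro parabolic_eq_on_roots[of w M w']) auto
  qed
  then show ?thesis
    by (simp add: M_def)
qed

text \<open>By uniqueness it is enough that \<open>wM \<odot> wN\<close> flips. On simple roots of
  \<open>I\<close> inside the component the two negations cancel, and the others are fixed. A
  positive root involving \<open>a\<close> stays positive under \<open>wN\<close>, which keeps its
  coordinate at \<open>a\<close>, and is then made negative by \<open>wM\<close>.\<close>

lemma omega_eq:
  assumes a: "a \<notin> I" and flips: "flips u I (insert a I)"
    and K: "K \<subseteq> insert a I" "act m u ` \<alpha> ` I = \<alpha> ` K"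
  shows "omega m a (x, I) = (x \<odot> ginv u, K)"
proof -
  define M where "M = comp_of m I a"
  define N where "N = M - {a}"
  define L where "L = insert a I"
  have M: "a \<in> M" "M \<subseteq> L" "N \<subseteq> I" "N \<subseteq> M"
    using comp_of_self[of a I] comp_of_subset[of I a] by (auto simp: M_def N_def L_def)
  have finM: "finite (parabolic m M)"
    using finite_parabolic_comp[OF a flips] by (simp add: M_def)
  have finN: "finite (parabolic m N)"
    using finM parabolic_mono[OF M(4)] finite_subset by blast
  define wM where "wM = longest m M"
  define wN where "wN = longest m N"
  have wM: "wM \<in> parabolic m M" "\<And>k. k \<in> M \<Longrightarrow> act m wM (\<alpha> k) \<le> 0" "ginv wM = wM" "wM \<in> W"
    unfolding wM_def using longest_parabolic[OF finM] inv_longest[OF finM] by auto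
  have wN: "wN \<in> parabolic m N" "\<And>k. k \<in> N \<Longrightarrow> act m wN (\<alpha> k) \<le> 0" "ginv wN = wN" "wN \<in> W"
    unfolding wN_def using longest_parabolic[OF finN] inv_longest[OF finN] by auto
  have wNM: "wN \<in> parabolic m M" "wN \<in> parabolic m I" "wN \<in> parabolic m L" "wM \<in> parabolic m L"
    using wM(1) wN(1) M parabolic_mono[of N M] parabolic_mono[of N I] parabolic_mono[of M L]
      parabolic_mono[of N L] by auto
  have fixed: "act m w (\<alpha> j) = \<alpha> j" if "w \<in> parabolic m M" "j \<in> L" "j \<notin> M" for w j
    using parabolic_fixes[OF that(1)] comp_of_orthogonal[of _ I a j] that(2,3) by (simp add: M_def L_def)
  define u' where "u' = wM \<odot> wN"
  have pos: "0 \<le> act m u' (\<alpha> i)" if i: "i \<in> I" for i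
  proof (cases "i \<in> M")
    case True
    then have iN: "i \<in> N"
      using i a by (auto simp: N_def)
    have "- act m wN (\<alpha> i) \<in> V M"
      using True wNM(1) parabolic_act_V[of wN M M "\<alpha> i"] by (simp add: V_minus)
    then have "act m wM (- act m wN (\<alpha> i)) \<le> 0"
      using wM wN(2)[OF iN] act_nonpos_V[of wM "- act m wN (\<alpha> i)" M] by auto
    then show ?thesis
      using wM(4) wN(4) by (simp add: u'_def act_minus)
  next
    case False
    then have "act m u' (\<alpha> i) = \<alpha> i"
      using fixed wM wN wNM i by (simp add: u'_def L_def)
    then show ?thesis
      by simp
  qed
  have neg: "act m u' r \<le> 0" if r: "r \<in> roots m" "r \<in> V L" "r \<notin> V I" "0 \<le> r" for r
  proof -
    have "r $ a \<noteq> 0"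
      using r(2,3) by (auto simp: V_def L_def)
    then have ra: "0 < r $ a"
      using r(4) by (simp add: less_eq_vec_def order_less_le)
    define \<gamma> where "\<gamma> = act m wN r"
    have \<gamma>: "\<gamma> \<in> roots m" "\<gamma> \<in> V L"
      using r wN(4) wNM(3) parabolic_act_V[of wN L L r] by (auto simp: \<gamma>_def)
    have \<gamma>a: "0 < \<gamma> $ a"
      using ra parabolic_act_nth[OF wN(1), of a r] by (simp add: \<gamma>_def N_def)
    then have \<gamma>pos: "0 \<le> \<gamma>"
      using root_sign_coordinate(1)[OF \<gamma>(1)] by blast
    \<comment> \<open>The part of \<open>\<gamma>\<close> supported on the component. The rest is
      fixed by \<open>wM\<close>, being orthogonal to the component, so a negative coordinate at an
      index in \<open>M\<close> decides the sign.\<close>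
    define \<mu> :: "real^'v" where "\<mu> = (\<chi> i. if i \<in> M then \<gamma> $ i else 0)"
    have \<mu>: "\<mu> \<in> V M" "0 \<le> \<mu>" "\<gamma> - \<mu> \<in> V (L - M)"
      using \<gamma>pos \<gamma>(2) by (auto simp: \<mu>_def V_def less_eq_vec_def)
    have fix\<mu>: "act m wM (\<gamma> - \<mu>) = \<gamma> - \<mu>"
      using act_V_expansion[OF wM(4) \<mu>(3)] V_expansion[OF \<mu>(3)] fixed[OF wM(1)]
      by (metis (no_types, lifting) Diff_iff sum.cong)
    have "act m wM \<gamma> = act m wM \<mu> + act m wM (\<gamma> - \<mu>)"
      using wM(4) by (simp add: linear_diff[OF linear_act])
    then have split: "act m wM \<gamma> = act m wM \<mu> + (\<gamma> - \<mu>)"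
      using fix\<mu> by simp
    have "act m wM \<mu> \<noteq> 0"
    proof
      assume "act m wM \<mu> = 0"
      then have "act m (ginv wM) 0 = \<mu>"
        using act_inv[OF wM(4), of \<mu>] by simp
      then have "\<mu> = 0"
        using linear_0[OF linear_act] wM(4) by auto
      then have "\<mu> $ a = 0"
        by simp
      then show False
        using \<gamma>a M(1) by (simp add: \<mu>_def)
    qed
    then obtain k where k: "act m wM \<mu> $ k \<noteq> 0"
      by (auto simp: vec_eq_iff)
    have kM: "k \<in> M"
      using k \<mu>(1) wM(1) parabolic_act_V[of wM M M \<mu>] by (auto simp: V_def)
    have "act m wM \<mu> \<le> 0"
      using wM \<mu> act_nonpos_V[of wM \<mu> M] by blast
    then have "act m wM \<gamma> $ k < 0"
      using k kM by (simp add: split \<mu>_def less_eq_vec_def order_less_le)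
    then have "act m wM \<gamma> \<le> 0"
      using root_sign_coordinate(2)[of "act m wM \<gamma>" k] \<gamma>(1) wM(4) by blast
    then show ?thesis
      using wM wN by (simp add: u'_def \<gamma>_def)
  qed
  have "flips u' I L"
    unfolding flips_def using pos neg wNM by (auto simp: u'_def L_def)
  then have u: "u = u'"
    using flips_unique flips by (simp add: L_def)
  have cross: "cross_elt m a I = ginv u"
    using wM wN by (simp add: u u'_def inv_mult_group cross_elt_def flip: M_def N_def wM_def wN_def)
  \<comment> \<open>\<open>wM\<close> is its own inverse and makes the simple roots of
    \<open>M\<close> negative, so indecomposability with sign \<open>- 1\<close> applies.\<close>
  have "\<exists>l. act m wM (\<alpha> a) = (- 1) *\<^sub>R \<alpha> l"
  proof (rule simple_root_image[OF wM(4)])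
    show "0 \<le> (- 1) *\<^sub>R act m wM (\<alpha> a)"
      using wM(2)[OF M(1)] by simp
    fix l assume "act m wM (\<alpha> a) $ l \<noteq> 0"
    then have "l \<in> M"
      using wM(1) M(1) parabolic_act_nth[of wM M l "\<alpha> a"] by (metis simple_root_other)
    then show "0 \<le> (- 1) *\<^sub>R act m (ginv wM) (\<alpha> l)"
      using wM(2,3) by simp
  qed simp
  then obtain j where j: "act m wM (\<alpha> a) = - \<alpha> j"
    by auto
  have "- \<alpha> j \<in> V M"
    using wM(1) M(1) parabolic_act_V[of wM M M "\<alpha> a"] j by simp
  then have jM: "j \<in> M"
    using V_minus[of "- \<alpha> j" M] by simp
  have iota: "iota m M a = j"
    unfolding iota_def wM_def[symmetric] j by (rule the_equality) auto
  have "j \<notin> K"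
  proof
    assume "j \<in> K"
    then have "\<alpha> j \<in> act m u ` \<alpha> ` I"
      unfolding K(2) by blast
    then obtain i where i: "i \<in> I" "\<alpha> j = act m u (\<alpha> i)"
      by blast
    then have "act m wM (act m wN (\<alpha> i)) = act m wM (- \<alpha> a)"
      using j wM wN by (simp add: u u'_def act_minus)
    then have "act m wN (\<alpha> i) = - \<alpha> a"
      using act_inv[OF wM(4)] by metis
    then have "\<alpha> i $ a = - 1"
      using parabolic_act_nth[OF wN(1), of a "\<alpha> i"] by (simp add: N_def)
    then show False
      by (simp add: simple_root_nth split: if_splits)
  qed
  have uW: "u \<in> W"
    using flips by (auto simp: flips_def)
  have inj: "inj_on \<alpha> X" for X
    by (simp add: inj_on_def)
  have "inj_on (act m u) X" for X
    using act_inv[OF uW] by (metis inj_onI)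
  \<comment> \<open>\<open>K\<close> and the set prescribed by \<open>omega\<close> turn out equally
    large, so an inclusion between them suffices.\<close>
  then have "card K = card I"
    using K(2) inj by (metis card_image)
  moreover have "card (insert a I - {j}) = card I"
    using jM M(2) a by (simp add: L_def card_Diff_singleton subset_iff)
  moreover have "K \<subseteq> insert a I - {j}"
    using K(1) \<open>j \<notin> K\<close> by blast
  ultimately have "K = insert a I - {j}"
    by (intro card_subset_eq) auto
  then show ?thesis
    using cross iota by (simp add: omega_def flip: M_def)
qed

lemma Sep_eq_empty:
  assumes "D \<in> Cham m J" "E \<in> Cham m J" "Sep J (ch D) (ch E) = {}"
  shows "ch D = ch E"
proof (rule ccontr)
  assume ne: "ch D \<noteq> ch E"
  obtain x I y K where D: "D = (x, I)" and E: "E = (y, K)"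
    by fastforce
  obtain a where "a \<notin> I" "\<not> 0 \<le> act m (ginv y) (act m x (\<alpha> a))"
    using Sep_nonempty[of x I J y K] assms ne unfolding D E by blast
  then show False
    using mem_Sep_simple[of x I J y K a] assms unfolding D E by blast
qed

text \<open>For a single wall the opposite chamber is the one named by \<open>omega\<close>. Just
  one hyperplane lies between: on \<open>Theta J\<close> the image of a root in the span of
  \<open>I + a\<close> but not of \<open>I\<close> agrees with a nonzero multiple of the image of
  \<alpha> a.\<close>

lemma wall_crossing:
  assumes xI: "(x, I) \<in> Cham m J" and E: "(y, K) \<in> Cham m J" and a: "a \<notin> I"
    and neg: "\<not> 0 \<le> act m (ginv y) (act m x (\<alpha> a))"
  shows "omega m a (x, I) \<in> Cham m J" "finite (parabolic m (comp_of m I a))"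
    "adjacent m J (ch (x, I)) (ch (omega m a (x, I)))"
    "Sep J (ch (x, I)) (ch (omega m a (x, I))) = {root_hyp (act m x (\<alpha> a)) \<inter> Theta J}"
    "card (Sep J (ch (x, I)) (ch (y, K))) = Suc (card (Sep J (ch (omega m a (x, I))) (ch (y, K))))"
proof -
  define H where "H = root_hyp (act m x (\<alpha> a)) \<inter> Theta J"
  have x: "x \<in> W"
    using ChamD xI by auto
  obtain u K' where u: "flips u I (I \<union> {a})" "K' \<subseteq> I \<union> {a}" "act m u ` \<alpha> ` I = \<alpha> ` K'"
    and F: "(x \<odot> ginv u, K') \<in> Cham m J"
    and un: "Sep J (ch (x, I)) (ch (y, K)) =
       Sep J (ch (x, I)) (ch (x \<odot> ginv u, K')) \<union> Sep J (ch (x \<odot> ginv u, K')) (ch (y, K))"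
    and disj: "Sep J (ch (x, I)) (ch (x \<odot> ginv u, K')) \<inter> Sep J (ch (x \<odot> ginv u, K')) (ch (y, K)) = {}"
    and mem: "\<And>r. r \<in> roots m \<Longrightarrow> r \<notin> V J \<Longrightarrow>
       root_hyp r \<inter> Theta J \<in> Sep J (ch (x, I)) (ch (x \<odot> ginv u, K')) \<longleftrightarrow> act m (ginv x) r \<in> V (I \<union> {a})"
    using opposite_chamber[OF xI E, of "{a}"] a neg by auto
  have ins: "I \<union> {a} = insert a I"
    by simp
  note u = u[unfolded ins] and mem = mem[unfolded ins]
  have om: "omega m a (x, I) = (x \<odot> ginv u, K')"
    using omega_eq[OF a u] .
  have hyp_eq: "root_hyp r \<inter> Theta J = H"
    if r: "r \<in> roots m" "r \<notin> V J" "act m (ginv x) r \<in> V (insert a I)" for r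
  proof -
    define \<beta> where "\<beta> = act m (ginv x) r"
    have \<beta>: "act m x \<beta> = r" "\<beta> \<notin> V I"
      using x r Cham_V_inv[OF xI] by (auto simp: \<beta>_def)
    then have \<beta>a: "\<beta> $ a \<noteq> 0"
      using r(3) by (auto simp: V_def \<beta>_def[symmetric])
    have "\<phi> \<bullet> r = \<beta> $ a * (\<phi> \<bullet> act m x (\<alpha> a))" if "\<phi> \<in> Theta J" for \<phi>
    proof -
      have "r = \<beta> $ a *\<^sub>R act m x (\<alpha> a) + (\<Sum>i\<in>I. \<beta> $ i *\<^sub>R act m x (\<alpha> i))"
        using act_V_expansion[OF x, of \<beta> "insert a I"] r(3) a \<beta> by (simp add: \<beta>_def[symmetric])
      then show ?thesis
        using that Cham_Theta[OF xI] by (simp add: inner_add_right inner_sum_right)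
    qed
    then show ?thesis
      using \<beta>a by (auto simp: H_def root_hyp_def)
  qed
  show sepDF: "Sep J (ch (x, I)) (ch (omega m a (x, I))) = {H}"
  proof (intro equalityI subsetI)
    fix H' assume H': "H' \<in> Sep J (ch (x, I)) (ch (omega m a (x, I)))"
    then obtain r where "r \<in> roots m" "r \<notin> V J" "H' = root_hyp r \<inter> Theta J"
      by (rule SepE)
    with hyp_eq H' mem om show "H' \<in> {H}"
      by auto
  next
    fix H' assume "H' \<in> {H}"
    then show "H' \<in> Sep J (ch (x, I)) (ch (omega m a (x, I)))"
      using mem[of "act m x (\<alpha> a)"] x a Cham_V[OF xI] by (auto simp: H_def om)
  qed
  show "omega m a (x, I) \<in> Cham m J"
    using F om by simp
  show "finite (parabolic m (comp_of m I a))"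
    using finite_parabolic_comp[OF a u(1)] .
  have "ch (x, I) \<noteq> ch (x \<odot> ginv u, K')"
    using sepDF Sep_self[OF xI] om by auto
  then show "adjacent m J (ch (x, I)) (ch (omega m a (x, I)))"
    unfolding om using u F by (intro adjacentI[OF xI a]) (auto simp: flips_def)
  show "card (Sep J (ch (x, I)) (ch (y, K))) = Suc (card (Sep J (ch (omega m a (x, I))) (ch (y, K))))"
    unfolding un using disj sepDF finite_Sep[OF F E] by (simp add: om)
qed

section \<open>Paths and geodesics\<close>

lemma is_path_Cons:
  "is_path m J D E (D' # p) \<longleftrightarrow> D' = D \<and> D \<in> chambers m J \<and>
     (if p = [] then D = E else adjacent m J D (hd p) \<and> is_path m J (hd p) E p)"
  by (auto simp: is_path_def successively_Cons)

text \<open>\<open>tl\<close> drops the junction chamber, which already ends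
  \<open>p\<close>.\<close>

lemma is_path_append:
  assumes "is_path m J D F p" "is_path m J F E q"
  shows "is_path m J D E (p @ tl q)"
  using assms
proof (induction p arbitrary: D)
  case (Cons D' p)
  show ?case
  proof (cases "p = []")
    case True
    then have "[D'] @ tl q = q"
      using Cons.prems by (cases q) (auto simp: is_path_def)
    with Cons.prems True show ?thesis
      by (simp add: is_path_Cons)
  next
    case False
    then show ?thesis
      using Cons by (simp add: is_path_Cons)
  qed
qed (simp add: is_path_def)

lemma is_path_in_chambers:
  assumes "is_path m J D E p"
  shows "D \<in> chambers m J" "E \<in> chambers m J"
  using assms by (auto simp: is_path_def)

text \<open>Each step crosses at most one separating hyperplane; the inequality is strict because
  the length counts chambers, one more than steps.\<close>

lemma card_Sep_less_length:
  assumes "is_path m J D E p"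
  shows "card (Sep J D E) < length p"
  using assms
proof (induction p arbitrary: D)
  case (Cons D' p)
  show ?case
  proof (cases "p = []")
    case True
    then have "D = E" "D \<in> chambers m J"
      using Cons.prems by (auto simp: is_path_Cons)
    then have "Sep J D E = {}"
      using Sep_self by (auto simp: chambers_eq)
    then show ?thesis
      by simp
  next
    case False
    then have adj: "adjacent m J D (hd p)" and p: "is_path m J (hd p) E p"
      using Cons.prems by (auto simp: is_path_Cons)
    obtain A B C where A: "A \<in> Cham m J" "D = ch A" and B: "B \<in> Cham m J" "hd p = ch B"
      and C: "C \<in> Cham m J" "E = ch C"
      using adj is_path_in_chambers(2)[OF p] unfolding adjacent_def chambers_eq by blast
    obtain H where "Sep J D (hd p) \<subseteq> {H}"
      using adjacent_Sep[OF A(1) B(1)] adj A B by auto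
    then have "card (Sep J D (hd p)) \<le> 1"
      using card_mono[of "{H}"] by simp
    moreover have "card (Sep J D E) \<le> card (Sep J D (hd p) \<union> Sep J (hd p) E)"
      using Sep_triangle[OF A(1) B(1) C(1)] finite_Sep[OF A(1) B(1)] finite_Sep[OF B(1) C(1)] A B C
      by (intro card_mono) auto
    moreover have "card (Sep J D (hd p) \<union> Sep J (hd p) E) \<le> card (Sep J D (hd p)) + card (Sep J (hd p) E)"
      by (rule card_Un_le)
    ultimately show ?thesis
      using Cons.IH[OF p] by simp
  qed
qed (simp add: is_path_def)

text \<open>While the chambers differ, some wall of \<open>D\<close> has \<open>E\<close> on its far
  side, and crossing it lowers the number of separating hyperplanes by one.\<close>

lemma ex_short_path:
  assumes "D \<in> Cham m J" "E \<in> Cham m J"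
  shows "\<exists>p. is_path m J (ch D) (ch E) p \<and> length p = Suc (card (Sep J (ch D) (ch E)))"
  using assms(1)
proof (induction "card (Sep J (ch D) (ch E))" arbitrary: D)
  case 0
  then have "ch D = ch E"
    using finite_Sep[OF 0(2) assms(2)] Sep_eq_empty[OF 0(2) assms(2)] by simp
  then show ?case
    using 0(1) chamber_in_chambers[OF 0(2)] by (intro exI[of _ "[ch D]"]) (simp add: is_path_Cons)
next
  case (Suc n)
  obtain x I y K where D: "D = (x, I)" and E: "E = (y, K)"
    by fastforce
  have "ch (x, I) \<noteq> ch (y, K)"
  proof
    assume "ch (x, I) = ch (y, K)"
    then have "Sep J (ch D) (ch E) = {}"
      using Sep_self[OF Suc.prems] by (simp add: D E)
    with Suc.hyps(2) show False
      by simp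
  qed
  then obtain a where a: "a \<notin> I" "\<not> 0 \<le> act m (ginv y) (act m x (\<alpha> a))"
    using Sep_nonempty[of x I J y K] Suc.prems assms(2) unfolding D E by blast
  note cross = wall_crossing[OF Suc.prems[unfolded D] assms(2)[unfolded E] a]
  have n: "n = card (Sep J (ch (omega m a (x, I))) (ch E))"
    using cross(5) Suc.hyps(2) by (simp add: D E)
  obtain p where p: "is_path m J (ch (omega m a (x, I))) (ch E) p" "length p = Suc n"
    using Suc.hyps(1)[OF n cross(1)] n by auto
  then have "is_path m J (ch D) (ch E) (ch D # p)"
    using cross(3) Suc.prems chamber_in_chambers by (auto simp: is_path_Cons D is_path_def[of m J _ _ p])
  then show ?case
    using p Suc.hyps(2) by (intro exI[of _ "ch D # p"]) simp
qed

text \<open>The lower bound and the greedy path agree, so minimality becomes an equation of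
  cardinalities that can be added along concatenated paths.\<close>

lemma geodesic_iff:
  assumes "D \<in> Cham m J" "E \<in> Cham m J"
  shows "geodesic m J (ch D) (ch E) p \<longleftrightarrow>
    is_path m J (ch D) (ch E) p \<and> length p = Suc (card (Sep J (ch D) (ch E)))"
proof
  assume g: "geodesic m J (ch D) (ch E) p"
  then have "length p \<le> Suc (card (Sep J (ch D) (ch E)))"
    using ex_short_path[OF assms] by (metis geodesic_def)
  moreover have "is_path m J (ch D) (ch E) p"
    using g by (simp add: geodesic_def)
  ultimately show "is_path m J (ch D) (ch E) p \<and> length p = Suc (card (Sep J (ch D) (ch E)))"
    using card_Sep_less_length by (metis le_antisym Suc_leI)
next
  assume "is_path m J (ch D) (ch E) p \<and> length p = Suc (card (Sep J (ch D) (ch E)))"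
  then show "geodesic m J (ch D) (ch E) p"
    using card_Sep_less_length by (auto simp: geodesic_def Suc_le_eq)
qed

text \<open>Some wall of the first chamber has the second one on its far side; as only one
  hyperplane separates the two, the second chamber is the result of crossing that wall. Counting
  then shows that the hyperplane also separates the endpoints.\<close>

lemma geodesic_first_step:
  assumes xI: "(x, I) \<in> Cham m J" and E: "(y, K) \<in> Cham m J"
    and p: "geodesic m J (ch (x, I)) (ch (y, K)) p" "Sep J (ch (x, I)) (ch (y, K)) \<noteq> {}"
  obtains a q where "a \<notin> I" "\<not> 0 \<le> act m (ginv y) (act m x (\<alpha> a))" "p = ch (x, I) # q"
    "geodesic m J (ch (omega m a (x, I))) (ch (y, K)) q"
proof -
  define D where "D = (x, I)"
  have path: "is_path m J (ch D) (ch (y, K)) p" and length: "length p = Suc (card (Sep J (ch D) (ch (y, K))))"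
    using p(1) geodesic_iff[OF xI E] by (auto simp: D_def)
  have D: "D \<in> Cham m J"
    using xI by (simp add: D_def)
  have fin: "finite (Sep J (ch D) (ch (y, K)))"
    using finite_Sep[OF D E] .
  obtain q where q: "p = ch D # q" "length q = card (Sep J (ch D) (ch (y, K)))"
    using path length by (cases p) (auto simp: is_path_Cons)
  have "q \<noteq> []"
    using q fin p(2) by (auto simp: D_def)
  then have adj: "adjacent m J (ch D) (hd q)" and qpath: "is_path m J (hd q) (ch (y, K)) q"
    using path by (auto simp: q is_path_Cons)
  obtain z M where zM: "(z, M) \<in> Cham m J" "hd q = ch (z, M)"
    using adj by (auto simp: adjacent_def chambers_eq)
  have "ch (x, I) \<noteq> ch (z, M)"
    using adj zM by (auto simp: adjacent_def D_def)
  then obtain a where a: "a \<notin> I" "\<not> 0 \<le> act m (ginv z) (act m x (\<alpha> a))"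
    using Sep_nonempty[OF xI zM(1)] by blast
  note cross = wall_crossing[OF xI zM(1) a]
  obtain H where "Sep J (ch (x, I)) (ch (z, M)) \<subseteq> {H}"
    using adjacent_Sep[OF xI zM(1)] adj zM by (auto simp: D_def)
  then have "card (Sep J (ch (x, I)) (ch (z, M))) \<le> 1"
    using card_mono[of "{H}"] by simp
  then have "card (Sep J (ch (omega m a (x, I))) (ch (z, M))) = 0"
    using cross(5) by simp
  then have hd: "ch (omega m a (x, I)) = hd q"
    using finite_Sep[OF cross(1) zM(1)] Sep_eq_empty[OF cross(1) zM(1)] zM(2) by simp
  define h where "h = root_hyp (act m x (\<alpha> a)) \<inter> Theta J"
  have sep: "Sep J (ch D) (hd q) = {h}"
    using cross(4) hd by (simp add: D_def h_def)
  \<comment> \<open>The tail has one chamber less than \<open>p\<close>, so fewer hyperplanes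
    separate its start from the end; one that is lost can only be \<open>h\<close>.\<close>
  have "card (Sep J (hd q) (ch (y, K))) < card (Sep J (ch D) (ch (y, K)))"
    using card_Sep_less_length[OF qpath] q(2) by simp
  then have "\<not> Sep J (ch D) (ch (y, K)) \<subseteq> Sep J (hd q) (ch (y, K))"
    using card_mono[OF finite_Sep[OF zM(1) E]] zM(2) by (metis not_less)
  then have "h \<in> Sep J (ch D) (ch (y, K))"
    using Sep_triangle[OF D zM(1) E] sep zM(2) by auto
  then have neg: "\<not> 0 \<le> act m (ginv y) (act m x (\<alpha> a))"
    using mem_Sep_simple[OF xI E a(1)] by (simp add: h_def D_def)
  have "geodesic m J (ch (omega m a (x, I))) (ch (y, K)) q"
    unfolding geodesic_iff[OF cross(1) E]
    using qpath hd q(2) wall_crossing(5)[OF xI E a(1) neg] by (simp add: D_def)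
  with that[OF a(1) neg] q(1) show thesis
    by (simp add: D_def)
qed

section \<open>Transforming geodesics by codimension two relations\<close>

lemma codim2_step_Cons: "codim2_step m J p q \<Longrightarrow> codim2_step m J (D # p) (D # q)"
  unfolding codim2_step_def by (metis append_Cons)

lemma codim2_steps_Cons: "(codim2_step m J)\<^sup>*\<^sup>* p q \<Longrightarrow> (codim2_step m J)\<^sup>*\<^sup>* (D # p) (D # q)"
  by (induction rule: rtranclp_induct) (auto intro: rtranclp.rtrancl_into_rtrancl codim2_step_Cons)

lemma geodesic_Cons:
  assumes xI: "(x, I) \<in> Cham m J" and E: "(y, K) \<in> Cham m J" and a: "a \<notin> I"
    and neg: "\<not> 0 \<le> act m (ginv y) (act m x (\<alpha> a))"
    and q: "geodesic m J (ch (omega m a (x, I))) (ch (y, K)) q"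
  shows "geodesic m J (ch (x, I)) (ch (y, K)) (ch (x, I) # q)"
    and "begins_with m (ch (x, I) # q) a (x, I)"
proof -
  note cross = wall_crossing[OF xI E a neg]
  have path: "is_path m J (ch (omega m a (x, I))) (ch (y, K)) q"
    and length: "length q = Suc (card (Sep J (ch (omega m a (x, I))) (ch (y, K))))"
    using q geodesic_iff[OF cross(1) E] by auto
  have hd: "q \<noteq> []" "hd q = ch (omega m a (x, I))"
    using path by (auto simp: is_path_def)
  show "geodesic m J (ch (x, I)) (ch (y, K)) (ch (x, I) # q)"
    unfolding geodesic_iff[OF xI E]
    using path length hd cross chamber_in_chambers[OF xI] by (simp add: is_path_Cons)
  show "begins_with m (ch (x, I) # q) a (x, I)"
    using cross(2) hd by (cases q) (auto simp: begins_with_def)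
qed

theorem geodesics_related:
  assumes "(x, I) \<in> Cham m J" "(y, K) \<in> Cham m J"
    and "geodesic m J (ch (x, I)) (ch (y, K)) p" "geodesic m J (ch (x, I)) (ch (y, K)) p'"
  shows "(codim2_step m J)\<^sup>*\<^sup>* p p'"
  using assms(1,3,4)
proof (induction "card (Sep J (ch (x, I)) (ch (y, K)))" arbitrary: x I p p')
  case 0
  have "length p = 1" "length p' = 1" "is_path m J (ch (x, I)) (ch (y, K)) p"
    "is_path m J (ch (x, I)) (ch (y, K)) p'"
    using 0 geodesic_iff[OF 0(2) assms(2)] by auto
  then have "p = p'"
    by (auto simp: length_Suc_conv is_path_Cons)
  then show ?case
    by simp
next
  case (Suc n)
  note xI = Suc.prems(1) and E = assms(2)
  have ne: "Sep J (ch (x, I)) (ch (y, K)) \<noteq> {}"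
    using Suc.hyps(2) by auto
  obtain a q where a: "a \<notin> I" "\<not> 0 \<le> act m (ginv y) (act m x (\<alpha> a))"
    and q: "p = ch (x, I) # q" "geodesic m J (ch (omega m a (x, I))) (ch (y, K)) q"
    using geodesic_first_step[OF xI E Suc.prems(2) ne] .
  obtain b q' where b: "b \<notin> I" "\<not> 0 \<le> act m (ginv y) (act m x (\<alpha> b))"
    and q': "p' = ch (x, I) # q'" "geodesic m J (ch (omega m b (x, I))) (ch (y, K)) q'"
    using geodesic_first_step[OF xI E Suc.prems(3) ne] .
  \<comment> \<open>For two geodesics with the same first crossing, the tails start at a chamber
    with one separating hyperplane less.\<close>
  have IH: "(codim2_step m J)\<^sup>*\<^sup>* (ch (x, I) # r) (ch (x, I) # r')"
    if c: "c \<notin> I" "\<not> 0 \<le> act m (ginv y) (act m x (\<alpha> c))"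
      and r: "geodesic m J (ch (omega m c (x, I))) (ch (y, K)) r"
        "geodesic m J (ch (omega m c (x, I))) (ch (y, K)) r'" for c r r'
  proof -
    obtain z M where zM: "omega m c (x, I) = (z, M)"
      by fastforce
    note cross = wall_crossing[OF xI E c]
    have "n = card (Sep J (ch (z, M)) (ch (y, K)))" "(z, M) \<in> Cham m J"
      using cross(1,5) Suc.hyps(2) by (simp_all add: zM)
    then have "(codim2_step m J)\<^sup>*\<^sup>* r r'"
      using r Suc.hyps(1) by (simp add: zM)
    then show ?thesis
      by (rule codim2_steps_Cons)
  qed
  show ?case
  proof (cases "a = b")
    case True
    then show ?thesis
      using IH[OF a q(2)] q q' by simp
  next
    case False
    let ?D = "ch (x, I)" and ?E = "ch (y, K)"
    have "{a, b} \<inter> I = {}" "\<And>c. c \<in> {a, b} \<Longrightarrow> \<not> 0 \<le> act m (ginv y) (act m x (\<alpha> c))"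
      using a b by auto
    then obtain u M where u: "flips u I (I \<union> {a, b})" and zM: "(x \<odot> ginv u, M) \<in> Cham m J"
      and un: "Sep J ?D ?E = Sep J ?D (ch (x \<odot> ginv u, M)) \<union> Sep J (ch (x \<odot> ginv u, M)) ?E"
      and disj: "Sep J ?D (ch (x \<odot> ginv u, M)) \<inter> Sep J (ch (x \<odot> ginv u, M)) ?E = {}"
      and mem: "\<And>r. r \<in> roots m \<Longrightarrow> r \<notin> V J \<Longrightarrow>
        root_hyp r \<inter> Theta J \<in> Sep J ?D (ch (x \<odot> ginv u, M)) \<longleftrightarrow> act m (ginv x) r \<in> V (I \<union> {a, b})"
      using opposite_chamber[OF xI E] by metis
    define z where "z = x \<odot> ginv u"
    let ?F = "ch (z, M)"
    note zM = zM[folded z_def] and un = un[folded z_def] and disj = disj[folded z_def] and mem = mem[folded z_def]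
    have x: "x \<in> W"
      using ChamD xI by auto
    have card: "card (Sep J ?D ?E) = card (Sep J ?D ?F) + card (Sep J ?F ?E)"
      unfolding un using disj finite_Sep[OF xI zM] finite_Sep[OF zM E] by (intro card_Un_disjoint)
    obtain t where t: "is_path m J ?F ?E t" "length t = Suc (card (Sep J ?F ?E))"
      using ex_short_path[OF zM E] by auto
    have half: "\<exists>s. geodesic m J ?D ?F (?D # s) \<and> begins_with m (?D # s) c (x, I) \<and>
        geodesic m J (ch (omega m c (x, I))) ?E (s @ tl t)"
      if c: "c \<in> {a, b}" "c \<notin> I" "\<not> 0 \<le> act m (ginv y) (act m x (\<alpha> c))" for c
    proof -
      note crossE = wall_crossing[OF xI E c(2,3)]
      \<comment> \<open>\<alpha> c lies in \<open>V (I \<union> {a, b})\<close>, so its hyperplane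
        passes through the face and separates \<open>?D\<close> from \<open>?F\<close>; hence a
        geodesic to \<open>?F\<close> may also begin with \<open>c\<close>.\<close>
      have "root_hyp (act m x (\<alpha> c)) \<inter> Theta J \<in> Sep J ?D ?F"
        using mem[of "act m x (\<alpha> c)"] x c Cham_V[OF xI] by auto
      then have neg: "\<not> 0 \<le> act m (ginv z) (act m x (\<alpha> c))"
        using mem_Sep_simple[OF xI zM c(2)] by blast
      note crossF = wall_crossing[OF xI zM c(2) neg]
      obtain s where s: "is_path m J (ch (omega m c (x, I))) ?F s"
        "length s = Suc (card (Sep J (ch (omega m c (x, I))) ?F))"
        using ex_short_path[OF crossF(1) zM] by auto
      then have "geodesic m J (ch (omega m c (x, I))) ?F s"
        using geodesic_iff[OF crossF(1) zM] by simp
      \<comment> \<open>The separators up to \<open>?F\<close> and after it are disjoint and exhaust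
        those of the endpoints, so the lengths add up to the minimum.\<close>
      moreover have "geodesic m J (ch (omega m c (x, I))) ?E (s @ tl t)"
        unfolding geodesic_iff[OF crossE(1) E]
        using is_path_append[OF s(1) t(1)] s(2) t(2) crossE(5) crossF(5) card by simp
      ultimately show ?thesis
        using geodesic_Cons[OF xI zM c(2) neg] by blast
    qed
    obtain s where s: "geodesic m J ?D ?F (?D # s)" "begins_with m (?D # s) a (x, I)"
      "geodesic m J (ch (omega m a (x, I))) ?E (s @ tl t)"
      using half[of a] a by auto
    obtain s' where s': "geodesic m J ?D ?F (?D # s')" "begins_with m (?D # s') b (x, I)"
      "geodesic m J (ch (omega m b (x, I))) ?E (s' @ tl t)"
      using half[of b] b by auto
    have z: "x \<odot> codim2_elt m a b I = z"
      using codim2_elt_eq[OF u] by (simp add: z_def)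
    have "finite (roots_of m (I \<union> {a, b}) - roots_of m I)"
      using finite_flipped[OF u] by (rule finite_subset[rotated]) (auto simp: roots_of_eq)
    then have "codim2_rel m J (?D # s) (?D # s')"
      unfolding codim2_rel_def using xI False a(1) b(1) zM s(1,2) s'(1,2)
      by (intro exI[of _ x] exI[of _ I] exI[of _ a] exI[of _ b] exI[of _ M]) (simp only: z, simp)
    then have "codim2_step m J (?D # s @ tl t) (?D # s' @ tl t)"
      unfolding codim2_step_def by (metis append_Cons append_Nil)
    moreover have "(codim2_step m J)\<^sup>*\<^sup>* p (?D # s @ tl t)"
      using IH[OF a q(2) s(3)] q(1) by simp
    moreover have "(codim2_step m J)\<^sup>*\<^sup>* (?D # s' @ tl t) p'"
      using IH[OF b s'(3) q'(2)] q'(1) by simp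
    ultimately show ?thesis
      by (metis rtranclp.rtrancl_into_rtrancl rtranclp_trans)
  qed
qed

end

theorem corollary4p26:
  fixes m :: "'v::finite \<Rightarrow> 'v \<Rightarrow> enat" and J I K :: "'v set"
    and x y :: "'v list set" and p p' :: "(real^'v) set list"
  assumes "coxeter_matrix m"
    and "(x, I) \<in> Cham m J" and "(y, K) \<in> Cham m J"
    and "geodesic m J (chamber_of m (x, I)) (chamber_of m (y, K)) p"
    and "geodesic m J (chamber_of m (x, I)) (chamber_of m (y, K)) p'"
  shows "(codim2_step m J)\<^sup>*\<^sup>* p p'"
  using coxeter.geodesics_related[OF coxeter.intro[OF assms(1)] assms(2-)] .

end
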